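(* Let $\{\xi_{j,n}:1\le j\le n\}$ be a centered triangular array as in the context. Suppose that $\sigma_n\to\infty$, that the $\xi_{j,n}$ are bounded, and that $\phi_n(j)\le B_ne^{-a_nj^\eta}$ (for all $n$ and $1\le j\le n$) for some sequences $a_n>0$, $B_n\ge1$ with $(a_n)$ bounded, and a constant $\eta>0$. Fix $v>1$ and set $$R_n=A_n(K_{\infty,n}j_n+1)B_ne^{a_n^{-v}},\qquad K_{\infty,n}=\max_{j\le n}\|\xi_{j,n}\|_{L^\infty},$$ and assume that $R_n=o(\sigma_n^{1/3})$. Let $Z$ be a standard normal random variable. Then there is a constant $C>0$ such that for every integer $p>2$, $$\big|\mathbb E[S_n^p]-\sigma_n^p\mathbb E[Z^p]\big|\le R_nC^p(p!)^{2+\eta^{-1}}\sum_{1\le u\le(p-1)/2}\frac{R_n^u\sigma_n^{2u}p^u}{(u!)^2}=O(R_n^p\sigma_n^{p-1}).$$ Thus, if $R_n^p/\sigma_n=o(1)$ then $\lim_{n\to\infty}\mathbb E[(S_n/\sigma_n)^p]=\mathbb E[Z^p]$. In particular, the latter convergence holds for all $p$ if $R_n=o(\sigma_n^{\varepsilon})$ for all $\varepsilon>0$ (which is the case, with $R_n$ bounded when $j_n$ is chosen constant, if $\sup_n\max_j\|\xi_{j,n}\|_{L^\infty}<\infty$ and $\phi(j)\le Ae^{-aj^\eta}$ for some positive constants $A,a,\eta$).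
   Context: Setting. For each $n$, $\zeta_{1,n},\dots,\zeta_{n,n}$ are random variables on a probability space $(\Omega,\mathcal F,\mathbb P)$ taking values in measurable spaces; $\xi_{j,n}=g_{j,n}(\zeta_{j,n})$ with $g_{j,n}$ real-valued measurable, $\mathbb E[\xi_{j,n}]=0$; $S_n=\sum_{j=1}^n\xi_{j,n}$, $\sigma_n=\sqrt{\mathrm{Var}(S_n)}$, $K_{r,n}=\max_{1\le j\le n}\|\xi_{j,n}\|_{L^r}$. Mixing. $\alpha(\mathcal G,\mathcal H)=\sup\{|\mathbb P(A\cap B)-\mathbb P(A)\mathbb P(B)|:A\in\mathcal G,B\in\mathcal H\}$, $\phi(\mathcal G,\mathcal H)=\sup\{|\mathbb P(B|A)-\mathbb P(B)|:A\in\mathcal G,B\in\mathcal H,\mathbb P(A)>0\}$. For $k\le n$, $\alpha_n(k)$ (resp. $\phi_n(k)$) is the supremum over $s\le n-k$ of $\alpha$ (resp. $\phi$) of the pair $\sigma\{\zeta_{j,n}:j\le s\}$, $\sigma\{\zeta_{j,n}:s+k\le j\le n\}$; $\phi(k)=\sup_n\phi_n(k)$. Sequences. Fix exponents $2<p_0<q_0$ (unrelated to the integer $p$ in the claim). $\Gamma_n(x)=\sum_{x\le j\le n}(\alpha_n(j))^{1/p_0-1/q_0}$; $\Gamma_n^{-1}(y)$ is the smallest positive integer $m$ with $\Gamma_n(m)\le y$; $r_n=\max\big(\Gamma_n^{-1}(\tfrac1{8K_{q_0,n}}),1\big)$; $A_n=18r_n(1+K_{2,n})$. $(j_n)$ is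 a sequence of positive integers $j_n<n$ such that $\phi_n(j_n)<\frac12-\varepsilon_0$ for some constant $\varepsilon_0>0$ not depending on $n$. *)

theory Defs
  imports "HOL-Probability.Probability" "HOL-Library.Landau_Symbols"
begin

text \<open>
  Triangular arrays are written with the row index first: \<open>\<xi> n j\<close> stands for
  \<open>\<xi>\<^sub>j\<^sub>,\<^sub>n\<close>, and only the entries with \<open>1 \<le> j \<le> n\<close> are meaningful.
  The variable \<open>\<zeta> n j\<close> takes values in the measurable space \<open>N n j\<close>, which may
  change with \<open>n\<close> and \<open>j\<close>.
\<close>

definition Lp_norm :: "'a measure \<Rightarrow> real \<Rightarrow> ('a \<Rightarrow> real) \<Rightarrow> real" where
  "Lp_norm M r X = (\<integral>\<omega>. \<bar>X \<omega>\<bar> powr r \<partial>M) powr (1 / r)"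

text \<open>Meaningful for essentially bounded \<open>X\<close> only (\<open>real_of_ereal \<infinity> = 0\<close>).\<close>

definition Linf_norm :: "'a measure \<Rightarrow> ('a \<Rightarrow> real) \<Rightarrow> real" where
  "Linf_norm M X = real_of_ereal (esssup M (\<lambda>\<omega>. ereal \<bar>X \<omega>\<bar>))"

definition K_norm :: "'a measure \<Rightarrow> (nat \<Rightarrow> nat \<Rightarrow> 'a \<Rightarrow> real) \<Rightarrow> real \<Rightarrow> nat \<Rightarrow> real" where
  "K_norm M \<xi> r n = Max ((\<lambda>j. Lp_norm M r (\<xi> n j)) ` {1..n})"

definition K_inf :: "'a measure \<Rightarrow> (nat \<Rightarrow> nat \<Rightarrow> 'a \<Rightarrow> real) \<Rightarrow> nat \<Rightarrow> real" where
  "K_inf M \<xi> n = Max ((\<lambda>j. Linf_norm M (\<xi> n j)) ` {1..n})"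

definition row_sum :: "(nat \<Rightarrow> nat \<Rightarrow> 'a \<Rightarrow> real) \<Rightarrow> nat \<Rightarrow> 'a \<Rightarrow> real" where
  "row_sum \<xi> n \<omega> = (\<Sum>j = 1..n. \<xi> n j \<omega>)"

definition row_sd :: "'a measure \<Rightarrow> (nat \<Rightarrow> nat \<Rightarrow> 'a \<Rightarrow> real) \<Rightarrow> nat \<Rightarrow> real" where
  "row_sd M \<xi> n = sqrt (prob_space.variance M (row_sum \<xi> n))"

definition alpha_coeff :: "'a measure \<Rightarrow> 'a set set \<Rightarrow> 'a set set \<Rightarrow> real" where
  "alpha_coeff M G H =
     Sup {\<bar>measure M (A \<inter> B) - measure M A * measure M B\<bar> | A B. A \<in> G \<and> B \<in> H}"

definition phi_coeff :: "'a measure \<Rightarrow> 'a set set \<Rightarrow> 'a set set \<Rightarrow> real" where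
  "phi_coeff M G H =
     Sup {\<bar>measure M (A \<inter> B) / measure M A - measure M B\<bar> | A B.
            A \<in> G \<and> B \<in> H \<and> measure M A > 0}"

definition gen_sigma ::
    "'a measure \<Rightarrow> (nat \<Rightarrow> 'b measure) \<Rightarrow> (nat \<Rightarrow> 'a \<Rightarrow> 'b) \<Rightarrow> nat set \<Rightarrow> 'a set set" where
  "gen_sigma M N \<zeta> J =
     sigma_sets (space M) (\<Union>j\<in>J. {\<zeta> j -` A \<inter> space M | A. A \<in> sets (N j)})"

text \<open>
  The value \<open>s = 0\<close> gives the trivial \<open>\<sigma>\<close>-algebra and contributes \<open>0\<close> to the suprema; it keeps
  the index set nonempty when \<open>k = n\<close>.
\<close>

definition alpha_row ::
    "'a measure \<Rightarrow> (nat \<Rightarrow> nat \<Rightarrow> 'b measure) \<Rightarrow> (nat \<Rightarrow> nat \<Rightarrow> 'a \<Rightarrow> 'b) \<Rightarrow> nat \<Rightarrow> nat \<Rightarrow> real" where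
  "alpha_row M N \<zeta> n k =
     (SUP s\<in>{0..n - k}. alpha_coeff M (gen_sigma M (N n) (\<zeta> n) {1..s})
                                      (gen_sigma M (N n) (\<zeta> n) {s + k..n}))"

definition phi_row ::
    "'a measure \<Rightarrow> (nat \<Rightarrow> nat \<Rightarrow> 'b measure) \<Rightarrow> (nat \<Rightarrow> nat \<Rightarrow> 'a \<Rightarrow> 'b) \<Rightarrow> nat \<Rightarrow> nat \<Rightarrow> real" where
  "phi_row M N \<zeta> n k =
     (SUP s\<in>{0..n - k}. phi_coeff M (gen_sigma M (N n) (\<zeta> n) {1..s})
                                    (gen_sigma M (N n) (\<zeta> n) {s + k..n}))"

definition phi_sup ::
    "'a measure \<Rightarrow> (nat \<Rightarrow> nat \<Rightarrow> 'b measure) \<Rightarrow> (nat \<Rightarrow> nat \<Rightarrow> 'a \<Rightarrow> 'b) \<Rightarrow> nat \<Rightarrow> real" where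
  "phi_sup M N \<zeta> k = (SUP n\<in>{k..}. phi_row M N \<zeta> n k)"

definition Gamma_row ::
    "'a measure \<Rightarrow> (nat \<Rightarrow> nat \<Rightarrow> 'b measure) \<Rightarrow> (nat \<Rightarrow> nat \<Rightarrow> 'a \<Rightarrow> 'b) \<Rightarrow>
     real \<Rightarrow> real \<Rightarrow> nat \<Rightarrow> nat \<Rightarrow> real" where
  "Gamma_row M N \<zeta> p0 q0 n x = (\<Sum>j = x..n. alpha_row M N \<zeta> n j powr (1 / p0 - 1 / q0))"

text \<open>
  The argument \<open>y\<close> is extended real so that \<open>1 / (8 K)\<close> below is \<open>\<infinity>\<close>, rather than \<open>0\<close>, for a row
  that vanishes almost surely.
\<close>

definition Gamma_inv ::
    "'a measure \<Rightarrow> (nat \<Rightarrow> nat \<Rightarrow> 'b measure) \<Rightarrow> (nat \<Rightarrow> nat \<Rightarrow> 'a \<Rightarrow> 'b) \<Rightarrow>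
     real \<Rightarrow> real \<Rightarrow> nat \<Rightarrow> ereal \<Rightarrow> nat" where
  "Gamma_inv M N \<zeta> p0 q0 n y = (LEAST m. 1 \<le> m \<and> ereal (Gamma_row M N \<zeta> p0 q0 n m) \<le> y)"

definition r_row ::
    "'a measure \<Rightarrow> (nat \<Rightarrow> nat \<Rightarrow> 'b measure) \<Rightarrow> (nat \<Rightarrow> nat \<Rightarrow> 'a \<Rightarrow> 'b) \<Rightarrow>
     (nat \<Rightarrow> nat \<Rightarrow> 'a \<Rightarrow> real) \<Rightarrow> real \<Rightarrow> real \<Rightarrow> nat \<Rightarrow> nat" where
  "r_row M N \<zeta> \<xi> p0 q0 n =
     max (Gamma_inv M N \<zeta> p0 q0 n (1 / (8 * ereal (K_norm M \<xi> q0 n)))) 1"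

definition A_row ::
    "'a measure \<Rightarrow> (nat \<Rightarrow> nat \<Rightarrow> 'b measure) \<Rightarrow> (nat \<Rightarrow> nat \<Rightarrow> 'a \<Rightarrow> 'b) \<Rightarrow>
     (nat \<Rightarrow> nat \<Rightarrow> 'a \<Rightarrow> real) \<Rightarrow> real \<Rightarrow> real \<Rightarrow> nat \<Rightarrow> real" where
  "A_row M N \<zeta> \<xi> p0 q0 n = 18 * real (r_row M N \<zeta> \<xi> p0 q0 n) * (1 + K_norm M \<xi> 2 n)"

definition R_row ::
    "'a measure \<Rightarrow> (nat \<Rightarrow> nat \<Rightarrow> 'b measure) \<Rightarrow> (nat \<Rightarrow> nat \<Rightarrow> 'a \<Rightarrow> 'b) \<Rightarrow>
     (nat \<Rightarrow> nat \<Rightarrow> 'a \<Rightarrow> real) \<Rightarrow> real \<Rightarrow> real \<Rightarrow> real \<Rightarrow>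
     (nat \<Rightarrow> real) \<Rightarrow> (nat \<Rightarrow> real) \<Rightarrow> (nat \<Rightarrow> nat) \<Rightarrow> nat \<Rightarrow> real" where
  "R_row M N \<zeta> \<xi> p0 q0 v a B j n =
     A_row M N \<zeta> \<xi> p0 q0 n * (K_inf M \<xi> n * real (j n) + 1) * B n * exp (a n powr (- v))"

end

theory Submission
  imports Defs
begin

unbundle no vec_syntax and fps_syntax

text \<open>
  Cut the row into consecutive blocks, ending a block as soon as its \<open>L\<^sup>2\<close>-norm exceeds a level
  \<open>A\<close>.  By mixing, the covariance of a block with everything to its right is a small fraction of the
  variance of the block, so there are only \<open>u = O((\<sigma> / A)\<^sup>2)\<close> blocks \<open>X\<^sub>1, \<dots>, X\<^sub>u\<close>.  An inequality of
  Hoffmann-Jorgensen type bounds their \<open>L\<^sup>p\<close>-norms by a multiple of \<open>p A\<close> and yields the crude bound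
  \<open>E \<bar>S\<bar>\<^sup>p \<le> C\<^sup>p p! \<sigma>\<^sup>p\<close>.

  Let \<open>F l t\<close> be the formal power series \<open>E exp (z (X\<^sub>l + \<dots> + X\<^sub>t))\<close> and \<open>\<rho> l t = F l t / F l (t - 1)\<close>.  Then
  \<open>F 1 u\<close> is the product of the \<open>\<rho> 1 t\<close>.  The difference \<open>\<rho> l t - \<rho> (l + 1) t\<close> has numerator
  \<open>F l t F (l+1) (t-1) - F (l+1) t F l (t-1)\<close>, which decays in \<open>t - l\<close> by mixing; summing over \<open>l\<close> shows
  that the \<open>k\<close>-th coefficient of \<open>\<rho> 1 t\<close> is at most \<open>q\<^sup>k\<close>, uniformly in \<open>t\<close>.  Hence \<open>F 1 u\<close> equals
  \<open>exp (\<sigma>\<^sup>2 z\<^sup>2 / 2)\<close> times a series \<open>1 + O(z\<^sup>3)\<close> whose \<open>j\<close>-th coefficient is at most \<open>(4 q)\<^sup>j\<close> times \<open>u\<close> to the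
  power \<open>j div 3\<close>, which is the claim as long as \<open>p\<close> is small compared with \<open>\<sigma>\<close>.  For the remaining \<open>p\<close> a
  fixed power of \<open>p\<close> exceeds \<open>\<sigma>\<close> and the crude bound suffices.

  Of \<open>R\<^sub>n\<close> only the lower bound \<open>R\<^sub>n \<ge> (1 + K\<^sub>\<infinity>) B\<^sub>n exp (a\<^sub>n powr - v)\<close> matters: block lengths and gaps enter
  through arbitrarily small powers of \<open>B\<^sub>n exp (a\<^sub>n powr - v)\<close>.
\<close>

section \<open>Formal power series close to a Gaussian\<close>

text \<open>Formal series are used because only coefficients of order at most \<open>p\<close> are
  under control, and no convergence is ever needed. The obstacle is the number \<open>u\<close> of
  blocks, of order (\<sigma>/A)^2: it makes a direct bound of the moments far too large. Dividing
  \<open>F 1 t\<close> by \<open>F 1 (t - 1)\<close> leaves coefficients bounded independently of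
  \<open>u\<close>. All first coefficients vanish, and matching the Gaussian removes the second, so
  a nontrivial factor costs at least three degrees and degree \<open>j\<close> involves at most
  \<open>j div 3\<close> of the \<open>u\<close> factors. Compared with the Gaussian size,
  \<open>u ^ (j div 3)\<close> is about \<sigma>^(2j/3) instead of \<sigma>^j. The gain of
  \<sigma>^(-1/3) per degree pays for \<open>4 * q = A * h\<close> as soon as \<open>h ^ 3\<close>
  is at most \<sigma>/A; this is the origin of the cubes. Mixing enters as polynomial decay of every
  order, with constants polynomial in the order. Degree \<open>k\<close> uses order
  \<open>k + 2\<close>: \<open>k\<close> powers of the window length pay for the words of length
  \<open>k\<close>, two more make the sum over \<open>l\<close> converge.\<close>

definition gauss_fps :: "real \<Rightarrow> real fps" where
  "gauss_fps c = Abs_fps (\<lambda>k. if even k then c ^ (k div 2) / fact (k div 2) else 0)"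

lemma gauss_fps_nth: "gauss_fps c $ k = (if even k then c ^ (k div 2) / fact (k div 2) else 0)"
  by (simp add: gauss_fps_def)

lemma gauss_fps_0: "gauss_fps 0 = 1"
  by (rule fps_ext) (auto simp: gauss_fps_nth elim!: evenE)

text \<open>\<open>gauss_fps c\<close> is the series of exp(c z^2), so this is the functional
  equation of exp; only even indices contribute and the binomial theorem remains. In particular
  \<open>gauss_fps (- c)\<close> inverts \<open>gauss_fps c\<close>.\<close>

lemma gauss_fps_add: "gauss_fps (a + b) = gauss_fps a * gauss_fps b"
proof (rule fps_ext)
  fix n
  show "gauss_fps (a + b) $ n = (gauss_fps a * gauss_fps b) $ n"
  proof (cases "even n")
    case False
    have "gauss_fps a $ i * gauss_fps b $ (n - i) = 0" if "i \<le> n" for i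
      using False that by (auto simp: gauss_fps_nth)
    then have "(gauss_fps a * gauss_fps b) $ n = 0" unfolding fps_mult_nth by (intro sum.neutral) auto
    then show ?thesis using False by (simp add: gauss_fps_nth)
  next
    case True
    then obtain m where m: "n = 2 * m" by (elim evenE)
    have "(gauss_fps a * gauss_fps b) $ n = (\<Sum>i=0..2*m. gauss_fps a $ i * gauss_fps b $ (2*m - i))"
      by (simp add: fps_mult_nth m)
    also have "\<dots> = (\<Sum>i\<in>(\<lambda>j. 2*j) ` {..m}. gauss_fps a $ i * gauss_fps b $ (2*m - i))"
    proof (rule sum.mono_neutral_right)
      show "\<forall>i\<in>{0..2 * m} - (\<lambda>j. 2*j) ` {..m}. gauss_fps a $ i * gauss_fps b $ (2 * m - i) = 0"
      proof
        fix i assume "i \<in> {0..2 * m} - (\<lambda>j. 2*j) ` {..m}"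
        then have "odd i" by (auto elim!: evenE)
        then show "gauss_fps a $ i * gauss_fps b $ (2 * m - i) = 0" by (simp add: gauss_fps_nth)
      qed
    qed auto
    also have "\<dots> = (\<Sum>j\<le>m. gauss_fps a $ (2*j) * gauss_fps b $ (2*m - 2*j))"
      by (subst sum.reindex) (auto simp: inj_on_def)
    also have "\<dots> = (\<Sum>j\<le>m. a ^ j / fact j * (b ^ (m - j) / fact (m - j)))"
      by (rule sum.cong) (auto simp: gauss_fps_nth simp flip: diff_mult_distrib2)
    also have "\<dots> = (\<Sum>j\<le>m. of_nat (m choose j) * a ^ j * b ^ (m - j) / fact m)"
      by (rule sum.cong) (auto simp: binomial_fact)
    also have "\<dots> = (a + b) ^ m / fact m"
      by (simp add: binomial_ring sum_divide_distrib)
    finally show ?thesis by (simp add: gauss_fps_nth m)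
  qed
qed

text \<open>The recursion for the inverse expresses coefficient \<open>k\<close> through all earlier
  ones. The ratio 2 is what makes the geometric sum 1 + 2 + ... + 2^(k-1) stay below 2^k.\<close>

lemma inverse_fps_nth_bound:
  fixes f :: "real fps"
  assumes f0: "f $ 0 = 1" and x: "x \<ge> 0" and b: "\<And>i. i \<le> p \<Longrightarrow> \<bar>f $ i\<bar> \<le> x ^ i"
  shows "k \<le> p \<Longrightarrow> \<bar>inverse f $ k\<bar> \<le> (2 * x) ^ k"
proof (induction k rule: less_induct)
  case (less k)
  show ?case
  proof (cases k)
    case 0
    then show ?thesis using f0 by simp
  next
    case (Suc k')
    have "inverse f * f = 1" using f0 by (intro inverse_mult_eq_1) auto
    then have "(inverse f * f) $ k = 0" using Suc by simp
    then have "(\<Sum>i=0..k. inverse f $ i * f $ (k - i)) = 0" by (simp add: fps_mult_nth)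
    then have "inverse f $ k = - (\<Sum>i<k. inverse f $ i * f $ (k - i))"
      using f0 by (simp add: atLeast0AtMost lessThan_Suc_atMost[symmetric] del: lessThan_Suc_atMost)
    then have "\<bar>inverse f $ k\<bar> \<le> (\<Sum>i<k. \<bar>inverse f $ i * f $ (k - i)\<bar>)"
      using sum_abs[of "\<lambda>i. inverse f $ i * f $ (k - i)" "{..<k}"] by simp
    also have "\<dots> \<le> (\<Sum>i<k. (2*x)^i * x^(k-i))"
      using less b by (intro sum_mono) (auto simp: abs_mult x intro!: mult_mono)
    also have "\<dots> = (\<Sum>i<k. 2^i * x^k)"
      by (intro sum.cong) (auto simp: power_mult_distrib simp flip: power_add)
    also have "\<dots> = (2^k - 1) * x^k"
      by (simp add: geometric_sum flip: sum_distrib_right)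
    also have "\<dots> \<le> (2*x)^k" using x by (simp add: power_mult_distrib algebra_simps)
    finally show ?thesis .
  qed
qed

text \<open>Dividing by the Gaussian with the same second coefficient cancels z^2, and z^1 is absent
  from both, so the quotient is 1 + O(z^3). The price is a doubled growth rate.\<close>

lemma gauss_quotient_bound:
  fixes r :: "real fps"
  assumes r0: "r $ 0 = 1" and r1: "r $ 1 = 0" and q: "q \<ge> 0"
    and b: "\<And>k. k \<le> p \<Longrightarrow> \<bar>r $ k\<bar> \<le> q ^ k" and p: "2 \<le> p"
  defines "\<tau> \<equiv> r * gauss_fps (- (r $ 2)) - 1"
  shows "\<tau> $ 0 = 0" "\<tau> $ 1 = 0" "\<tau> $ 2 = 0" "k \<le> p \<Longrightarrow> \<bar>\<tau> $ k\<bar> \<le> (2 * q) ^ k"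
proof -
  show t0: "\<tau> $ 0 = 0" using r0 by (simp add: \<tau>_def gauss_fps_nth)
  show "\<tau> $ 1 = 0" using r0 r1 by (simp add: \<tau>_def gauss_fps_nth fps_mult_nth)
  show "\<tau> $ 2 = 0" using r0 r1 by (simp add: \<tau>_def gauss_fps_nth fps_mult_nth numeral_2_eq_2)
  assume k: "k \<le> p"
  show "\<bar>\<tau> $ k\<bar> \<le> (2 * q) ^ k"
  proof (cases "k = 0")
    case False
    have g: "\<bar>gauss_fps (- (r $ 2)) $ i\<bar> \<le> q ^ i" for i
    proof (cases "even i")
      case True
      then obtain j where j: "i = 2 * j" by (elim evenE)
      have "\<bar>gauss_fps (- (r $ 2)) $ i\<bar> = \<bar>r $ 2\<bar> ^ j / fact j"
        by (simp add: gauss_fps_nth j power_abs)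
      also have "\<dots> \<le> \<bar>r $ 2\<bar> ^ j / 1" by (intro divide_left_mono) (auto simp: fact_ge_1)
      also have "\<dots> \<le> (q ^ 2) ^ j / 1" using b[of 2] p by (intro divide_right_mono power_mono) auto
      finally show ?thesis by (simp add: j power_mult)
    qed (simp add: gauss_fps_nth q)
    have "\<bar>\<tau> $ k\<bar> = \<bar>\<Sum>i=0..k. r $ i * gauss_fps (- (r $ 2)) $ (k - i)\<bar>"
      using False by (simp add: \<tau>_def fps_mult_nth)
    also have "\<dots> = \<bar>\<Sum>i\<in>insert 0 {2..k}. r $ i * gauss_fps (- (r $ 2)) $ (k - i)\<bar>"
    proof (intro arg_cong[where f=abs] sum.mono_neutral_right ballI)
      fix i assume "i \<in> {0..k} - insert 0 {2..k}"
      then have "i = 1" by auto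
      then show "r $ i * gauss_fps (- (r $ 2)) $ (k - i) = 0" using r1 by simp
    qed (use False in auto)
    also have "\<dots> \<le> (\<Sum>i\<in>insert 0 {2..k}. \<bar>r $ i * gauss_fps (- (r $ 2)) $ (k - i)\<bar>)"
      by (rule sum_abs)
    also have "\<dots> \<le> (\<Sum>i\<in>insert 0 {2..k}. q ^ k)"
    proof (rule sum_mono)
      fix i assume i: "i \<in> insert 0 {2..k}"
      have "\<bar>r $ i * gauss_fps (- (r $ 2)) $ (k - i)\<bar> \<le> q ^ i * q ^ (k - i)"
        unfolding abs_mult using b[of i] i k q g by (intro mult_mono) auto
      also have "\<dots> = q ^ k" using i by (auto simp flip: power_add)
      finally show "\<bar>r $ i * gauss_fps (- (r $ 2)) $ (k - i)\<bar> \<le> q ^ k" .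
    qed
    \<comment> \<open>The index 1 was dropped, so exactly \<open>k\<close> summands are
      left.\<close>
    also have "\<dots> = real k * q ^ k" using False by simp
    also have "\<dots> \<le> 2 ^ k * q ^ k"
      using q of_nat_less_two_power[of k, where 'a=real] by (intro mult_right_mono) auto
    finally show ?thesis by (simp add: power_mult_distrib)
  qed (simp add: t0)
qed

text \<open>Each nontrivial choice in the product uses up at least three degrees, so degree
  \<open>j\<close> admits at most \<open>j div 3\<close> of them, each among \<open>u\<close>
  factors. The induction telescopes over the factors: the last nontrivial one contributes one power
  of \<open>u\<close> and leaves degree at most \<open>j - 3\<close>.\<close>

lemma prod_one_plus_cubic_bound:
  fixes \<Psi> \<tau> :: "nat \<Rightarrow> real fps"
  assumes P0: "\<Psi> 0 = 1" and PS: "\<And>t. t < u \<Longrightarrow> \<Psi> (Suc t) = \<Psi> t * (1 + \<tau> t)"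
    and t0: "\<And>t i. t < u \<Longrightarrow> i < 3 \<Longrightarrow> \<tau> t $ i = 0"
    and tb: "\<And>t i. t < u \<Longrightarrow> i \<le> p \<Longrightarrow> \<bar>\<tau> t $ i\<bar> \<le> (2 * q) ^ i" and q: "q \<ge> 0"
  shows "j \<le> p \<Longrightarrow> t \<le> u \<Longrightarrow> 
    \<bar>\<Psi> t $ j\<bar> \<le> (4 * q) ^ j * real u ^ (j div 3) \<and> (0 < j \<longrightarrow> j < 3 \<longrightarrow> \<Psi> t $ j = 0) \<and> \<Psi> t $ 0 = 1"
proof (induction j arbitrary: t rule: less_induct)
  case (less j)
  have step: "\<Psi> (Suc s) $ j = \<Psi> s $ j + (\<Sum>i=3..j. \<Psi> s $ (j - i) * \<tau> s $ i)" if s: "s < u" for s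
  proof -
    have "(\<tau> s * \<Psi> s) $ j = (\<Sum>i=0..j. \<tau> s $ i * \<Psi> s $ (j - i))" by (simp add: fps_mult_nth)
    also have "\<dots> = (\<Sum>i=3..j. \<tau> s $ i * \<Psi> s $ (j - i))"
      using t0[OF s] by (intro sum.mono_neutral_right) auto
    finally show ?thesis using PS[OF s] by (simp add: algebra_simps)
  qed
  have tel: "\<Psi> t $ j = (1 :: real fps) $ j + (\<Sum>s<t. \<Sum>i=3..j. \<Psi> s $ (j - i) * \<tau> s $ i)" if "t \<le> u" for t
    using that
  proof (induction t)
    case (Suc t)
    then show ?case using step[of t] by simp
  qed (simp add: P0)
  show ?case
  proof (cases "j < 3")
    case True
    then have "\<Psi> t $ j = (1 :: real fps) $ j" using tel[OF less.prems(2)] by simp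
    moreover have "\<Psi> t $ 0 = 1" using tel[of t] less.prems True by (cases "j = 0") (use less.IH[of 0 t] less.prems in auto)
    ultimately show ?thesis using True q by (cases "j = 0") auto
  next
    case False
    have "\<bar>\<Psi> t $ j\<bar> \<le> (\<Sum>s<t. \<Sum>i=3..j. \<bar>\<Psi> s $ (j - i) * \<tau> s $ i\<bar>)"
      using tel[OF less.prems(2)] False
      by (simp, intro order.trans[OF sum_abs] sum_mono sum_abs)
    also have "\<dots> \<le> (\<Sum>s<t. \<Sum>i=3..j. (4 * q) ^ j * real u ^ (j div 3 - 1) * (1/2) ^ i)"
    proof (intro sum_mono)
      fix s i assume s: "s \<in> {..<t}" and i: "i \<in> {3..j}"
      have su: "s < u" using s less.prems by auto
      have u1: "real u \<ge> 1" using su by auto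
      have "\<bar>\<Psi> s $ (j - i)\<bar> \<le> (4 * q) ^ (j - i) * real u ^ ((j - i) div 3)"
        using less.IH[of "j - i" s] i su less.prems by auto
      also have "\<dots> \<le> (4 * q) ^ (j - i) * real u ^ (j div 3 - 1)"
      proof (intro mult_left_mono power_increasing u1)
        have "(j - i) div 3 \<le> (j - 3) div 3" using i by (intro div_le_mono) auto
        also have "\<dots> = j div 3 - 1" using False by (simp add: div_if[of j 3])
        finally show "(j - i) div 3 \<le> j div 3 - 1" .
      qed (use q in auto)
      finally have 1: "\<bar>\<Psi> s $ (j - i)\<bar> \<le> (4 * q) ^ (j - i) * real u ^ (j div 3 - 1)" .
      have 2: "\<bar>\<tau> s $ i\<bar> \<le> (2 * q) ^ i" using tb[OF su, of i] i less.prems by auto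
      have "\<bar>\<Psi> s $ (j - i) * \<tau> s $ i\<bar> \<le> ((4 * q) ^ (j - i) * real u ^ (j div 3 - 1)) * (2 * q) ^ i"
        unfolding abs_mult using 1 2 q by (intro mult_mono) auto
      \<comment> \<open>The slack between the rates \<open>2 * q\<close> and \<open>4 * q\<close> is
        a geometric weight that makes the sum over \<open>i\<close> harmless.\<close>
      also have "(2 * q) ^ i = (4 * q) ^ i * (1/2) ^ i" unfolding power_mult_distrib[symmetric] by simp
      also have "((4 * q) ^ (j - i) * real u ^ (j div 3 - 1)) * \<dots> = (4 * q) ^ (j - i + i) * real u ^ (j div 3 - 1) * (1/2) ^ i"
        unfolding power_add by simp
      finally show "\<bar>\<Psi> s $ (j - i) * \<tau> s $ i\<bar> \<le> (4 * q) ^ j * real u ^ (j div 3 - 1) * (1/2) ^ i"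
        using i by simp
    qed
    also have "\<dots> = real t * ((4 * q) ^ j * real u ^ (j div 3 - 1) * (\<Sum>i=3..j. (1/2) ^ i))"
      by (simp add: sum_distrib_left)
    also have "\<dots> \<le> real u * ((4 * q) ^ j * real u ^ (j div 3 - 1) * 1)"
    proof (intro mult_mono mult_left_mono)
      have "(\<Sum>i=3..j. (1/2::real) ^ i) = ((1/2)^3 - (1/2)^Suc j) / (1 - 1/2)"
        using sum_gp[of "1/2::real" 3 j] False by simp
      also have "\<dots> \<le> 1" using zero_le_power[of "1/2::real" j] by (simp add: power3_eq_cube del: zero_le_power)
      finally show "(\<Sum>i=3..j. (1/2::real) ^ i) \<le> 1" .
    qed (use q less.prems in \<open>auto intro!: sum_nonneg mult_nonneg_nonneg\<close>)
    also have "\<dots> = (4 * q) ^ j * real u ^ (j div 3)"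
    proof -
      have "j div 3 = Suc (j div 3 - 1)" using False by (simp add: div_if[of j 3])
      then have "real u ^ (j div 3) = real u * real u ^ (j div 3 - 1)" by (metis power_Suc)
      then show ?thesis by simp
    qed
    finally have "\<bar>\<Psi> t $ j\<bar> \<le> (4 * q) ^ j * real u ^ (j div 3)" .
    then show ?thesis using False less.IH[of 0 t] less.prems by auto
  qed
qed


text \<open>The Gaussian corrections of the single factors multiply to one Gaussian with parameter
  \<open>v\<close>, and multiplying back recovers the product. In the resulting convolution index 0
  is the Gaussian coefficient itself, indices 1 and 2 vanish, and odd \<open>p - j\<close> drop out
  because the Gaussian is even.\<close>

lemma prod_near_gauss_fps:
  fixes r :: "nat \<Rightarrow> real fps"
  assumes r0: "\<And>t. t < u \<Longrightarrow> r t $ 0 = 1" and r1: "\<And>t. t < u \<Longrightarrow> r t $ 1 = 0"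
    and b: "\<And>t k. t < u \<Longrightarrow> k \<le> p \<Longrightarrow> \<bar>r t $ k\<bar> \<le> q ^ k" and q: "q \<ge> 0" and p: "3 \<le> p"
  defines "v \<equiv> \<Sum>t<u. r t $ 2"
  shows "\<bar>(\<Prod>t<u. r t) $ p - gauss_fps v $ p\<bar>
    \<le> (\<Sum>j | j \<in> {3..p} \<and> even (p - j). (4 * q) ^ j * real u ^ (j div 3) * \<bar>v\<bar> ^ ((p - j) div 2))"
proof -
  define \<tau> where "\<tau> t = r t * gauss_fps (- (r t $ 2)) - 1" for t
  define \<Psi> where "\<Psi> t = (\<Prod>s<t. r s) * gauss_fps (- (\<Sum>s<t. r s $ 2))" for t
  have tau: "\<tau> t $ 0 = 0" "\<tau> t $ 1 = 0" "\<tau> t $ 2 = 0" "i \<le> p \<Longrightarrow> \<bar>\<tau> t $ i\<bar> \<le> (2 * q) ^ i" if "t < u" for t i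
    using gauss_quotient_bound[of "r t" q p] r0[OF that] r1[OF that] b[OF that] q p unfolding \<tau>_def by auto
  have P0: "\<Psi> 0 = 1" by (simp add: \<Psi>_def gauss_fps_0)
  have PS: "\<Psi> (Suc t) = \<Psi> t * (1 + \<tau> t)" for t
  proof -
    have "gauss_fps (- (\<Sum>s<Suc t. r s $ 2)) = gauss_fps (- (\<Sum>s<t. r s $ 2)) * gauss_fps (- (r t $ 2))"
      by (subst gauss_fps_add[symmetric]) simp
    then show ?thesis by (simp add: \<Psi>_def \<tau>_def)
  qed
  have t0: "\<tau> t $ i = 0" if "t < u" "i < 3" for t i
  proof -
    have "i = 0 \<or> i = 1 \<or> i = 2" using that(2) by auto
    then show ?thesis using tau(1-3)[OF that(1)] by auto
  qed
  have \<Psi>: "\<bar>\<Psi> u $ j\<bar> \<le> (4 * q) ^ j * real u ^ (j div 3)" "0 < j \<Longrightarrow> j < 3 \<Longrightarrow> \<Psi> u $ j = 0" "\<Psi> u $ 0 = 1"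
    if "j \<le> p" for j
    using prod_one_plus_cubic_bound[of \<Psi> u \<tau> p q j u, OF P0 PS t0 tau(4) q that] by auto
  have "\<Psi> u * gauss_fps v = (\<Prod>t<u. r t) * gauss_fps (- v + v)"
    unfolding \<Psi>_def v_def[symmetric] gauss_fps_add by (simp add: mult.assoc)
  then have "(\<Prod>t<u. r t) $ p = (\<Psi> u * gauss_fps v) $ p" by (simp add: gauss_fps_0)
  also have "\<dots> = (\<Sum>i=0..p. \<Psi> u $ i * gauss_fps v $ (p - i))" by (simp add: fps_mult_nth)
  also have "\<dots> = gauss_fps v $ p + (\<Sum>i=Suc 0..p. \<Psi> u $ i * gauss_fps v $ (p - i))"
    using \<Psi>(3)[of 0] by (subst sum.atLeast_Suc_atMost) auto
  also have "(\<Sum>i=Suc 0..p. \<Psi> u $ i * gauss_fps v $ (p - i)) =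
     (\<Sum>i | i \<in> {3..p} \<and> even (p - i). \<Psi> u $ i * gauss_fps v $ (p - i))"
    using \<Psi>(2) by (intro sum.mono_neutral_right) (auto simp: gauss_fps_nth not_le)
  finally have "\<bar>(\<Prod>t<u. r t) $ p - gauss_fps v $ p\<bar> \<le>
     (\<Sum>i | i \<in> {3..p} \<and> even (p - i). \<bar>\<Psi> u $ i * gauss_fps v $ (p - i)\<bar>)"
    by simp
  also have "\<dots> \<le> (\<Sum>j | j \<in> {3..p} \<and> even (p - j). (4 * q) ^ j * real u ^ (j div 3) * \<bar>v\<bar> ^ ((p - j) div 2))"
  proof (intro sum_mono)
    fix i assume i: "i \<in> {j. j \<in> {3..p} \<and> even (p - j)}"
    have ev: "even (p - i)" using i by blast
    have "\<bar>gauss_fps v $ (p - i)\<bar> = \<bar>v\<bar> ^ ((p - i) div 2) / fact ((p - i) div 2)"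
      unfolding gauss_fps_nth if_P[OF ev] abs_divide power_abs by (simp only: abs_of_pos[OF fact_gt_zero])
    also have "\<dots> \<le> \<bar>v\<bar> ^ ((p - i) div 2) / 1" by (intro divide_left_mono) (auto simp: fact_ge_1)
    finally have g: "\<bar>gauss_fps v $ (p - i)\<bar> \<le> \<bar>v\<bar> ^ ((p - i) div 2)" by simp
    show "\<bar>\<Psi> u $ i * gauss_fps v $ (p - i)\<bar> \<le> (4 * q) ^ i * real u ^ (i div 3) * \<bar>v\<bar> ^ ((p - i) div 2)"
      unfolding abs_mult using g \<Psi>(1)[of i] i q by (intro mult_mono) auto
  qed
  finally show ?thesis .
qed

text \<open>Units: \<sigma> is \<open>A * s\<close> and the growth rate \<open>4 * q\<close> is
  \<open>A * h\<close>. Each summand must not exceed the power \<open>2 * ((p - 1) div 2)\<close> of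
  \<open>s\<close>; surplus powers of \<open>h\<close> beyond the sixth are traded for powers of
  \<open>s\<close> by means of \<open>h ^ 3 \<le> s\<close>.\<close>

lemma gauss_error_numeric:
  fixes A h s :: real
  assumes A: "A > 0" and h: "h \<ge> 1" and s: "s \<ge> h ^ 3" and u: "real u \<le> 3 * s\<^sup>2" and p: "3 \<le> p"
  shows "(\<Sum>j | j \<in> {3..p} \<and> even (p - j). (A * h) ^ j * real u ^ (j div 3) * ((A * s)\<^sup>2 / 2) ^ ((p - j) div 2))
    \<le> real p * 3 ^ p * A ^ p * h ^ 6 * s ^ (2 * ((p - 1) div 2))"
proof -
  have s1: "s \<ge> 1" using h s by (meson one_le_power order_trans)
  have "(A * h) ^ j * real u ^ (j div 3) * ((A * s)\<^sup>2 / 2) ^ ((p - j) div 2)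
      \<le> 3 ^ p * A ^ p * h ^ 6 * s ^ (2 * ((p - 1) div 2))" if j: "j \<in> {3..p}" "even (p - j)" for j
  proof -
    define d where "d = j div 3"
    define e where "e = 2 * ((p - 1) div 2) - (p - j + 2 * d)"
    \<comment> \<open>\<open>e\<close> is the number of powers of \<open>s\<close> left over in this
      summand; three powers of \<open>h\<close> can be paid with each of them. Even \<open>p\<close>
      is the tight case and produces the factor \<open>h ^ 6\<close>.\<close>
    have le: "p - j + 2 * d \<le> 2 * ((p - 1) div 2) \<and> j - 6 \<le> 3 * e"
    proof -
      have d: "3 * d \<le> j" "d \<ge> 1" using j unfolding d_def by auto
      show ?thesis
      proof (cases "even p")
        case True
        then have "even j" using j by auto
        moreover have p2: "2 * ((p - 1) div 2) = p - 2" using True p by (auto elim!: evenE)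
        \<comment> \<open>For even \<open>p\<close> the index \<open>j\<close> is even as well,
          which excludes \<open>j = 3\<close>, where this would fail.\<close>
        moreover have "2 * d + 2 \<le> j"
          using \<open>even j\<close> d j by (cases "d = 1"; cases "j = 3") auto
        ultimately show ?thesis using j d p unfolding e_def p2 by auto
      next
        case False
        then have p1: "2 * ((p - 1) div 2) = p - 1" by (auto elim!: oddE)
        show ?thesis using j d p unfolding e_def p1 by auto
      qed
    qed
    have hj: "h ^ j \<le> h ^ 6 * s ^ e"
    proof -
      have "h ^ j \<le> h ^ (6 + 3 * e)" using le h by (intro power_increasing) auto
      also have "\<dots> = h ^ 6 * (h ^ 3) ^ e" by (simp add: power_add power_mult)
      also have "\<dots> \<le> h ^ 6 * s ^ e" using h s by (intro mult_left_mono power_mono) auto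
      finally show ?thesis .
    qed
    have "real u ^ d \<le> (3 * s\<^sup>2) ^ d" using u by (intro power_mono) auto
    also have "\<dots> = 3 ^ d * s ^ (2 * d)" by (simp add: power_mult_distrib power_mult)
    also have "\<dots> \<le> 3 ^ p * s ^ (2 * d)"
      using j s1 by (intro mult_right_mono power_increasing) (auto simp: d_def)
    finally have ud: "real u ^ d \<le> 3 ^ p * s ^ (2 * d)" .
    have "((A * s)\<^sup>2 / 2) ^ ((p - j) div 2) \<le> ((A * s)\<^sup>2) ^ ((p - j) div 2)"
      by (intro power_mono) auto
    also have "\<dots> = (A * s) ^ (p - j)" using j by (simp flip: power_mult)
    finally have vs: "((A * s)\<^sup>2 / 2) ^ ((p - j) div 2) \<le> (A * s) ^ (p - j)" .
    have "(A * h) ^ j * real u ^ d * ((A * s)\<^sup>2 / 2) ^ ((p - j) div 2)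
       \<le> (A ^ j * (h ^ 6 * s ^ e)) * (3 ^ p * s ^ (2 * d)) * (A * s) ^ (p - j)"
      using A s1 h hj ud vs by (intro mult_mono) (auto simp: power_mult_distrib intro!: mult_left_mono)
    also have "\<dots> = 3 ^ p * A ^ (j + (p - j)) * h ^ 6 * s ^ (e + 2 * d + (p - j))"
      by (simp add: power_mult_distrib power_add)
    also have "e + 2 * d + (p - j) = 2 * ((p - 1) div 2)" using le by (simp add: e_def)
    finally show ?thesis using j by (simp add: d_def)
  qed
  then have "(\<Sum>j | j \<in> {3..p} \<and> even (p - j). (A * h) ^ j * real u ^ (j div 3) * ((A * s)\<^sup>2 / 2) ^ ((p - j) div 2))
    \<le> of_nat (card {j. j \<in> {3..p} \<and> even (p - j)}) * (3 ^ p * A ^ p * h ^ 6 * s ^ (2 * ((p - 1) div 2)))"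
    by (intro sum_bounded_above) auto
  also have "\<dots> \<le> real p * (3 ^ p * A ^ p * h ^ 6 * s ^ (2 * ((p - 1) div 2)))"
  proof (intro mult_right_mono)
    have "card {j. j \<in> {3..p} \<and> even (p - j)} \<le> card {1..p}" by (intro card_mono) auto
    then show "real (card {j. j \<in> {3..p} \<and> even (p - j)}) \<le> real p" by simp
  qed (use A h s1 in auto)
  finally show ?thesis by simp
qed

section \<open>Covariances under \<open>\<phi>\<close>-mixing\<close>

text \<open>The sum counts the grid points below \<open>y\<close>, which is the integer part of
  \<open>y * N / T\<close>; rounding costs one mesh width.\<close>

lemma layer_sum_error:
  fixes y T :: real
  assumes "0 \<le> y" "y \<le> T" "T > 0" "N \<ge> 1"
  shows "\<bar>y - T / real N * (\<Sum>i=1..N. indicator {z. real i * T / real N \<le> z} y)\<bar> \<le> T / real N"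
proof -
  define m where "m = nat \<lfloor>y * real N / T\<rfloor>"
  have N: "real N > 0" using assms by simp
  have yN: "y * real N / T \<ge> 0" using assms by simp
  have "y * real N \<le> T * real N" using assms by (intro mult_right_mono) auto
  then have "y * real N / T \<le> real N" using assms by (simp add: divide_le_eq mult.commute)
  then have mN: "m \<le> N" using yN unfolding m_def by linarith
  have m1: "real m \<le> y * real N / T" and m2: "y * real N / T < real m + 1"
    using yN unfolding m_def by linarith+
  have iff: "real i * T / real N \<le> y \<longleftrightarrow> i \<le> m" for i
  proof -
    have "real i * T / real N \<le> y \<longleftrightarrow> real i \<le> y * real N / T"
      using assms N by (simp add: divide_le_eq le_divide_eq)
    also have "\<dots> \<longleftrightarrow> i \<le> m" using m1 m2 by linarith
    finally show ?thesis .
  qed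
  have "(\<Sum>i=1..N. indicator {z. real i * T / real N \<le> z} y) = (\<Sum>i=1..N. if i \<le> m then 1 else (0::real))"
    by (intro sum.cong refl) (simp add: indicator_def iff)
  also have "\<dots> = (\<Sum>i=1..m. 1)"
    using mN by (intro sum.mono_neutral_cong_right) auto
  finally have s: "(\<Sum>i=1..N. indicator {z. real i * T / real N \<le> z} y) = real m" by simp
  have "T / real N * real m \<le> y" using m1 assms N by (simp add: field_simps)
  moreover have "y \<le> T / real N * real m + T / real N" using m2 assms N by (simp add: field_simps)
  ultimately show ?thesis unfolding s by linarith
qed

context prob_space
begin

lemma integrable_bounded:
  fixes f :: "'a \<Rightarrow> real"
  assumes "f \<in> borel_measurable M" "\<And>\<omega>. \<omega> \<in> space M \<Longrightarrow> \<bar>f \<omega>\<bar> \<le> c"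
  shows "integrable M f"
  by (rule integrable_const_bound[of _ c]) (use assms in auto)

lemma integrable_indicator_event: "A \<in> events \<Longrightarrow> integrable M (\<lambda>\<omega>. indicator A \<omega> :: real)"
  by (rule integrable_bounded[where c=1]) (auto split: split_indicator)

lemma abs_expectation_le:
  fixes f :: "'a \<Rightarrow> real"
  assumes "f \<in> borel_measurable M" "\<And>\<omega>. \<omega> \<in> space M \<Longrightarrow> \<bar>f \<omega>\<bar> \<le> c"
  shows "\<bar>expectation f\<bar> \<le> c"
proof -
  have "\<bar>expectation f\<bar> \<le> expectation (\<lambda>\<omega>. \<bar>f \<omega>\<bar>)" using integral_abs_bound by blast
  also have "\<dots> \<le> expectation (\<lambda>\<omega>. c)"
    by (rule integral_mono) (use assms in \<open>auto intro: integrable_bounded[where c=c]\<close>)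
  finally show ?thesis by (simp add: prob_space)
qed

text \<open>Finite layer cake: \<open>U\<close> is approximated by a Riemann sum of indicators of its level sets.\<close>

lemma covariance_layer_bound:
  fixes U W :: "'a \<Rightarrow> real"
  assumes F: "subalgebra M F" and U: "U \<in> borel_measurable F" and W: "W \<in> borel_measurable M"
    and Ub: "\<And>\<omega>. \<omega> \<in> space M \<Longrightarrow> 0 \<le> U \<omega> \<and> U \<omega> \<le> T" and Wb: "\<And>\<omega>. \<omega> \<in> space M \<Longrightarrow> \<bar>W \<omega>\<bar> \<le> w"
    and T: "T > 0" and c: "c \<ge> 0"
    and ind: "\<And>A. A \<in> sets F \<Longrightarrow>
      \<bar>expectation (\<lambda>\<omega>. indicator A \<omega> * W \<omega>) - prob A * expectation W\<bar> \<le> \<kappa> + c * prob A"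
  shows "\<bar>expectation (\<lambda>\<omega>. U \<omega> * W \<omega>) - expectation U * expectation W\<bar> \<le> T * \<kappa> + c * expectation U"
proof -
  have w: "w \<ge> 0" using Wb not_empty by fastforce
  have UM: "U \<in> borel_measurable M" by (rule measurable_from_subalg[OF F U])
  have WI: "integrable M W" by (rule integrable_bounded[OF W Wb])
  have spF: "space F = space M" and setF: "sets F \<subseteq> sets M" using F by (auto simp: subalgebra_def)
  have EW: "\<bar>expectation W\<bar> \<le> w" by (rule abs_expectation_le[OF W Wb])
  have approx: "\<bar>expectation (\<lambda>\<omega>. U \<omega> * W \<omega>) - expectation U * expectation W\<bar>
      \<le> T * \<kappa> + c * expectation U + (2 * w + c) * (T / real N)" if N: "N \<ge> 1" for N
  proof -
    define A where "A i = {\<omega> \<in> space F. real i * T / real N \<le> U \<omega>}" for i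
    have A: "A i \<in> sets F" for i unfolding A_def using U by measurable
    then have AM: "A i \<in> sets M" for i using setF by auto
    define V where "V \<omega> = T / real N * (\<Sum>i=1..N. indicator (A i) \<omega>)" for \<omega>
    have VM: "V \<in> borel_measurable M" unfolding V_def using AM by measurable
    have UV: "\<bar>U \<omega> - V \<omega>\<bar> \<le> T / real N" if "\<omega> \<in> space M" for \<omega>
    proof -
      have "V \<omega> = T / real N * (\<Sum>i=1..N. indicator {z. real i * T / real N \<le> z} (U \<omega>))"
        unfolding V_def A_def using that spF by (auto simp: indicator_def)
      then show ?thesis using layer_sum_error[of "U \<omega>" T N] Ub[OF that] T N by simp
    qed
    have Ui: "integrable M U" by (rule integrable_bounded[where c=T]) (use UM Ub in auto)
    have Vb: "\<bar>V \<omega>\<bar> \<le> T + T / real N" if "\<omega> \<in> space M" for \<omega>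
      using UV[OF that] Ub[OF that] by linarith
    have Vi: "integrable M V" by (rule integrable_bounded[OF VM Vb])
    have UWi: "integrable M (\<lambda>\<omega>. U \<omega> * W \<omega>)" 
      by (rule integrable_bounded[where c="T * w"]) (use UM W Ub Wb T in \<open>auto simp: abs_mult intro!: mult_mono\<close>)
    have TN: "T + T / real N \<ge> 0" using T by simp
    have VWi: "integrable M (\<lambda>\<omega>. V \<omega> * W \<omega>)"
      by (rule integrable_bounded[where c="(T + T / real N) * w"])
        (use VM W Vb Wb TN in \<open>auto simp: abs_mult intro!: mult_mono\<close>)
    have 1: "\<bar>expectation (\<lambda>\<omega>. U \<omega> * W \<omega>) - expectation (\<lambda>\<omega>. V \<omega> * W \<omega>)\<bar> \<le> T / real N * w"
    proof -
      have "expectation (\<lambda>\<omega>. U \<omega> * W \<omega>) - expectation (\<lambda>\<omega>. V \<omega> * W \<omega>) = expectation (\<lambda>\<omega>. (U \<omega> - V \<omega>) * W \<omega>)"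
        using UWi VWi by (simp add: algebra_simps)
      also have "\<bar>\<dots>\<bar> \<le> T / real N * w"
      proof (rule abs_expectation_le)
        show "\<bar>(U \<omega> - V \<omega>) * W \<omega>\<bar> \<le> T / real N * w" if "\<omega> \<in> space M" for \<omega>
          unfolding abs_mult using UV[OF that] Wb[OF that] T by (intro mult_mono) auto
      qed (use UM VM W in measurable)
      finally show ?thesis .
    qed
    have 2: "\<bar>expectation U - expectation V\<bar> \<le> T / real N"
    proof -
      have "expectation U - expectation V = expectation (\<lambda>\<omega>. U \<omega> - V \<omega>)" using Ui Vi by simp
      also have "\<bar>\<dots>\<bar> \<le> T / real N"
        by (rule abs_expectation_le) (use UM VM UV in auto)
      finally show ?thesis .
    qed
    have iW: "integrable M (\<lambda>\<omega>. indicator (A i) \<omega> * W \<omega>)" for i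
      using integrable_real_mult_indicator[OF AM WI] by (simp add: mult.commute)
    have iA: "integrable M (\<lambda>\<omega>. indicator (A i) \<omega> :: real)" for i
      by (rule integrable_indicator_event[OF AM])
    have eV: "expectation V = T / real N * (\<Sum>i=1..N. prob (A i))"
      unfolding V_def using iA AM by (simp add: sets.sets_into_space Int_absorb2)
    have "expectation (\<lambda>\<omega>. V \<omega> * W \<omega>) = expectation (\<lambda>\<omega>. T / real N * (\<Sum>i=1..N. indicator (A i) \<omega> * W \<omega>))"
      unfolding V_def by (simp add: sum_distrib_right mult.assoc)
    also have "\<dots> = T / real N * (\<Sum>i=1..N. expectation (\<lambda>\<omega>. indicator (A i) \<omega> * W \<omega>))"
      unfolding integral_mult_right_zero by (subst Bochner_Integration.integral_sum) (rule iW refl)+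
    finally have eVW: "expectation (\<lambda>\<omega>. V \<omega> * W \<omega>) = T / real N * (\<Sum>i=1..N. expectation (\<lambda>\<omega>. indicator (A i) \<omega> * W \<omega>))" .
    have "\<bar>expectation (\<lambda>\<omega>. V \<omega> * W \<omega>) - expectation V * expectation W\<bar>
       = T / real N * \<bar>\<Sum>i=1..N. expectation (\<lambda>\<omega>. indicator (A i) \<omega> * W \<omega>) - prob (A i) * expectation W\<bar>"
    proof -
      have "expectation (\<lambda>\<omega>. V \<omega> * W \<omega>) - expectation V * expectation W
       = T / real N * (\<Sum>i=1..N. expectation (\<lambda>\<omega>. indicator (A i) \<omega> * W \<omega>) - prob (A i) * expectation W)"
        unfolding eV eVW sum_subtractf sum_distrib_right[symmetric] right_diff_distrib by simp
      then show ?thesis using T by (simp add: abs_mult)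
    qed
    also have "\<dots> \<le> T / real N * (\<Sum>i=1..N. \<kappa> + c * prob (A i))"
      using T by (intro mult_left_mono order.trans[OF sum_abs] sum_mono ind A) auto
    also have "\<dots> = T * \<kappa> + c * expectation V"
      using N unfolding eV by (simp add: sum.distrib sum_distrib_left[symmetric] distrib_left)
    also have "c * expectation V \<le> c * (expectation U + T / real N)"
      using 2 c by (intro mult_left_mono) auto
    finally have 3: "\<bar>expectation (\<lambda>\<omega>. V \<omega> * W \<omega>) - expectation V * expectation W\<bar> \<le> T * \<kappa> + c * (expectation U + T / real N)"
      by simp
    have 4: "\<bar>(expectation U - expectation V) * expectation W\<bar> \<le> T / real N * w"
      unfolding abs_mult using 2 EW T by (intro mult_mono) auto
    have 5: "(2 * w + c) * (T / real N) = 2 * (T / real N * w) + c * (T / real N)" by (simp add: algebra_simps)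
    show ?thesis using 1 3 4 unfolding left_diff_distrib 5 distrib_left abs_le_iff by linarith
  qed
  \<comment> \<open>Refining the layers removes the discretisation error; the bound \<open>w\<close>
    on \<open>W\<close> enters only through that error.\<close>
  have "(\<lambda>N. T * \<kappa> + c * expectation U + (2 * w + c) * (T / real N)) \<longlonglongrightarrow> T * \<kappa> + c * expectation U + (2 * w + c) * 0"
    by (intro tendsto_intros lim_const_over_n)
  then show ?thesis
    by (intro LIMSEQ_le_const[where X="\<lambda>N. T * \<kappa> + c * expectation U + (2 * w + c) * (T / real N)"])
       (use approx in auto)
qed

text \<open>The covariance inequality in its L^1 and L^\<infinity> form, obtained from two layer
  decompositions. First \<open>V + T\<close>, with range in [0, 2T], is layered against an indicator
  of \<open>A\<close>, with the additive error \<open>c * prob A\<close>. Then the positive and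
  negative parts of \<open>U\<close> are layered against \<open>V\<close>, with an error
  proportional to the probability of the layer.\<close>

lemma phi_covariance_bounded:
  fixes U V :: "'a \<Rightarrow> real"
  assumes F: "subalgebra M F" and G: "subalgebra M G"
    and mix: "\<And>A B. A \<in> sets F \<Longrightarrow> B \<in> sets G \<Longrightarrow> \<bar>prob (A \<inter> B) - prob A * prob B\<bar> \<le> c * prob A"
    and U: "U \<in> borel_measurable F" and V: "V \<in> borel_measurable G"
    and Ub: "\<And>\<omega>. \<omega> \<in> space M \<Longrightarrow> \<bar>U \<omega>\<bar> \<le> b" and Vb: "\<And>\<omega>. \<omega> \<in> space M \<Longrightarrow> \<bar>V \<omega>\<bar> \<le> T"
    and T: "T > 0" and c: "c \<ge> 0"
  shows "\<bar>expectation (\<lambda>\<omega>. U \<omega> * V \<omega>) - expectation U * expectation V\<bar> \<le> 2 * c * T * expectation (\<lambda>\<omega>. \<bar>U \<omega>\<bar>)"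
proof -
  have UM: "U \<in> borel_measurable M" by (rule measurable_from_subalg[OF F U])
  have VM: "V \<in> borel_measurable M" by (rule measurable_from_subalg[OF G V])
  have spF: "space F = space M" "space G = space M" and setF: "sets F \<subseteq> sets M" "sets G \<subseteq> sets M"
    using F G by (auto simp: subalgebra_def)
  have b0: "b \<ge> 0" using Ub not_empty by fastforce
  define b1 where "b1 = b + 1"
  have b1: "b1 > 0" using b0 by (simp add: b1_def)
  have V1: "(\<lambda>\<omega>. V \<omega> + T) \<in> borel_measurable G" using V by measurable
  have Vi: "integrable M V" by (rule integrable_bounded[OF VM Vb])
  have EV1: "expectation (\<lambda>\<omega>. V \<omega> + T) = expectation V + T" using Vi by (simp add: prob_space)
  have ind: "\<bar>expectation (\<lambda>\<omega>. indicator A \<omega> * V \<omega>) - prob A * expectation V\<bar> \<le> 0 + 2 * c * T * prob A"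
    if A: "A \<in> sets F" for A
  proof -
    have AM: "A \<in> sets M" using A setF by auto
    have "\<bar>expectation (\<lambda>\<omega>. (V \<omega> + T) * indicator A \<omega>) - expectation (\<lambda>\<omega>. V \<omega> + T) * expectation (indicator A)\<bar> 
       \<le> 2 * T * (c * prob A) + 0 * expectation (\<lambda>\<omega>. V \<omega> + T)"
    proof (rule covariance_layer_bound[OF G V1])
      fix B assume B: "B \<in> sets G"
      have "expectation (\<lambda>\<omega>. indicator B \<omega> * indicator A \<omega>) = prob (A \<inter> B)"
        using B AM setF by (simp add: indicator_inter_arith[symmetric] Int_commute sets.sets_into_space Int_absorb2 sets.Int subset_iff)
      moreover have "expectation (indicator A) = prob A" using AM by (simp add: sets.sets_into_space Int_absorb2)
      ultimately show "\<bar>expectation (\<lambda>\<omega>. indicator B \<omega> * indicator A \<omega>) - prob B * expectation (indicator A)\<bar> \<le> c * prob A + 0 * prob B"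
        using mix[OF A B] by (simp add: mult.commute)
    next
      show "0 \<le> V \<omega> + T \<and> V \<omega> + T \<le> 2 * T" if "\<omega> \<in> space M" for \<omega> using Vb[OF that] by auto
      show "\<bar>indicator A \<omega> :: real\<bar> \<le> 1" for \<omega> by (auto simp: indicator_def)
    qed (use T AM in auto)
    moreover have "expectation (\<lambda>\<omega>. (V \<omega> + T) * indicator A \<omega>) = expectation (\<lambda>\<omega>. indicator A \<omega> * V \<omega>) + T * prob A"
    proof -
      have "integrable M (\<lambda>\<omega>. indicator A \<omega> * V \<omega>)" using integrable_real_mult_indicator[OF AM Vi] by (simp add: mult.commute)
      then have "expectation (\<lambda>\<omega>. indicator A \<omega> * V \<omega> + T * indicator A \<omega>) =
          expectation (\<lambda>\<omega>. indicator A \<omega> * V \<omega>) + expectation (\<lambda>\<omega>. T * indicator A \<omega>)"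
        using integrable_indicator_event[OF AM] by (intro Bochner_Integration.integral_add) auto
      then show ?thesis using AM by (simp add: algebra_simps sets.sets_into_space Int_absorb2)
    qed
    moreover have "expectation (indicator A) = prob A" using AM by (simp add: sets.sets_into_space Int_absorb2)
    ultimately show ?thesis unfolding EV1 by (simp add: algebra_simps)
  qed
  have part: "\<bar>expectation (\<lambda>\<omega>. U' \<omega> * V \<omega>) - expectation U' * expectation V\<bar> \<le> 2 * c * T * expectation U'"
    if U': "U' \<in> borel_measurable F" "\<And>\<omega>. \<omega> \<in> space M \<Longrightarrow> 0 \<le> U' \<omega> \<and> U' \<omega> \<le> b1" for U'
    using covariance_layer_bound[OF F U'(1) VM U'(2) Vb b1 _ ind] T c by simp
  define P where "P \<omega> = max 0 (U \<omega>)" for \<omega>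
  define Q where "Q \<omega> = max 0 (- U \<omega>)" for \<omega>
  have PF: "P \<in> borel_measurable F" "Q \<in> borel_measurable F" unfolding P_def Q_def using U by measurable
  have PQb: "0 \<le> P \<omega> \<and> P \<omega> \<le> b1" "0 \<le> Q \<omega> \<and> Q \<omega> \<le> b1" if "\<omega> \<in> space M" for \<omega>
    \<comment> \<open>\<open>b1\<close> exceeds \<open>b\<close> by one because the layer bound asks
      for a positive height.\<close>
    using Ub[OF that] b0 by (auto simp: P_def Q_def b1_def)
  have PM: "P \<in> borel_measurable M" "Q \<in> borel_measurable M" using PF measurable_from_subalg[OF F] by auto
  have PQi: "integrable M P" "integrable M Q"
    using PM PQb by (auto intro!: integrable_bounded[where c=b1])
  have PQVi: "integrable M (\<lambda>\<omega>. P \<omega> * V \<omega>)" "integrable M (\<lambda>\<omega>. Q \<omega> * V \<omega>)"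
    using PM VM PQb Vb b1 by (auto intro!: integrable_bounded[where c="b1 * T"] mult_mono simp: abs_mult)
  have Ueq: "U \<omega> = P \<omega> - Q \<omega>" "\<bar>U \<omega>\<bar> = P \<omega> + Q \<omega>" for \<omega> by (auto simp: P_def Q_def)
  have "expectation (\<lambda>\<omega>. U \<omega> * V \<omega>) = expectation (\<lambda>\<omega>. P \<omega> * V \<omega>) - expectation (\<lambda>\<omega>. Q \<omega> * V \<omega>)"
    using PQVi by (simp add: Ueq left_diff_distrib)
  moreover have "expectation U = expectation P - expectation Q"
    using Bochner_Integration.integral_diff[OF PQi] by (simp flip: Ueq)
  moreover have "expectation (\<lambda>\<omega>. \<bar>U \<omega>\<bar>) = expectation P + expectation Q"
    using Bochner_Integration.integral_add[OF PQi] by (simp flip: Ueq(2))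
  moreover have "\<bar>expectation (\<lambda>\<omega>. P \<omega> * V \<omega>) - expectation P * expectation V\<bar> \<le> 2 * c * T * expectation P"
    by (rule part) (use PF PQb in auto)
  moreover have "\<bar>expectation (\<lambda>\<omega>. Q \<omega> * V \<omega>) - expectation Q * expectation V\<bar> \<le> 2 * c * T * expectation Q"
    by (rule part) (use PF PQb in auto)
  ultimately show ?thesis
    by (simp only: left_diff_distrib distrib_left abs_le_iff) linarith
qed

text \<open>For products of blocks no useful sup bound is available; \<open>b\<close> and
  \<open>b'\<close> secure integrability only and stay out of the estimate. Truncating
  \<open>V\<close> at \<open>T\<close> gives the square root of the mixing coefficient and requires
  only second moments of \<open>V\<close>. The joint hypothesis on
  \<open>\<bar>U\<bar> * V\<^sup>2\<close> is there because \<open>U\<close> and \<open>V\<close>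
  are dependent in the truncated tail.\<close>

lemma phi_covariance:
  fixes U V :: "'a \<Rightarrow> real"
  assumes F: "subalgebra M F" and G: "subalgebra M G"
    and mix: "\<And>A B. A \<in> sets F \<Longrightarrow> B \<in> sets G \<Longrightarrow> \<bar>prob (A \<inter> B) - prob A * prob B\<bar> \<le> c * prob A"
    and U: "U \<in> borel_measurable F" and V: "V \<in> borel_measurable G"
    and Ub: "\<And>\<omega>. \<omega> \<in> space M \<Longrightarrow> \<bar>U \<omega>\<bar> \<le> b" and Vb: "\<And>\<omega>. \<omega> \<in> space M \<Longrightarrow> \<bar>V \<omega>\<bar> \<le> b'"
    and c: "0 \<le> c" "c \<le> s\<^sup>2" "s \<ge> 0"
    and hU: "expectation (\<lambda>\<omega>. \<bar>U \<omega>\<bar>) \<le> hU" and hV: "hV > 0" "expectation (\<lambda>\<omega>. (V \<omega>)\<^sup>2) \<le> hV\<^sup>2"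
    and hUV: "expectation (\<lambda>\<omega>. \<bar>U \<omega>\<bar> * (V \<omega>)\<^sup>2) \<le> hU * hV\<^sup>2"
  shows "\<bar>expectation (\<lambda>\<omega>. U \<omega> * V \<omega>) - expectation U * expectation V\<bar> \<le> 4 * s * hU * hV"
proof -
  have UM: "U \<in> borel_measurable M" by (rule measurable_from_subalg[OF F U])
  have VM: "V \<in> borel_measurable M" by (rule measurable_from_subalg[OF G V])
  have b0: "b \<ge> 0" "b' \<ge> 0" using Ub Vb not_empty by fastforce+
  have hU0: "hU \<ge> 0" using hU by (meson Bochner_Integration.integral_nonneg abs_ge_zero order_trans)
  show ?thesis
  proof (cases "s = 0")
    case True
    then have "c = 0" using c by auto
    then have "\<bar>expectation (\<lambda>\<omega>. U \<omega> * V \<omega>) - expectation U * expectation V\<bar> \<le> 2 * 0 * (b' + 1) * expectation (\<lambda>\<omega>. \<bar>U \<omega>\<bar>)"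
      using b0 Vb by (intro phi_covariance_bounded[OF F G _ U V Ub]) (use mix in fastforce)+
    then show ?thesis using True by simp
  next
    case False
    then have s: "s > 0" using c by simp
    \<comment> \<open>This level balances the errors: each of the two tails costs
      \<open>hV\<^sup>2 / T = s * hV\<close> times \<open>hU\<close>, and the truncated covariance
      costs twice that, 4 in total.\<close>
    define T where "T = hV / s"
    have T: "T > 0" using s hV by (simp add: T_def)
    define V' where "V' \<omega> = max (- T) (min T (V \<omega>))" for \<omega>
    have V'G: "V' \<in> borel_measurable G" unfolding V'_def using V by measurable
    have V'M: "V' \<in> borel_measurable M" by (rule measurable_from_subalg[OF G V'G])
    have V'b: "\<bar>V' \<omega>\<bar> \<le> T" for \<omega> using T by (auto simp: V'_def)
    have dV: "\<bar>V \<omega> - V' \<omega>\<bar> \<le> (V \<omega>)\<^sup>2 / T" for \<omega>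
    proof (cases "\<bar>V \<omega>\<bar> \<le> T")
      case True
      then have "V' \<omega> = V \<omega>" by (auto simp: V'_def)
      then show ?thesis using T by simp
    next
      case False
      then have "\<bar>V \<omega> - V' \<omega>\<bar> \<le> \<bar>V \<omega>\<bar>" using T by (auto simp: V'_def)
      also have "\<dots> \<le> (V \<omega>)\<^sup>2 / T"
      proof -
        have "\<bar>V \<omega>\<bar> * T \<le> \<bar>V \<omega>\<bar> * \<bar>V \<omega>\<bar>" using False by (intro mult_left_mono) auto
        then show ?thesis using T by (simp add: le_divide_eq power2_eq_square)
      qed
      finally show ?thesis .
    qed
    have Vi: "integrable M V" by (rule integrable_bounded[OF VM Vb])
    have V'i: "integrable M V'" by (rule integrable_bounded[OF V'M V'b])
    have V2i: "integrable M (\<lambda>\<omega>. (V \<omega>)\<^sup>2)"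
      by (rule integrable_bounded[where c="b'\<^sup>2"]) (use VM Vb b0 in \<open>auto intro: power2_le_iff_abs_le[THEN iffD2]\<close>)
    have UV2b: "\<bar>\<bar>U \<omega>\<bar> * (V \<omega>)\<^sup>2\<bar> \<le> b * b'\<^sup>2" if "\<omega> \<in> space M" for \<omega>
    proof -
      have "\<bar>U \<omega>\<bar> * (V \<omega>)\<^sup>2 \<le> b * b'\<^sup>2"
        using Ub[OF that] Vb[OF that] b0 by (intro mult_mono) (auto intro: power2_le_iff_abs_le[THEN iffD2])
      then show ?thesis by simp
    qed
    have UV2i: "integrable M (\<lambda>\<omega>. \<bar>U \<omega>\<bar> * (V \<omega>)\<^sup>2)"
      by (rule integrable_bounded[OF _ UV2b]) (use UM VM in auto)
    have UVi: "integrable M (\<lambda>\<omega>. U \<omega> * V \<omega>)"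
      by (rule integrable_bounded[where c="b * b'"]) (use UM VM Ub Vb b0 in \<open>auto simp: abs_mult intro!: mult_mono\<close>)
    have UV'i: "integrable M (\<lambda>\<omega>. U \<omega> * V' \<omega>)"
      by (rule integrable_bounded[where c="b * T"]) (use UM V'M Ub V'b b0 in \<open>auto simp: abs_mult intro!: mult_mono\<close>)
    have Ui: "integrable M U" by (rule integrable_bounded[OF UM Ub])
    have TV: "hV\<^sup>2 / T = hV * s" using hV s by (simp add: T_def power2_eq_square)
    have 1: "\<bar>expectation (\<lambda>\<omega>. U \<omega> * V \<omega>) - expectation (\<lambda>\<omega>. U \<omega> * V' \<omega>)\<bar> \<le> s * hU * hV"
    proof -
      have "\<bar>expectation (\<lambda>\<omega>. U \<omega> * V \<omega>) - expectation (\<lambda>\<omega>. U \<omega> * V' \<omega>)\<bar> = \<bar>expectation (\<lambda>\<omega>. U \<omega> * (V \<omega> - V' \<omega>))\<bar>"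
        using UVi UV'i by (simp add: right_diff_distrib)
      also have "\<dots> \<le> expectation (\<lambda>\<omega>. \<bar>U \<omega> * (V \<omega> - V' \<omega>)\<bar>)" by (rule integral_abs_bound)
      also have "\<dots> \<le> expectation (\<lambda>\<omega>. \<bar>U \<omega>\<bar> * (V \<omega>)\<^sup>2 / T)"
      proof (rule integral_mono)
        show "integrable M (\<lambda>\<omega>. \<bar>U \<omega> * (V \<omega> - V' \<omega>)\<bar>)" using UVi UV'i by (auto simp: right_diff_distrib)
        show "\<bar>U \<omega> * (V \<omega> - V' \<omega>)\<bar> \<le> \<bar>U \<omega>\<bar> * (V \<omega>)\<^sup>2 / T" for \<omega>
          using mult_left_mono[OF dV[of \<omega>], of "\<bar>U \<omega>\<bar>"] by (simp add: abs_mult)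
      qed (use UV2i in auto)
      also have "\<dots> \<le> hU * hV\<^sup>2 / T" using hUV T by (simp add: divide_right_mono)
      also have "\<dots> = s * hU * hV" using TV by (simp add: mult_ac flip: times_divide_eq_right)
      finally show ?thesis .
    qed
    have EU: "\<bar>expectation U\<bar> \<le> hU" using hU integral_abs_bound[of M U] by linarith
    have 2: "\<bar>expectation U * expectation V - expectation U * expectation V'\<bar> \<le> s * hU * hV"
    proof -
      have "\<bar>expectation V - expectation V'\<bar> = \<bar>expectation (\<lambda>\<omega>. V \<omega> - V' \<omega>)\<bar>"
        using Vi V'i by simp
      also have "\<dots> \<le> expectation (\<lambda>\<omega>. \<bar>V \<omega> - V' \<omega>\<bar>)" by (rule integral_abs_bound)
      also have "\<dots> \<le> expectation (\<lambda>\<omega>. (V \<omega>)\<^sup>2 / T)"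
        using Vi V'i V2i dV by (intro integral_mono) auto
      also have "\<dots> \<le> hV\<^sup>2 / T" using hV T by (simp add: divide_right_mono)
      finally have "\<bar>expectation V - expectation V'\<bar> \<le> hV * s" using TV by simp
      then have "\<bar>expectation U\<bar> * \<bar>expectation V - expectation V'\<bar> \<le> hU * (hV * s)"
        using EU hU0 by (intro mult_mono) auto
      then show ?thesis by (simp add: abs_mult right_diff_distrib[symmetric] mult_ac)
    qed
    have 3: "\<bar>expectation (\<lambda>\<omega>. U \<omega> * V' \<omega>) - expectation U * expectation V'\<bar> \<le> 2 * s * hU * hV"
    proof -
      have "\<bar>expectation (\<lambda>\<omega>. U \<omega> * V' \<omega>) - expectation U * expectation V'\<bar> \<le> 2 * c * T * expectation (\<lambda>\<omega>. \<bar>U \<omega>\<bar>)"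
        by (rule phi_covariance_bounded[OF F G mix U V'G Ub V'b T c(1)])
      also have "\<dots> \<le> 2 * s\<^sup>2 * T * hU"
        using c T hU hU0 by (intro mult_mono) auto
      also have "\<dots> = 2 * s * hU * hV" using s by (simp add: T_def power2_eq_square)
      finally show ?thesis .
    qed
    show ?thesis using 1 2 3 by (simp add: abs_le_iff algebra_simps)
  qed
qed

end

section \<open>Tails of partial sums\<close>

text \<open>\<open>Fs J\<close> stands for the \<sigma>-algebra generated by the coordinates in
  \<open>J\<close>. The mixing inequality is multiplied out, so that null events need no exception;
  \<open>s + k\<close> may exceed \<open>n\<close>, and then the index set of the second algebra is
  empty.\<close>

locale mixing_row = prob_space M for M :: "'a measure" +
  fixes Fs :: "nat set \<Rightarrow> 'a measure" and x :: "nat \<Rightarrow> 'a \<Rightarrow> real"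
    and n :: nat and K :: real and \<phi> :: "nat \<Rightarrow> real"
  assumes sub: "J \<subseteq> {1..n} \<Longrightarrow> subalgebra M (Fs J)"
    and x_meas: "J \<subseteq> {1..n} \<Longrightarrow> j \<in> J \<Longrightarrow> x j \<in> borel_measurable (Fs J)"
    and x_bound: "j \<in> {1..n} \<Longrightarrow> \<omega> \<in> space M \<Longrightarrow> \<bar>x j \<omega>\<bar> \<le> K"
    and x_centered: "j \<in> {1..n} \<Longrightarrow> expectation (x j) = 0"
    and K1: "1 \<le> K" and phi0: "0 \<le> \<phi> k"
    and mixing: "s \<le> n \<Longrightarrow> 1 \<le> k \<Longrightarrow> A \<in> sets (Fs {1..s}) \<Longrightarrow> B \<in> sets (Fs {s+k..n}) \<Longrightarrow>
      \<bar>prob (A \<inter> B) - prob A * prob B\<bar> \<le> \<phi> k * prob A"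
begin

text \<open>The interval is half open, so that consecutive sums share their cut point and add
  up.\<close>

definition S :: "nat \<Rightarrow> nat \<Rightarrow> 'a \<Rightarrow> real" where
  "S a b \<omega> = (\<Sum>j\<in>{a<..b}. x j \<omega>)"

lemma space_Fs [simp]: "J \<subseteq> {1..n} \<Longrightarrow> space (Fs J) = space M"
  using sub[of J] by (simp add: subalgebra_def)

lemma sets_Fs: "J \<subseteq> {1..n} \<Longrightarrow> A \<in> sets (Fs J) \<Longrightarrow> A \<in> events"
  using sub[of J] by (auto simp: subalgebra_def)

lemma S_meas: "{a<..b} \<subseteq> J \<Longrightarrow> J \<subseteq> {1..n} \<Longrightarrow> S a b \<in> borel_measurable (Fs J)"
  unfolding S_def by (intro borel_measurable_sum x_meas) auto

lemma S_rv [measurable]: "b \<le> n \<Longrightarrow> S a b \<in> borel_measurable M"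
  by (rule measurable_from_subalg[OF sub[OF order_refl] S_meas]) auto

lemma S_empty [simp]: "b \<le> a \<Longrightarrow> S a b \<omega> = 0"
  by (simp add: S_def)

lemma S_split: "a \<le> b \<Longrightarrow> b \<le> c \<Longrightarrow> S a c \<omega> = S a b \<omega> + S b c \<omega>"
  unfolding S_def by (subst sum.union_disjoint[symmetric]) (auto intro!: sum.cong)

lemma S_bound: "b \<le> n \<Longrightarrow> \<omega> \<in> space M \<Longrightarrow> \<bar>S a b \<omega>\<bar> \<le> real (b - a) * K"
proof -
  assume "b \<le> n" "\<omega> \<in> space M"
  then have "\<bar>S a b \<omega>\<bar> \<le> (\<Sum>j\<in>{a<..b}. K)"
    unfolding S_def by (intro order.trans[OF sum_abs] sum_mono x_bound) auto
  then show ?thesis by simp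
qed

lemma S_power_integrable: "b \<le> n \<Longrightarrow> integrable M (\<lambda>\<omega>. S a b \<omega> ^ d)"
  by (rule integrable_bounded[where c="(real (b - a) * K) ^ d"]) (use S_bound in \<open>auto simp: power_abs intro!: power_mono\<close>)

lemma S_abs_power_integrable: "b \<le> n \<Longrightarrow> integrable M (\<lambda>\<omega>. \<bar>S a b \<omega>\<bar> ^ d)"
  using integrable_abs[OF S_power_integrable[of b a d]] by (simp add: power_abs)

lemma S_mean: "b \<le> n \<Longrightarrow> expectation (S a b) = 0"
proof -
  assume b: "b \<le> n"
  have "integrable M (x j)" if "j \<in> {a<..b}" for j
    by (rule integrable_bounded[OF measurable_from_subalg[OF sub[OF order_refl] x_meas] x_bound])
       (use b that in auto)
  then show ?thesis unfolding S_def using b x_centered by (subst Bochner_Integration.integral_sum) auto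
qed

lemma chebyshev_S:
  assumes "b \<le> n" "expectation (\<lambda>\<omega>. (S a b \<omega>)\<^sup>2) \<le> z\<^sup>2" "z > 0"
  shows "prob {\<omega> \<in> space M. 4 * z < \<bar>S a b \<omega>\<bar>} \<le> 1 / 16"
proof -
  have "prob {\<omega> \<in> space M. 4 * z < \<bar>S a b \<omega>\<bar>} \<le> prob {\<omega> \<in> space M. (4 * z)\<^sup>2 \<le> (S a b \<omega>)\<^sup>2}"
  proof (rule finite_measure_mono)
    have "(4 * z)\<^sup>2 \<le> (S a b \<omega>)\<^sup>2" if "4 * z < \<bar>S a b \<omega>\<bar>" for \<omega>
      using that assms(3) power_mono[of "4 * z" "\<bar>S a b \<omega>\<bar>" 2] by simp
    then show "{\<omega> \<in> space M. 4 * z < \<bar>S a b \<omega>\<bar>} \<subseteq> {\<omega> \<in> space M. (4 * z)\<^sup>2 \<le> (S a b \<omega>)\<^sup>2}" by auto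
    show "{\<omega> \<in> space M. (4 * z)\<^sup>2 \<le> (S a b \<omega>)\<^sup>2} \<in> events" using assms(1) by measurable
  qed
  also have "\<dots> \<le> expectation (\<lambda>\<omega>. (S a b \<omega>)\<^sup>2) / (4 * z)\<^sup>2"
    by (rule integral_Markov_inequality_measure[where A="{}", simplified])
       (use assms S_power_integrable[of b a 2] in auto)
  also have "\<dots> \<le> z\<^sup>2 / (4 * z)\<^sup>2" using assms by (intro divide_right_mono) auto
  also have "\<dots> = 1 / 16" using assms by (simp add: power2_eq_square)
  finally show ?thesis .
qed

section \<open>First passages and maximal inequalities\<close>

definition passage :: "nat \<Rightarrow> nat \<Rightarrow> real \<Rightarrow> 'a set" where
  "passage a e y = {\<omega> \<in> space M. \<exists>i\<in>{a..e}. y < \<bar>S a i \<omega>\<bar>}"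

text \<open>These events cut a passage into disjoint pieces, each determined by the past up to
  \<open>i\<close>, so that mixing can be applied piece by piece with errors adding up to a multiple
  of the whole probability.\<close>

definition first_passage :: "nat \<Rightarrow> real \<Rightarrow> nat \<Rightarrow> 'a set" where
  "first_passage a y i = {\<omega> \<in> space M. y < \<bar>S a i \<omega>\<bar> \<and> (\<forall>j\<in>{a..<i}. \<bar>S a j \<omega>\<bar> \<le> y)}"

text \<open>\<open>S a i\<close> starts with the summand of index \<open>a + 1\<close>, hence the
  condition \<open>k \<le> a + 1\<close>: the event belongs to the future after a gap.\<close>

lemma passage_sets: "e \<le> n \<Longrightarrow> k \<le> a + 1 \<Longrightarrow> 1 \<le> k \<Longrightarrow> passage a e y \<in> sets (Fs {k..n})"
proof -
  assume e: "e \<le> n" and k: "k \<le> a + 1" "1 \<le> k"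
  have sp: "space (Fs {k..n}) = space M" using k by (intro space_Fs) auto
  have "passage a e y = (\<Union>i\<in>{a..e}. {\<omega> \<in> space (Fs {k..n}). y < \<bar>S a i \<omega>\<bar>})"
    unfolding passage_def sp by auto
  also have "\<dots> \<in> sets (Fs {k..n})"
  proof (intro sets.finite_UN)
    fix i assume "i \<in> {a..e}"
    then have [measurable]: "S a i \<in> borel_measurable (Fs {k..n})" using e k by (intro S_meas) auto
    show "{\<omega> \<in> space (Fs {k..n}). y < \<bar>S a i \<omega>\<bar>} \<in> sets (Fs {k..n})" by measurable
  qed auto
  finally show ?thesis .
qed

lemma passage_events: "e \<le> n \<Longrightarrow> passage a e y \<in> events"
  by (rule sets_Fs[OF _ passage_sets[of e 1]]) auto

lemma first_passage_sets: "i \<le> n \<Longrightarrow> first_passage a y i \<in> sets (Fs {1..i})"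
proof -
  assume i: "i \<le> n"
  have sp: "space (Fs {1..i}) = space M" using i by (intro space_Fs) auto
  have m: "S a j \<in> borel_measurable (Fs {1..i})" if "j \<le> i" for j
    using i that by (intro S_meas) auto
  have [measurable]: "S a i \<in> borel_measurable (Fs {1..i})" by (rule m) simp
  have "first_passage a y i = {\<omega> \<in> space (Fs {1..i}). y < \<bar>S a i \<omega>\<bar>} - (\<Union>j\<in>{a..<i}. {\<omega> \<in> space (Fs {1..i}). y < \<bar>S a j \<omega>\<bar>})"
    unfolding first_passage_def sp by auto
  also have "\<dots> \<in> sets (Fs {1..i})"
  proof (intro sets.Diff sets.finite_UN)
    fix j assume "j \<in> {a..<i}"
    then have [measurable]: "S a j \<in> borel_measurable (Fs {1..i})" by (intro m) auto
    show "{\<omega> \<in> space (Fs {1..i}). y < \<bar>S a j \<omega>\<bar>} \<in> sets (Fs {1..i})" by measurable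
  next
    show "{\<omega> \<in> space (Fs {1..i}). y < \<bar>S a i \<omega>\<bar>} \<in> sets (Fs {1..i})" by measurable
  qed auto
  finally show ?thesis .
qed

lemma first_passage_disjoint: "disjoint_family_on (first_passage a y) {a..e}"
proof (unfold disjoint_family_on_def, intro ballI impI)
  fix i j assume ij: "i \<in> {a..e}" "j \<in> {a..e}" "i \<noteq> j"
  have "first_passage a y i' \<inter> first_passage a y j' = {}" if "a \<le> i'" "i' < j'" for i' j'
    using that by (force simp: first_passage_def)
  then show "first_passage a y i \<inter> first_passage a y j = {}"
    using ij by (cases i j rule: linorder_cases) (auto simp: Int_commute)
qed

lemma passage_eq_Union: "passage a e y = (\<Union>i\<in>{a..e}. first_passage a y i)"
proof
  show "(\<Union>i\<in>{a..e}. first_passage a y i) \<subseteq> passage a e y"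
    by (auto simp: passage_def first_passage_def)
  show "passage a e y \<subseteq> (\<Union>i\<in>{a..e}. first_passage a y i)"
  proof
    fix \<omega> assume "\<omega> \<in> passage a e y"
    then obtain i where i: "i \<in> {a..e}" "y < \<bar>S a i \<omega>\<bar>" "\<omega> \<in> space M" by (auto simp: passage_def)
    define m where "m = (LEAST i. a \<le> i \<and> y < \<bar>S a i \<omega>\<bar>)"
    have m: "a \<le> m" "y < \<bar>S a m \<omega>\<bar>" using i LeastI[of "\<lambda>i. a \<le> i \<and> y < \<bar>S a i \<omega>\<bar>" i] by (auto simp: m_def)
    have "m \<le> i" unfolding m_def using i by (intro Least_le) auto
    moreover have "\<bar>S a j \<omega>\<bar> \<le> y" if "j \<in> {a..<m}" for j
      using not_less_Least[of j "\<lambda>i. a \<le> i \<and> y < \<bar>S a i \<omega>\<bar>"] that unfolding m_def by auto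
    ultimately show "\<omega> \<in> (\<Union>i\<in>{a..e}. first_passage a y i)"
      using m i by (auto simp: first_passage_def intro!: bexI[of _ m])
  qed
qed

lemma prob_passage: "e \<le> n \<Longrightarrow> prob (passage a e y) = (\<Sum>i\<in>{a..e}. prob (first_passage a y i))"
  unfolding passage_eq_Union
  by (rule finite_measure_finite_Union)
     (auto intro!: first_passage_disjoint sets_Fs[OF _ first_passage_sets])

lemma sum_prob_first_passage_Int:
  assumes "e \<le> n" "\<And>i. i \<in> {a..e} \<Longrightarrow> B i \<in> events"
  shows "prob (\<Union>i\<in>{a..e}. first_passage a y i \<inter> B i) = (\<Sum>i\<in>{a..e}. prob (first_passage a y i \<inter> B i))"
proof (rule finite_measure_finite_Union)
  show "(\<lambda>i. first_passage a y i \<inter> B i) ` {a..e} \<subseteq> events"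
    using assms by (auto intro!: sets.Int sets_Fs[OF _ first_passage_sets])
  show "disjoint_family_on (\<lambda>i. first_passage a y i \<inter> B i) {a..e}"
    by (rule disjoint_family_on_bisimulation[OF first_passage_disjoint]) auto
qed auto

end

text \<open>\<open>l\<close> is a gap long enough for near independence. The bound
  \<open>z\<^sup>2\<close> is required for all sums ending at \<open>e\<close>, since variances of
  dependent sums are not monotone in the interval.\<close>

locale controlled_row = mixing_row +
  fixes s0 e l :: nat and z :: real
  assumes e_n: "e \<le> n" and l1: "1 \<le> l" and phi_l: "\<phi> l \<le> 1 / 16" and z0: "0 < z"
    and suffix: "\<And>i. s0 \<le> i \<Longrightarrow> i \<le> e \<Longrightarrow> expectation (\<lambda>\<omega>. (S i e \<omega>)\<^sup>2) \<le> z\<^sup>2"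
begin

text \<open>After the first passage at \<open>i\<close>, the next \<open>l - 1\<close> summands move
  the sum by at most \<open>K * l\<close>, and the remainder is nearly independent of the past and
  at most \<open>4 * z\<close> with probability at least 15/16. So most passages end with
  \<open>\<bar>S a e\<bar>\<close> above \<open>4 * z\<close>, which Chebyshev bounds by
  1/16.\<close>

lemma ottaviani:
  assumes a: "s0 \<le> a"
  shows "prob (passage a e (K * l + 8 * z)) \<le> 1 / 14"
proof (cases "a \<le> e")
  case False
  then have "passage a e (K * l + 8 * z) = {}" by (auto simp: passage_def)
  then show ?thesis by simp
next
  case True
  let ?y = "K * l + 8 * z"
  define G where "G i = {\<omega> \<in> space M. \<bar>S (i + l - 1) e \<omega>\<bar> \<le> 4 * z}" for i
  have Gset: "G i \<in> sets (Fs {i+l..n})" for i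
  proof -
    have J: "{i+l..n} \<subseteq> {1..n}" using l1 by auto
    have [measurable]: "S (i + l - 1) e \<in> borel_measurable (Fs {i+l..n})"
      using e_n l1 J by (intro S_meas) auto
    have "G i = {\<omega> \<in> space (Fs {i+l..n}). \<bar>S (i + l - 1) e \<omega>\<bar> \<le> 4 * z}" using J by (simp add: G_def)
    also have "\<dots> \<in> sets (Fs {i+l..n})" by measurable
    finally show ?thesis .
  qed
  have Gev: "G i \<in> events" for i by (rule sets_Fs[OF _ Gset]) (use l1 in auto)
  have PG: "prob (G i) \<ge> 15 / 16" if "i \<in> {a..e}" for i
  proof -
    have "expectation (\<lambda>\<omega>. (S (i + l - 1) e \<omega>)\<^sup>2) \<le> z\<^sup>2"
      using suffix[of "i + l - 1"] a that l1 by (cases "i + l - 1 \<le> e") auto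
    then have "prob {\<omega> \<in> space M. 4 * z < \<bar>S (i + l - 1) e \<omega>\<bar>} \<le> 1 / 16"
      by (intro chebyshev_S e_n z0)
    moreover have "space M - G i = {\<omega> \<in> space M. 4 * z < \<bar>S (i + l - 1) e \<omega>\<bar>}" by (auto simp: G_def)
    ultimately show ?thesis using prob_compl[OF Gev[of i]] by simp
  qed
  \<comment> \<open>15/16 from Chebyshev minus 1/16 from mixing; dividing the final 1/16 by 7/8
    gives 1/14.\<close>
  have "7 / 8 * prob (first_passage a ?y i) \<le> prob (first_passage a ?y i \<inter> G i)" if i: "i \<in> {a..e}" for i
  proof -
    have "\<bar>prob (first_passage a ?y i \<inter> G i) - prob (first_passage a ?y i) * prob (G i)\<bar> \<le> \<phi> l * prob (first_passage a ?y i)"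
      by (rule mixing[of i]) (use i e_n l1 Gset first_passage_sets in auto)
    moreover have "\<phi> l * prob (first_passage a ?y i) \<le> 1 / 16 * prob (first_passage a ?y i)"
      using phi_l by (intro mult_right_mono) auto
    moreover have "prob (first_passage a ?y i) * prob (G i) \<ge> prob (first_passage a ?y i) * (15 / 16)"
      using PG[OF i] by (intro mult_left_mono) auto
    ultimately show ?thesis by linarith
  qed
  then have "7 / 8 * prob (passage a e ?y) \<le> (\<Sum>i\<in>{a..e}. prob (first_passage a ?y i \<inter> G i))"
    unfolding prob_passage[OF e_n] sum_distrib_left by (intro sum_mono) auto
  also have "\<dots> = prob (\<Union>i\<in>{a..e}. first_passage a ?y i \<inter> G i)"
    by (rule sum_prob_first_passage_Int[symmetric, OF e_n Gev])
  also have "\<dots> \<le> prob {\<omega> \<in> space M. 4 * z < \<bar>S a e \<omega>\<bar>}"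
  proof (rule finite_measure_mono)
    show "{\<omega> \<in> space M. 4 * z < \<bar>S a e \<omega>\<bar>} \<in> events" using e_n by measurable
    show "(\<Union>i\<in>{a..e}. first_passage a ?y i \<inter> G i) \<subseteq> {\<omega> \<in> space M. 4 * z < \<bar>S a e \<omega>\<bar>}"
    proof
      fix \<omega> assume "\<omega> \<in> (\<Union>i\<in>{a..e}. first_passage a ?y i \<inter> G i)"
      then obtain i where i: "i \<in> {a..e}" "\<omega> \<in> space M" "?y < \<bar>S a i \<omega>\<bar>" "\<bar>S (i + l - 1) e \<omega>\<bar> \<le> 4 * z"
        by (auto simp: first_passage_def G_def)
      \<comment> \<open>The gap may run past \<open>e\<close>; then the remaining sum is
        empty.\<close>
      define m where "m = min (i + l - 1) e"
      have m: "i \<le> m" "m \<le> e" using i l1 by (auto simp: m_def)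
      have "S m e \<omega> = S (i + l - 1) e \<omega>" by (cases "i + l - 1 \<le> e") (auto simp: m_def)
      moreover have "S a e \<omega> = S a i \<omega> + S i m \<omega> + S m e \<omega>"
        using S_split[of a i m \<omega>] S_split[of a m e \<omega>] i m by auto
      moreover have "\<bar>S i m \<omega>\<bar> \<le> K * l"
      proof -
        have "\<bar>S i m \<omega>\<bar> \<le> real (m - i) * K" using S_bound[of m \<omega> i] i m e_n by auto
        also have "\<dots> \<le> real l * K" using K1 by (intro mult_right_mono) (auto simp: m_def)
        finally show ?thesis by (simp add: mult.commute)
      qed
      ultimately show "\<omega> \<in> {\<omega> \<in> space M. 4 * z < \<bar>S a e \<omega>\<bar>}" using i by auto
    qed
  qed
  also have "\<dots> \<le> 1 / 16" using a True by (intro chebyshev_S e_n z0 suffix) auto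
  finally show ?thesis by simp
qed

text \<open>To get from level \<open>y\<close> to the higher level the path overshoots by at most
  \<open>K\<close>, gains at most \<open>K * l\<close> during the gap, and must then pass the
  Ottaviani level \<open>K * l + 8 * z\<close> afresh. By mixing this has small conditional
  probability, so the tail at least halves.\<close>

lemma hoffmann_jorgensen:
  assumes y: "0 \<le> y"
  shows "prob (passage s0 e (y + (K * (2 * l + 1) + 8 * z))) \<le> 1 / 2 * prob (passage s0 e y)"
proof -
  let ?w = "K * l + 8 * z"
  define H where "H i = passage (i + l - 1) e ?w" for i
  have Hset: "H i \<in> sets (Fs {i+l..n})" for i
    unfolding H_def using e_n l1 by (intro passage_sets) auto
  have Hev: "H i \<in> events" for i unfolding H_def by (rule passage_events[OF e_n])
  have "passage s0 e (y + (K * (2 * l + 1) + 8 * z)) \<subseteq> (\<Union>i\<in>{s0..e}. first_passage s0 y i \<inter> H i)"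
  proof
    fix \<omega> assume "\<omega> \<in> passage s0 e (y + (K * (2 * l + 1) + 8 * z))"
    then obtain j where j: "j \<in> {s0..e}" "y + (K * (2 * l + 1) + 8 * z) < \<bar>S s0 j \<omega>\<bar>" "\<omega> \<in> space M"
      by (auto simp: passage_def)
    have Kl: "K * (2 * l + 1) = K * l + K * l + K" by (simp add: algebra_simps)
    have Kl0: "0 \<le> K * l" using K1 by simp
    have "y < \<bar>S s0 j \<omega>\<bar>" using j(2) z0 K1 Kl Kl0 by linarith
    then have "\<omega> \<in> passage s0 j y" using j by (auto simp: passage_def intro!: bexI[of _ j])
    then obtain i where i: "i \<in> {s0..j}" "\<omega> \<in> first_passage s0 y i" unfolding passage_eq_Union by auto
    have i1: "i > s0" using i y by (cases "i = s0") (auto simp: first_passage_def)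
    have "S s0 i \<omega> = S s0 (i - 1) \<omega> + S (i - 1) i \<omega>" using i1 by (intro S_split) auto
    moreover have "\<bar>S s0 (i - 1) \<omega>\<bar> \<le> y" using i i1 by (auto simp: first_passage_def)
    moreover have "\<bar>S (i - 1) i \<omega>\<bar> \<le> K" using S_bound[of i \<omega> "i - 1"] i i1 j e_n by auto
    ultimately have Si: "\<bar>S s0 i \<omega>\<bar> \<le> y + K" by linarith
    define m where "m = min (i + l - 1) j"
    have m: "i \<le> m" "m \<le> j" using i l1 by (auto simp: m_def)
    have "\<bar>S i m \<omega>\<bar> \<le> K * l"
    proof -
      have "\<bar>S i m \<omega>\<bar> \<le> real (m - i) * K" using S_bound[of m \<omega> i] i j m e_n by auto
      also have "\<dots> \<le> real l * K" using K1 by (intro mult_right_mono) (auto simp: m_def)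
      finally show ?thesis by (simp add: mult.commute)
    qed
    moreover have "S s0 j \<omega> = S s0 i \<omega> + S i m \<omega> + S m j \<omega>"
      using S_split[of s0 i m \<omega>] S_split[of s0 m j \<omega>] i m by auto
    ultimately have w: "?w < \<bar>S m j \<omega>\<bar>" using Si j(2) Kl by linarith
    have "m \<noteq> j" using w Kl0 z0 by auto
    \<comment> \<open>The gap alone cannot reach the higher level, so it ends before
      \<open>j\<close> and a passage from its end up to \<open>j\<close> remains.\<close>
    then have "m = i + l - 1" by (auto simp: m_def)
    then have "\<omega> \<in> H i" using w m j unfolding H_def passage_def by auto
    then show "\<omega> \<in> (\<Union>i\<in>{s0..e}. first_passage s0 y i \<inter> H i)" using i j by auto
  qed
  then have "prob (passage s0 e (y + (K * (2 * l + 1) + 8 * z))) \<le> prob (\<Union>i\<in>{s0..e}. first_passage s0 y i \<inter> H i)"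
    using e_n Hev by (intro finite_measure_mono sets.finite_UN sets.Int sets_Fs[OF _ first_passage_sets]) auto
  also have "\<dots> = (\<Sum>i\<in>{s0..e}. prob (first_passage s0 y i \<inter> H i))"
    by (rule sum_prob_first_passage_Int[OF e_n Hev])
  also have "\<dots> \<le> (\<Sum>i\<in>{s0..e}. 1 / 2 * prob (first_passage s0 y i))"
  proof (rule sum_mono)
    fix i assume i: "i \<in> {s0..e}"
    have "\<bar>prob (first_passage s0 y i \<inter> H i) - prob (first_passage s0 y i) * prob (H i)\<bar> \<le> \<phi> l * prob (first_passage s0 y i)"
      by (rule mixing[of i]) (use i e_n l1 Hset first_passage_sets in auto)
    moreover have "\<phi> l * prob (first_passage s0 y i) \<le> 1 / 16 * prob (first_passage s0 y i)"
      using phi_l by (intro mult_right_mono) auto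
    moreover have "prob (first_passage s0 y i) * prob (H i) \<le> prob (first_passage s0 y i) * (1 / 14)"
      unfolding H_def using i l1 by (intro mult_left_mono ottaviani) auto
    \<comment> \<open>1/14 from Ottaviani plus 1/16 from mixing is below 1/2.\<close>
    ultimately show "prob (first_passage s0 y i \<inter> H i) \<le> 1 / 2 * prob (first_passage s0 y i)"
      using measure_nonneg[of M "first_passage s0 y i"] by linarith
  qed
  also have "\<dots> = 1 / 2 * prob (passage s0 e y)" unfolding prob_passage[OF e_n] sum_distrib_left ..
  finally show ?thesis .
qed

lemma passage_tail: "prob (passage s0 e (real k * (K * (2 * l + 1) + 8 * z))) \<le> (1 / 2) ^ k"
proof (induction k)
  case (Suc k)
  let ?Y = "K * (2 * l + 1) + 8 * z"
  have "0 \<le> real k * ?Y" using K1 z0 by (intro mult_nonneg_nonneg) auto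
  then have "prob (passage s0 e (real k * ?Y + ?Y)) \<le> 1 / 2 * prob (passage s0 e (real k * ?Y))"
    by (rule hoffmann_jorgensen)
  then show ?case using Suc by (simp add: algebra_simps)
qed simp

text \<open>The tail halves with every step of size \<open>Y0\<close>, so the exponential moment at
  scale \<open>4 * Y0\<close> is finite: the weights grow by 4/3 per step and 4/3 times 1/2 is less
  than 1. The factor \<open>fact d\<close> comes from
  \<open>t ^ d / fact d \<le> exp t\<close>.\<close>

lemma passage_moment_bound:
  assumes se: "s0 \<le> e" and Y: "K * (2 * l + 1) + 8 * z \<le> Y"
  shows "expectation (\<lambda>\<omega>. \<bar>S s0 e \<omega>\<bar> ^ d) \<le> 6 * fact d * (4 * Y) ^ d"
proof -
  define Y0 where "Y0 = K * (2 * l + 1) + 8 * z"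
  have Y0: "Y0 > 0" using K1 z0 unfolding Y0_def by (intro add_nonneg_pos mult_nonneg_nonneg) auto
  define J where "J = nat \<lceil>real (e - s0) * K / Y0\<rceil>"
  have SJ: "\<bar>S s0 e \<omega>\<bar> \<le> real J * Y0" if "\<omega> \<in> space M" for \<omega>
  proof -
    have "real (e - s0) * K / Y0 \<le> real J" unfolding J_def by linarith
    then have "real (e - s0) * K \<le> real J * Y0" using Y0 by (simp add: divide_le_eq)
    then show ?thesis using S_bound[OF e_n that, of s0] by linarith
  qed
  \<comment> \<open>A step function dominating the exponential; \<open>J\<close> levels suffice
    because the sum is bounded.\<close>
  define f where "f \<omega> = (\<Sum>k\<le>J. (4/3) ^ Suc k * indicator (passage s0 e (real k * Y0)) \<omega> :: real)" for \<omega>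
  have pw: "\<bar>S s0 e \<omega>\<bar> ^ d \<le> fact d * (4 * Y0) ^ d * (4/3 + f \<omega>)" if w: "\<omega> \<in> space M" for \<omega>
  proof -
    define t where "t = \<bar>S s0 e \<omega>\<bar> / (4 * Y0)"
    have t0: "t \<ge> 0" using Y0 by (simp add: t_def)
    have "t ^ d / fact d \<le> exp t"
    proof -
      have "(\<Sum>k<Suc d. t ^ k /\<^sub>R fact k) \<le> (\<Sum>k. t ^ k /\<^sub>R fact k)"
        using t0 by (intro sum_le_suminf summable_exp_generic) auto
      then have "(\<Sum>k<Suc d. t ^ k /\<^sub>R fact k) \<le> exp t" by (simp add: exp_def)
      moreover have "(\<Sum>k<d. t ^ k /\<^sub>R fact k) \<ge> 0" using t0 by (intro sum_nonneg) auto
      ultimately show ?thesis by (simp add: divide_inverse mult.commute)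
    qed
    also have "exp t \<le> 4/3 + f \<omega>"
    proof -
      \<comment> \<open>From exp 1 \<le> 3 < (4/3)^4.\<close>
      have e14: "exp (1/4::real) \<le> 4/3"
      proof -
        have "exp (1/4::real) ^ 4 = exp 1" by (simp flip: exp_of_nat_mult)
        also have "\<dots> \<le> 3" by (rule exp_le)
        also have "\<dots> \<le> (4/3) ^ 4" by (simp add: power4_eq_xxxx)
        finally show ?thesis using power_mono_iff[of "exp (1/4::real)" "4/3" 4] by simp
      qed
      have step: "exp (real k / 4) \<le> (4/3) ^ k" for k
      proof -
        have "exp (real k / 4) = exp (1/4) ^ k" by (simp flip: exp_of_nat_mult)
        also have "\<dots> \<le> (4/3) ^ k" using e14 by (intro power_mono) auto
        finally show ?thesis .
      qed
      have f0: "f \<omega> \<ge> 0" unfolding f_def by (intro sum_nonneg) auto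
      \<comment> \<open>Rounding up makes level \<open>k - 1\<close> strictly exceeded, so that its
        indicator is 1 and supplies the weight \<open>(4/3) ^ k\<close>.\<close>
      define k where "k = nat (\<lceil>\<bar>S s0 e \<omega>\<bar> / Y0\<rceil>)"
      have k: "\<bar>S s0 e \<omega>\<bar> / Y0 \<le> real k" unfolding k_def by linarith
      then have tk: "t \<le> real k / 4" using Y0 by (simp add: t_def field_simps)
      show ?thesis
      proof (cases k)
        case 0
        then have "exp t \<le> 1" using tk by simp
        then show ?thesis using f0 by linarith
      next
        case (Suc k')
        have "real k' < \<bar>S s0 e \<omega>\<bar> / Y0" using Suc unfolding k_def by linarith
        then have k': "real k' * Y0 < \<bar>S s0 e \<omega>\<bar>" using Y0 by (simp add: less_divide_eq)
        then have "\<omega> \<in> passage s0 e (real k' * Y0)" using se w by (auto simp: passage_def)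
        moreover have "k' \<le> J"
        proof -
          have "real k' * Y0 < real J * Y0" using k' SJ[OF w] by linarith
          then show ?thesis using Y0 by auto
        qed
        ultimately have "(4/3) ^ Suc k' \<le> f \<omega>"
          unfolding f_def using member_le_sum[of k' "{..J}" "\<lambda>k. (4/3) ^ Suc k * indicator (passage s0 e (real k * Y0)) \<omega> :: real"]
          by (simp add: indicator_def)
        moreover have "exp t \<le> exp (real k / 4)" using tk by simp
        ultimately show ?thesis using step[of k] unfolding Suc by linarith
      qed
    qed
    finally have "t ^ d \<le> fact d * (4/3 + f \<omega>)" by (simp add: divide_le_eq mult.commute)
    then have "t ^ d * (4 * Y0) ^ d \<le> fact d * (4/3 + f \<omega>) * (4 * Y0) ^ d"
      using Y0 by (intro mult_right_mono) auto
    moreover have "t ^ d * (4 * Y0) ^ d = \<bar>S s0 e \<omega>\<bar> ^ d"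
      unfolding power_mult_distrib[symmetric] using Y0 by (simp add: t_def)
    ultimately show ?thesis by (simp add: mult_ac)
  qed
  have fi: "integrable M (\<lambda>\<omega>. (4/3) ^ Suc k * indicator (passage s0 e (real k * Y0)) \<omega> :: real)" for k
    by (intro integrable_mult_right integrable_indicator_event passage_events e_n)
  have fI: "integrable M f" unfolding f_def using fi by (intro Bochner_Integration.integrable_sum)
  have Ef: "expectation f \<le> 4"
  proof -
    have ei: "expectation (indicator (passage s0 e (real k * Y0))) = prob (passage s0 e (real k * Y0))" for k
      using Int_absorb2[OF sets.sets_into_space[OF passage_events[OF e_n]]] by simp
    have "expectation f = (\<Sum>k\<le>J. (4/3) ^ Suc k * prob (passage s0 e (real k * Y0)))"
      unfolding f_def using fi by (subst Bochner_Integration.integral_sum) (simp_all only: integral_mult_right_zero ei)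
    also have "\<dots> \<le> (\<Sum>k\<le>J. 4/3 * (2/3) ^ k)"
    proof (rule sum_mono)
      fix k
      have "(4/3) ^ Suc k * prob (passage s0 e (real k * Y0)) \<le> (4/3) ^ Suc k * (1/2::real) ^ k"
        using passage_tail[of k] unfolding Y0_def by (intro mult_left_mono) auto
      also have "\<dots> = 4/3 * ((4/3) ^ k * (1/2) ^ k)" by simp
      also have "\<dots> = 4/3 * (2/3) ^ k" unfolding power_mult_distrib[symmetric] by simp
      finally show "(4/3) ^ Suc k * prob (passage s0 e (real k * Y0)) \<le> 4/3 * (2/3) ^ k" .
    qed
    also have "\<dots> = 4/3 * (\<Sum>k<Suc J. (2/3) ^ k)" by (simp only: sum_distrib_left lessThan_Suc_atMost)
    also have "\<dots> = 4/3 * ((1 - (2/3) ^ Suc J) / (1 - 2/3))" by (subst sum_gp_strict) simp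
    also have "\<dots> \<le> 4" using zero_le_power[of "2/3::real" "Suc J"] by (simp del: zero_le_power power_Suc)
    finally show ?thesis .
  qed
  have YY: "Y0 \<le> Y" "0 \<le> Y" using Y Y0 unfolding Y0_def by linarith+
  have Ef0: "0 \<le> expectation f" by (rule Bochner_Integration.integral_nonneg) (auto simp: f_def intro!: sum_nonneg)
  have "expectation (\<lambda>\<omega>. \<bar>S s0 e \<omega>\<bar> ^ d) \<le> expectation (\<lambda>\<omega>. fact d * (4 * Y0) ^ d * (4/3 + f \<omega>))"
    using pw fI by (intro integral_mono S_abs_power_integrable e_n) auto
  also have "\<dots> = fact d * (4 * Y0) ^ d * (4/3 + expectation f)"
    using fI by (simp add: prob_space)
  also have "\<dots> \<le> fact d * (4 * Y) ^ d * (4/3 + 4)"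
    using Ef Ef0 YY Y0 by (intro mult_mono power_mono add_mono) auto
  also have "\<dots> \<le> fact d * (4 * Y) ^ d * 6"
    using YY by (intro mult_left_mono) auto
  finally show ?thesis by simp
qed

end

section \<open>Decomposition into blocks\<close>

lemma sum_inverse_squares_le: "(\<Sum>k=1..N. 1 / (real k)\<^sup>2) \<le> 2"
proof -
  have "(\<Sum>k=1..N. 1 / (real k)\<^sup>2) \<le> 2 - 1 / real N"
  proof (induction N)
    case (Suc N)
    have "1 / (real (Suc N))\<^sup>2 \<le> 1 / real N - 1 / real (Suc N)" if "N > 0"
    proof -
      have "1 / (real (Suc N))\<^sup>2 \<le> 1 / (real N * real (Suc N))"
        using that by (intro divide_left_mono) (auto simp: power2_eq_square)
      also have "\<dots> = 1 / real N - 1 / real (Suc N)" using that by (simp add: field_simps)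
      finally show ?thesis .
    qed
    then show ?case using Suc by (cases "N = 0") auto
  qed simp
  also have "\<dots> \<le> 2" by simp
  finally show ?thesis .
qed

locale sq_mixing_row = mixing_row +
  fixes \<Lambda> :: real
  assumes Lam1: "1 \<le> \<Lambda>" and phi_sq: "1 \<le> k \<Longrightarrow> \<phi> k \<le> (\<Lambda> / real k)\<^sup>2"
begin

definition V :: "nat \<Rightarrow> nat \<Rightarrow> real" where "V a b = expectation (\<lambda>\<omega>. (S a b \<omega>)\<^sup>2)"

text \<open>At this level the covariance of a block with the rest of the row is at most one eighteenth of the
  variance of the block.\<close>

definition A :: real where "A = 72 * \<Lambda>\<^sup>2 * K"

lemma V_nonneg: "0 \<le> V a b" unfolding V_def by simp

lemma V_empty: "b \<le> a \<Longrightarrow> V a b = 0" unfolding V_def by simp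

lemma A_ge: "72 \<le> A" "K \<le> A"
proof -
  have "1 \<le> \<Lambda>\<^sup>2" using Lam1 by simp
  then have "72 * 1 * 1 \<le> 72 * \<Lambda>\<^sup>2 * K" "72 * 1 * K \<le> 72 * \<Lambda>\<^sup>2 * K" using K1 by (intro mult_mono; simp)+
  then show "72 \<le> A" "K \<le> A" using K1 unfolding A_def by linarith+
qed

lemma expectation_abs_le_sqrt_V: "b \<le> n \<Longrightarrow> expectation (\<lambda>\<omega>. \<bar>S a b \<omega>\<bar>) \<le> sqrt (V a b)"
proof -
  assume b: "b \<le> n"
  have "0 \<le> variance (\<lambda>\<omega>. \<bar>S a b \<omega>\<bar>)" by simp
  also have "variance (\<lambda>\<omega>. \<bar>S a b \<omega>\<bar>) = expectation (\<lambda>\<omega>. \<bar>S a b \<omega>\<bar>\<^sup>2) - (expectation (\<lambda>\<omega>. \<bar>S a b \<omega>\<bar>))\<^sup>2"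
    using S_abs_power_integrable[OF b, of a 1] S_abs_power_integrable[OF b, of a 2] by (intro variance_eq) auto
  finally have "(expectation (\<lambda>\<omega>. \<bar>S a b \<omega>\<bar>))\<^sup>2 \<le> V a b" by (simp add: V_def)
  then show ?thesis by (rule real_le_rsqrt)
qed

text \<open>The right-hand sum is treated one summand at a time: each is bounded by
  \<open>K\<close>, so its covariance with the block needs only the L^1 norm of the block. As the
  mixing coefficients are summable, the bound does not depend on the length of the right-hand
  part.\<close>

lemma covariance_adjacent:
  assumes "a \<le> b" "b \<le> c" "c \<le> n"
  shows "\<bar>expectation (\<lambda>\<omega>. S a b \<omega> * S b c \<omega>)\<bar> \<le> 4 * \<Lambda>\<^sup>2 * K * sqrt (V a b)"
proof -
  let ?m = "expectation (\<lambda>\<omega>. \<bar>S a b \<omega>\<bar>)"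
  have xj: "x j \<in> borel_measurable M" if "j \<in> {b<..c}" for j
    by (rule measurable_from_subalg[OF sub[OF order_refl] x_meas]) (use assms that in auto)
  have K0: "0 < K" using K1 by simp
  have int: "integrable M (\<lambda>\<omega>. S a b \<omega> * x j \<omega>)" if j: "j \<in> {b<..c}" for j
  proof (rule integrable_bounded[where c="(real (b - a) * K) * K"])
    show "(\<lambda>\<omega>. S a b \<omega> * x j \<omega>) \<in> borel_measurable M" by (intro borel_measurable_times S_rv xj[OF j]) (use assms in auto)
    show "\<bar>S a b \<omega> * x j \<omega>\<bar> \<le> (real (b - a) * K) * K" if "\<omega> \<in> space M" for \<omega>
      unfolding abs_mult using S_bound[of b \<omega> a] x_bound[of j \<omega>] that j assms K0 by (intro mult_mono) auto
  qed
  have cov: "\<bar>expectation (\<lambda>\<omega>. S a b \<omega> * x j \<omega>)\<bar> \<le> 2 * (\<Lambda> / real (j - b))\<^sup>2 * K * ?m" if j: "j \<in> {b<..c}" for j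
  proof -
    have J: "{1..b} \<subseteq> {1..n}" "{b + (j - b)..n} \<subseteq> {1..n}" using assms j by auto
    have "\<bar>expectation (\<lambda>\<omega>. S a b \<omega> * x j \<omega>) - expectation (S a b) * expectation (x j)\<bar> \<le> 2 * \<phi> (j - b) * K * ?m"
    proof (rule phi_covariance_bounded[OF sub[OF J(1)] sub[OF J(2)]])
      show "\<bar>prob (A \<inter> B) - prob A * prob B\<bar> \<le> \<phi> (j - b) * prob A"
        if "A \<in> sets (Fs {1..b})" "B \<in> sets (Fs {b + (j - b)..n})" for A B
        using mixing[of b "j - b" A B] that assms j by auto
      show "S a b \<in> borel_measurable (Fs {1..b})" using assms by (intro S_meas) auto
      show "x j \<in> borel_measurable (Fs {b + (j - b)..n})" using assms j by (intro x_meas) auto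
      show "\<bar>S a b \<omega>\<bar> \<le> real (b - a) * K" if "\<omega> \<in> space M" for \<omega> using S_bound[of b \<omega> a] that assms by auto
      show "\<bar>x j \<omega>\<bar> \<le> K" if "\<omega> \<in> space M" for \<omega> using x_bound that assms j by auto
    qed (use K0 phi0 in auto)
    also have "\<dots> \<le> 2 * (\<Lambda> / real (j - b))\<^sup>2 * K * ?m"
      using phi_sq[of "j - b"] j K0 by (intro mult_right_mono) auto
    finally show ?thesis using x_centered[of j] assms j by auto
  qed
  have "expectation (\<lambda>\<omega>. S a b \<omega> * S b c \<omega>) = (\<Sum>j\<in>{b<..c}. expectation (\<lambda>\<omega>. S a b \<omega> * x j \<omega>))"
    unfolding S_def[of b c] sum_distrib_left using int by (intro Bochner_Integration.integral_sum) auto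
  also have "\<bar>\<dots>\<bar> \<le> (\<Sum>j\<in>{b<..c}. 2 * (\<Lambda> / real (j - b))\<^sup>2 * K * ?m)"
    using cov by (intro order.trans[OF sum_abs] sum_mono) auto
  also have "\<dots> = (\<Sum>k\<in>{1..c-b}. 2 * (\<Lambda> / real k)\<^sup>2 * K * ?m)"
    by (rule sum.reindex_bij_witness[of _ "\<lambda>k. k + b" "\<lambda>j. j - b"]) auto
  also have "\<dots> = 2 * \<Lambda>\<^sup>2 * K * ?m * (\<Sum>k\<in>{1..c-b}. 1 / (real k)\<^sup>2)"
    unfolding sum_distrib_left by (intro sum.cong) (auto simp: power_divide)
  also have "\<dots> \<le> 2 * \<Lambda>\<^sup>2 * K * ?m * 2"
    using sum_inverse_squares_le K0 by (intro mult_left_mono mult_nonneg_nonneg) auto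
  also have "\<dots> \<le> 2 * \<Lambda>\<^sup>2 * K * sqrt (V a b) * 2"
    using expectation_abs_le_sqrt_V[of b a] assms K0 by (intro mult_mono mult_nonneg_nonneg) (auto simp: V_nonneg)
  finally show ?thesis by (simp add: mult_ac)
qed

text \<open>The covariance is linear in the standard deviation of the block while the variance is
  quadratic, so above level \<open>A\<close> the cross term is at most one ninth of
  \<open>V a b\<close>.\<close>

lemma V_superadditive:
  assumes "a \<le> b" "b \<le> c" "c \<le> n" "A\<^sup>2 \<le> V a b"
  shows "8 / 9 * V a b + V b c \<le> V a c"
proof -
  have i2: "integrable M (\<lambda>\<omega>. (S a b \<omega>)\<^sup>2)" "integrable M (\<lambda>\<omega>. (S b c \<omega>)\<^sup>2)"
    using S_power_integrable assms by auto
  have i: "integrable M (\<lambda>\<omega>. S a b \<omega> * S b c \<omega>)"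
  proof (rule integrable_bounded[where c="(real (b - a) * K) * (real (c - b) * K)"])
    show "(\<lambda>\<omega>. S a b \<omega> * S b c \<omega>) \<in> borel_measurable M"
      by (intro borel_measurable_times S_rv) (use assms in auto)
    show "\<bar>S a b \<omega> * S b c \<omega>\<bar> \<le> (real (b - a) * K) * (real (c - b) * K)" if "\<omega> \<in> space M" for \<omega>
      unfolding abs_mult using S_bound[of b \<omega> a] S_bound[of c \<omega> b] that assms K1 by (intro mult_mono) auto
  qed
  have "V a c = expectation (\<lambda>\<omega>. (S a b \<omega>)\<^sup>2 + (S b c \<omega>)\<^sup>2 + 2 * (S a b \<omega> * S b c \<omega>))"
    unfolding V_def using S_split[OF assms(1,2)] by (simp add: power2_sum algebra_simps)
  also have "\<dots> = V a b + V b c + 2 * expectation (\<lambda>\<omega>. S a b \<omega> * S b c \<omega>)"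
    using i i2 by (simp add: V_def)
  finally have 1: "V a c = V a b + V b c + 2 * expectation (\<lambda>\<omega>. S a b \<omega> * S b c \<omega>)" .
  have sV: "A \<le> sqrt (V a b)" using assms(4) by (rule real_le_rsqrt)
  have "9 * (2 * (4 * \<Lambda>\<^sup>2 * K * sqrt (V a b))) = A * sqrt (V a b)" by (simp add: A_def)
  also have "\<dots> \<le> sqrt (V a b) * sqrt (V a b)" using sV V_nonneg by (intro mult_right_mono) auto
  also have "\<dots> = V a b" using V_nonneg by simp
  finally show ?thesis using covariance_adjacent[OF assms(1-3)] 1 by (simp add: abs_le_iff)
qed

lemma S_sq_comb_le:
  assumes "b1 \<le> n" "b2 \<le> n" "b3 \<le> n" "b4 \<le> n"
    and "\<And>\<omega>. \<omega> \<in> space M \<Longrightarrow> (S a1 b1 \<omega>)\<^sup>2 \<le> c * ((S a2 b2 \<omega>)\<^sup>2 + (S a3 b3 \<omega>)\<^sup>2 + (S a4 b4 \<omega>)\<^sup>2)"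
  shows "V a1 b1 \<le> c * (V a2 b2 + V a3 b3 + V a4 b4)"
proof -
  have "V a1 b1 \<le> expectation (\<lambda>\<omega>. c * ((S a2 b2 \<omega>)\<^sup>2 + (S a3 b3 \<omega>)\<^sup>2 + (S a4 b4 \<omega>)\<^sup>2))"
    unfolding V_def using assms S_power_integrable by (intro integral_mono) auto
  also have "\<dots> = c * (V a2 b2 + V a3 b3 + V a4 b4)"
    unfolding V_def using assms S_power_integrable by simp
  finally show ?thesis .
qed

text \<open>The trailing 0 brings the inequality into the three-slot form.\<close>

lemma sq_add_le: "((y::real) + z)\<^sup>2 \<le> 2 * (y\<^sup>2 + z\<^sup>2 + 0)"
  using sum_squares_ge_zero[of "y - z" 0] by (simp add: power2_eq_square algebra_simps)

lemma V_suffix: "a \<le> b \<Longrightarrow> b \<le> c \<Longrightarrow> c \<le> n \<Longrightarrow> V b c \<le> 2 * (V a c + V a b)"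
proof -
  assume b: "a \<le> b" "b \<le> c" "c \<le> n"
  have "V b c \<le> 2 * (V a c + V a b + V 0 0)"
  proof (rule S_sq_comb_le)
    show "(S b c \<omega>)\<^sup>2 \<le> 2 * ((S a c \<omega>)\<^sup>2 + (S a b \<omega>)\<^sup>2 + (S 0 0 \<omega>)\<^sup>2)" for \<omega>
      using sq_add_le[of "S a c \<omega>" "- S a b \<omega>"] S_split[OF b(1,2), of \<omega>] by simp
  qed (use b in auto)
  then show ?thesis by (simp add: V_empty)
qed

lemma V_join: "a \<le> b \<Longrightarrow> b \<le> c \<Longrightarrow> c \<le> n \<Longrightarrow> V a c \<le> 2 * (V a b + V b c)"
proof -
  assume b: "a \<le> b" "b \<le> c" "c \<le> n"
  have "V a c \<le> 2 * (V a b + V b c + V 0 0)"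
  proof (rule S_sq_comb_le)
    show "(S a c \<omega>)\<^sup>2 \<le> 2 * ((S a b \<omega>)\<^sup>2 + (S b c \<omega>)\<^sup>2 + (S 0 0 \<omega>)\<^sup>2)" for \<omega>
      using sq_add_le[of "S a b \<omega>" "S b c \<omega>"] S_split[OF b(1,2), of \<omega>] by simp
  qed (use b in auto)
  then show ?thesis by (simp add: V_empty)
qed

lemma V_single: "1 \<le> e \<Longrightarrow> e \<le> n \<Longrightarrow> V (e - 1) e \<le> K\<^sup>2"
proof -
  assume e: "1 \<le> e" "e \<le> n"
  have "\<bar>expectation (\<lambda>\<omega>. (S (e - 1) e \<omega>)\<^sup>2)\<bar> \<le> K\<^sup>2"
  proof (rule abs_expectation_le)
    fix \<omega> assume "\<omega> \<in> space M"
    then have "\<bar>S (e - 1) e \<omega>\<bar> \<le> K" using S_bound[of e \<omega> "e - 1"] e by simp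
    then show "\<bar>(S (e - 1) e \<omega>)\<^sup>2\<bar> \<le> K\<^sup>2" using power_mono[of "\<bar>S (e - 1) e \<omega>\<bar>" K 2] by simp
  qed (use e in measurable)
  then show ?thesis by (simp add: V_def)
qed

lemma V_suffix_step: "a \<le> t \<Longrightarrow> t < e \<Longrightarrow> e \<le> n \<Longrightarrow> V t e \<le> 3 * (V a (e - 1) + V a t + K\<^sup>2)"
proof -
  assume b: "a \<le> t" "t < e" "e \<le> n"
  have "V t e \<le> 3 * (V a (e - 1) + V a t + V (e - 1) e)"
  proof (rule S_sq_comb_le)
    fix \<omega>
    define p q r where pqr: "p = S a (e - 1) \<omega>" "q = S a t \<omega>" "r = S (e - 1) e \<omega>"
    have "S t e \<omega> = p - q + r"
      using S_split[of a t "e - 1" \<omega>] S_split[of t "e - 1" e \<omega>] b by (simp add: pqr)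
    moreover have "0 \<le> (p + q)\<^sup>2 + (p - r)\<^sup>2 + (q + r)\<^sup>2" by simp
    then have "(p - q + r)\<^sup>2 \<le> 3 * (p\<^sup>2 + q\<^sup>2 + r\<^sup>2)" by (simp add: power2_eq_square algebra_simps)
    ultimately show "(S t e \<omega>)\<^sup>2 \<le> 3 * ((S a (e - 1) \<omega>)\<^sup>2 + (S a t \<omega>)\<^sup>2 + (S (e - 1) e \<omega>)\<^sup>2)"
      by (simp add: pqr)
  qed (use b in auto)
  also have "\<dots> \<le> 3 * (V a (e - 1) + V a t + K\<^sup>2)" using V_single[of e] b by simp
  finally show ?thesis .
qed

section \<open>Cutting a row into blocks\<close>

lemma block_partition:
  "s < n \<Longrightarrow> \<exists>u b. 1 \<le> u \<and> b 0 = s \<and> b u = n \<and> (\<forall>i<u. b i < b (Suc i)) \<and>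
     (\<forall>i<u. \<forall>t. b i \<le> t \<longrightarrow> t \<le> b (Suc i) \<longrightarrow> V t (b (Suc i)) \<le> (3 * A)\<^sup>2) \<and>
     real (u - 1) * (8 / 9 * A\<^sup>2) \<le> V s n \<and> (\<forall>i\<le>u. V (b i) n \<le> V s n)"
proof (induction "n - s" arbitrary: s rule: less_induct)
  case less
  have KA: "K\<^sup>2 \<le> A\<^sup>2" using A_ge K1 by (intro power_mono) auto
  define b1 where "b1 = (\<lambda>i::nat. if i = 0 then s else n)"
  show ?case
  proof (cases "\<exists>e. s \<le> e \<and> e \<le> n \<and> A\<^sup>2 < V s e")
    case False
    then have le: "V s e \<le> A\<^sup>2" if "s \<le> e" "e \<le> n" for e using that by force
    have "V t n \<le> (3 * A)\<^sup>2" if t: "s \<le> t" "t \<le> n" for t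
    proof -
      have "V t n \<le> 2 * (V s n + V s t)" using t by (intro V_suffix) auto
      also have "\<dots> \<le> (3 * A)\<^sup>2"
      proof -
        have "V s n \<le> A\<^sup>2" "V s t \<le> A\<^sup>2" using le t less.prems by auto
        then have "2 * (V s n + V s t) \<le> 2 * (A\<^sup>2 + A\<^sup>2)" by simp
        also have "\<dots> \<le> 9 * A\<^sup>2" by simp
        also have "\<dots> = (3 * A)\<^sup>2" by (simp add: power_mult_distrib)
        finally show ?thesis .
      qed
      finally show ?thesis .
    qed
    then show ?thesis using less.prems V_nonneg
      by (intro exI[of _ 1] exI[of _ b1]) (auto simp: b1_def le_Suc_eq V_empty)
  next
    case True
    \<comment> \<open>The greedy cut: the block ends at the first index where its variance exceeds
      \<open>A\<^sup>2\<close>.\<close>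
    define e where "e = (LEAST e. s \<le> e \<and> e \<le> n \<and> A\<^sup>2 < V s e)"
    have e: "s \<le> e" "e \<le> n" "A\<^sup>2 < V s e"
      using LeastI_ex[OF True] unfolding e_def by auto
    have se: "s < e" using e A_ge zero_le_power2[of A] by (cases "s = e") (auto simp: V_empty)
    have le: "V s t \<le> A\<^sup>2" if "s \<le> t" "t < e" for t
      using not_less_Least[of t "\<lambda>e. s \<le> e \<and> e \<le> n \<and> A\<^sup>2 < V s e"] that e unfolding e_def[symmetric] by force
    have blk: "V t e \<le> (3 * A)\<^sup>2" if t: "s \<le> t" "t \<le> e" for t
    proof (cases "t = e")
      case False
      have "V t e \<le> 3 * (V s (e - 1) + V s t + K\<^sup>2)" using t False e by (intro V_suffix_step) auto
      \<comment> \<open>Just before \<open>e\<close> the level was not yet exceeded, and the last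
        summand is at most \<open>K \<le> A\<close>. This gives \<open>(3 * A)\<^sup>2\<close> for
        every tail of the block, which the maximal inequality requires.\<close>
      also have "\<dots> \<le> 3 * (A\<^sup>2 + A\<^sup>2 + A\<^sup>2)" using le[of "e - 1"] le[of t] KA se t False
        by (intro mult_left_mono add_mono) auto
      finally show ?thesis by (simp add: power_mult_distrib)
    qed (simp add: V_empty)
    have big: "8 / 9 * V s e + V e n \<le> V s n" using e by (intro V_superadditive) auto
    show ?thesis
    proof (cases "e = n")
      case True
      then show ?thesis using less.prems V_nonneg blk
        by (intro exI[of _ 1] exI[of _ b1]) (auto simp: b1_def le_Suc_eq V_empty)
    next
      case False
      then obtain u b where u: "1 \<le> u" "b 0 = e" "b u = n" "\<forall>i<u. b i < b (Suc i)"
        "\<forall>i<u. \<forall>t. b i \<le> t \<longrightarrow> t \<le> b (Suc i) \<longrightarrow> V t (b (Suc i)) \<le> (3 * A)\<^sup>2"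
        "real (u - 1) * (8 / 9 * A\<^sup>2) \<le> V e n" "\<forall>i\<le>u. V (b i) n \<le> V e n"
        using less.hyps[of e] se e by (auto simp: diff_less_mono2)
      define b' where "b' = (\<lambda>i. case i of 0 \<Rightarrow> s | Suc i \<Rightarrow> b i)"
      have b'[simp]: "b' 0 = s" "b' (Suc i) = b i" for i by (auto simp: b'_def)
      have "V e n \<le> V s n" using big V_nonneg[of s e] by linarith
      \<comment> \<open>Every block except the last has variance above \<open>A\<^sup>2\<close>, and
        superadditivity lets each claim 8/9 of it; the last one may be small, hence
        \<open>u - 1\<close>.\<close>
      have c: "real (Suc u - 1) * (8 / 9 * A\<^sup>2) \<le> V s n"
      proof -
        have "real (Suc u - 1) * (8 / 9 * A\<^sup>2) = 8 / 9 * A\<^sup>2 + real (u - 1) * (8 / 9 * A\<^sup>2)"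
          using u(1) by (cases u) (simp_all add: distrib_right)
        also have "\<dots> \<le> 8 / 9 * V s e + V e n" using u(6) e(3) by (intro add_mono) auto
        finally show ?thesis using big by simp
      qed
      have 4: "\<forall>i<Suc u. b' i < b' (Suc i)"
        using u se by (auto simp: less_Suc_eq_0_disj)
      have 5: "\<forall>i<Suc u. \<forall>t. b' i \<le> t \<longrightarrow> t \<le> b' (Suc i) \<longrightarrow> V t (b' (Suc i)) \<le> (3 * A)\<^sup>2"
        using u blk by (auto simp: less_Suc_eq_0_disj)
      have 7: "\<forall>i\<le>Suc u. V (b' i) n \<le> V s n"
      proof (intro allI impI)
        fix i assume "i \<le> Suc u"
        then show "V (b' i) n \<le> V s n" using u(7) \<open>V e n \<le> V s n\<close> by (cases i) force+
      qed
      show ?thesis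
        using u(1,3) c 4 5 7 by (intro exI[of _ "Suc u"] exI[of _ b'] conjI) auto
    qed
  qed
qed

text \<open>An arbitrary start \<open>t\<close> lies in some block. The part up to the end of that
  block is controlled by the block bound, the rest starts at a cut point; 2 * (9 + 1) is below
  25.\<close>

lemma V_suffix_le:
  assumes u: "b 0 = 0" "b u = n" "\<And>i. i < u \<Longrightarrow> b i < b (Suc i)"
    and blk: "\<And>i t. i < u \<Longrightarrow> b i \<le> t \<Longrightarrow> t \<le> b (Suc i) \<Longrightarrow> V t (b (Suc i)) \<le> (3 * A)\<^sup>2"
    and suf: "\<And>i. i \<le> u \<Longrightarrow> V (b i) n \<le> \<sigma>\<^sup>2" and \<sigma>: "A \<le> \<sigma>" and t: "t \<le> n"
  shows "V t n \<le> (5 * \<sigma>)\<^sup>2"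
proof (cases "t = 0")
  case True
  have "V t n \<le> \<sigma>\<^sup>2" using suf[of 0] u True by simp
  also have "\<dots> \<le> (5 * \<sigma>)\<^sup>2" by (simp add: power_mult_distrib)
  finally show ?thesis .
next
  case False
  define i where "i = (LEAST i. t \<le> b i)"
  have tu: "t \<le> b u" using u t by simp
  have ti: "t \<le> b i" unfolding i_def by (rule LeastI[of _ u]) (rule tu)
  have iu: "i \<le> u" unfolding i_def by (rule Least_le) (rule tu)
  obtain k where k: "i = Suc k" using ti u False by (cases i) auto
  have bk: "b k \<le> t" using not_less_Least[of k "\<lambda>i. t \<le> b i"] k unfolding i_def[symmetric] by auto
  have bn: "b i \<le> n"
  proof -
    have "b i \<le> b u" using iu
    proof (rule dec_induct[of i u "\<lambda>m. b i \<le> b m"])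
      show "b i \<le> b (Suc m)" if "i \<le> m" "m < u" "b i \<le> b m" for m using u(3)[of m] that by auto
    qed auto
    then show ?thesis using u by simp
  qed
  have "V t n \<le> 2 * (V t (b i) + V (b i) n)" using ti bn by (intro V_join) auto
  also have "\<dots> \<le> 2 * ((3 * A)\<^sup>2 + \<sigma>\<^sup>2)" using blk[of k t] suf[of i] k iu bk ti by auto
  also have "\<dots> \<le> 2 * ((3 * \<sigma>)\<^sup>2 + \<sigma>\<^sup>2)" using \<sigma> A_ge by (intro mult_left_mono add_mono power_mono) auto
  also have "\<dots> \<le> (5 * \<sigma>)\<^sup>2" by (simp add: power_mult_distrib)
  finally show ?thesis .
qed

end

section \<open>Generating functions of windows\<close>

lemma sum_Pow_Un_disjoint:
  fixes g :: "'b set \<Rightarrow> 'c :: comm_monoid_add"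
  assumes "finite L" "finite R" "L \<inter> R = {}"
  shows "(\<Sum>T\<in>Pow (L \<union> R). g T) = (\<Sum>P\<in>Pow L. \<Sum>Q\<in>Pow R. g (P \<union> Q))"
proof -
  have "(\<Sum>P\<in>Pow L. \<Sum>Q\<in>Pow R. g (P \<union> Q)) = (\<Sum>(P, Q)\<in>Pow L \<times> Pow R. g (P \<union> Q))"
    by (rule sum.cartesian_product)
  also have "\<dots> = (\<Sum>T\<in>Pow (L \<union> R). g T)"
    by (rule sum.reindex_bij_witness[of _ "\<lambda>T. (T \<inter> L, T \<inter> R)" "\<lambda>(P, Q). P \<union> Q"])
       (use assms in \<open>auto\<close>)
  finally show ?thesis ..
qed

text \<open>Pigeonhole: \<open>k\<close> disjoint intervals of length \<open>h\<close> cannot all be met by the fewer than \<open>k\<close>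
  letters different from \<open>l\<close>.\<close>
lemma word_gap:
  fixes f :: "nat \<Rightarrow> nat"
  assumes "r0 < k" "f r0 = l"
  obtains i where "i < k" "\<And>r. r < k \<Longrightarrow> \<not> (l + i * h < f r \<and> f r \<le> l + (i + 1) * h)"
proof -
  have "\<exists>i<k. \<forall>r<k. \<not> (l + i * h < f r \<and> f r \<le> l + (i + 1) * h)"
  proof (rule ccontr)
    assume "\<not> ?thesis"
    then have "\<forall>i\<in>{..<k}. \<exists>r. r < k \<and> l + i * h < f r \<and> f r \<le> l + (i + 1) * h" by auto
    then obtain c where c: "\<And>i. i < k \<Longrightarrow> c i < k \<and> l + i * h < f (c i) \<and> f (c i) \<le> l + (i + 1) * h"
      by (metis lessThan_iff)
    have "inj_on c {..<k}"
    proof (rule inj_onI, rule ccontr)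
      fix i j assume ij: "i \<in> {..<k}" "j \<in> {..<k}" "c i = c j" "i \<noteq> j"
      have no: False if "i' < j'" "i' < k" "j' < k" "c i' = c j'" for i' j'
      proof -
        have "(i' + 1) * h \<le> j' * h" using that by (intro mult_right_mono) auto
        then show False using c[of i'] c[of j'] that by auto
      qed
      show False using ij no[of i j] no[of j i] by (cases "i < j") auto
    qed
    moreover have "c ` {..<k} \<subseteq> {..<k} - {r0}"
    proof
      fix r assume "r \<in> c ` {..<k}"
      then obtain i where "i < k" "r = c i" by auto
      then show "r \<in> {..<k} - {r0}" using c[of i] assms by auto
    qed
    ultimately have "card {..<k} \<le> card ({..<k} - {r0})" by (intro card_inj_on_le) auto
    then show False using assms by simp
  qed
  then show thesis using that by blast
qed

context prob_space
begin

text \<open>A product of expectations is an expectation over two independent copies. The identity is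
  assumed for all pairs of points and integrated in one variable at a time, which replaces a product
  measure.\<close>

lemma expectation_bilinear_cong:
  fixes a b c d :: "'i \<Rightarrow> 'a \<Rightarrow> real"
  assumes I: "\<And>i. i \<in> I \<Longrightarrow> integrable M (a i) \<and> integrable M (b i)"
    and J: "\<And>j. j \<in> J \<Longrightarrow> integrable M (a' j) \<and> integrable M (b' j)"
    and eq: "\<And>\<omega> \<omega>'. \<omega> \<in> space M \<Longrightarrow> \<omega>' \<in> space M \<Longrightarrow>
      (\<Sum>i\<in>I. a i \<omega> * b i \<omega>') = (\<Sum>j\<in>J. a' j \<omega> * b' j \<omega>')"
  shows "(\<Sum>i\<in>I. expectation (a i) * expectation (b i)) = (\<Sum>j\<in>J. expectation (a' j) * expectation (b' j))"
proof -
  have inner: "(\<Sum>i\<in>I. a i \<omega> * expectation (b i)) = (\<Sum>j\<in>J. a' j \<omega> * expectation (b' j))" if w: "\<omega> \<in> space M" for \<omega>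
  proof -
    have "(\<Sum>i\<in>I. a i \<omega> * expectation (b i)) = expectation (\<lambda>\<omega>'. \<Sum>i\<in>I. a i \<omega> * b i \<omega>')"
      using I by (subst Bochner_Integration.integral_sum) auto
    also have "\<dots> = expectation (\<lambda>\<omega>'. \<Sum>j\<in>J. a' j \<omega> * b' j \<omega>')"
      using eq w by (intro Bochner_Integration.integral_cong) auto
    also have "\<dots> = (\<Sum>j\<in>J. a' j \<omega> * expectation (b' j))"
      using J by (subst Bochner_Integration.integral_sum) auto
    finally show ?thesis .
  qed
  have "(\<Sum>i\<in>I. expectation (a i) * expectation (b i)) = expectation (\<lambda>\<omega>. \<Sum>i\<in>I. a i \<omega> * expectation (b i))"
    using I by (subst Bochner_Integration.integral_sum) auto
  also have "\<dots> = expectation (\<lambda>\<omega>. \<Sum>j\<in>J. a' j \<omega> * expectation (b' j))"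
    using inner by (intro Bochner_Integration.integral_cong) auto
  also have "\<dots> = (\<Sum>j\<in>J. expectation (a' j) * expectation (b' j))"
    using J by (subst Bochner_Integration.integral_sum) auto
  finally show ?thesis .
qed

end

section \<open>Words in weakly dependent letters\<close>

locale weak_dependence = prob_space M for M :: "'a measure" +
  fixes X :: "nat \<Rightarrow> 'a \<Rightarrow> real" and u p :: nat and H :: real and \<epsilon> :: "nat \<Rightarrow> real" and c :: real
  assumes X_rv: "i \<in> {1..u} \<Longrightarrow> X i \<in> borel_measurable M"
    and X_bounded: "i \<in> {1..u} \<Longrightarrow> \<omega> \<in> space M \<Longrightarrow> \<bar>X i \<omega>\<bar> \<le> c"
    and X_mean: "i \<in> {1..u} \<Longrightarrow> expectation (X i) = 0"
    and H0: "0 \<le> H" and eps0: "0 \<le> \<epsilon> h"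
    and word_bound: "finite (T :: nat set) \<Longrightarrow> card T \<le> p \<Longrightarrow> f ` T \<subseteq> {1..u} \<Longrightarrow>
      \<bar>expectation (\<lambda>\<omega>. \<Prod>r\<in>T. X (f r) \<omega>)\<bar> \<le> H ^ card T"
    and word_dec: "finite (L :: nat set) \<Longrightarrow> finite R \<Longrightarrow> L \<inter> R = {} \<Longrightarrow> card L + card R \<le> p \<Longrightarrow> 1 \<le> h \<Longrightarrow>
      f ` L \<subseteq> {1..s} \<Longrightarrow> f ` R \<subseteq> {s + h..u} \<Longrightarrow> s + h \<le> Suc u \<Longrightarrow>
      \<bar>expectation (\<lambda>\<omega>. (\<Prod>r\<in>L. X (f r) \<omega>) * (\<Prod>r\<in>R. X (f r) \<omega>)) -
        expectation (\<lambda>\<omega>. \<Prod>r\<in>L. X (f r) \<omega>) * expectation (\<lambda>\<omega>. \<Prod>r\<in>R. X (f r) \<omega>)\<bar>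
        \<le> \<epsilon> h * H ^ (card L + card R)"
begin

text \<open>\<open>f\<close> assigns letters to positions and \<open>T\<close> selects positions.
  Keeping positions apart from letters lets one word be distributed over two copies, with repeated
  letters separated.\<close>

definition word :: "(nat \<Rightarrow> nat) \<Rightarrow> nat set \<Rightarrow> real" where
  "word f T = expectation (\<lambda>\<omega>. \<Prod>r\<in>T. X (f r) \<omega>)"

definition F :: "nat \<Rightarrow> nat \<Rightarrow> real fps" where
  "F l t = Abs_fps (\<lambda>k. expectation (\<lambda>\<omega>. (\<Sum>i\<in>{l..t}. X i \<omega>) ^ k) / fact k)"

lemma letters_subset: "f \<in> A \<rightarrow>\<^sub>E I \<Longrightarrow> I \<subseteq> {1..u} \<Longrightarrow> T \<subseteq> A \<Longrightarrow> f ` T \<subseteq> {1..u}"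
  by (meson PiE_mem image_subsetI subset_iff)

lemma word_integrable: "f ` T \<subseteq> {1..u} \<Longrightarrow> integrable M (\<lambda>\<omega>. \<Prod>r\<in>T. X (f r) \<omega>)"
proof (rule integrable_bounded)
  assume T: "f ` T \<subseteq> {1..u}"
  then show "(\<lambda>\<omega>. \<Prod>r\<in>T. X (f r) \<omega>) \<in> borel_measurable M"
    by (intro borel_measurable_prod X_rv) auto
  show "\<bar>\<Prod>r\<in>T. X (f r) \<omega>\<bar> \<le> (\<Prod>r\<in>T. c)" if "\<omega> \<in> space M" for \<omega>
    unfolding abs_prod using T X_bounded[OF _ that] by (intro prod_mono) auto
qed

lemma weighted_sum_power_integrable:
  assumes "I \<subseteq> {1..u}"
  shows "integrable M (\<lambda>\<omega>. (\<Sum>i\<in>I. \<alpha> i * X i \<omega>) ^ k)"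
proof (rule integrable_bounded)
  show "(\<lambda>\<omega>. (\<Sum>i\<in>I. \<alpha> i * X i \<omega>) ^ k) \<in> borel_measurable M"
    using assms X_rv by (intro borel_measurable_power borel_measurable_sum borel_measurable_times) auto
  show "\<bar>(\<Sum>i\<in>I. \<alpha> i * X i \<omega>) ^ k\<bar> \<le> (\<Sum>i\<in>I. \<bar>\<alpha> i\<bar> * c) ^ k" if w: "\<omega> \<in> space M" for \<omega>
    unfolding power_abs using assms X_bounded[OF _ w]
    by (intro power_mono order.trans[OF sum_abs] sum_mono) (auto simp: abs_mult intro!: mult_left_mono)
qed

text \<open>The left side is the \<open>k\<close>-th moment of the weighted sum over two independent
  copies, one with weights \<open>\<alpha>\<close>, one with \<open>\<beta>\<close>. Expanding the
  power, every position picks a letter and a copy; \<open>T\<close> is the set of positions in the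
  first copy.\<close>

lemma moment_product_words:
  assumes I: "I \<subseteq> {1..u}"
  shows "(\<Sum>i\<le>k. real (k choose i) * expectation (\<lambda>\<omega>. (\<Sum>j\<in>I. \<alpha> j * X j \<omega>) ^ i) * expectation (\<lambda>\<omega>. (\<Sum>j\<in>I. \<beta> j * X j \<omega>) ^ (k - i))) =
    (\<Sum>f\<in>{..<k} \<rightarrow>\<^sub>E I. \<Sum>T\<in>Pow {..<k}. (\<Prod>r\<in>T. \<alpha> (f r)) * (\<Prod>r\<in>{..<k} - T. \<beta> (f r)) * (word f T * word f ({..<k} - T)))"
proof -
  have fI: "finite I" using I finite_subset by blast
  let ?J = "({..<k} \<rightarrow>\<^sub>E I) \<times> Pow {..<k}"
  let ?a = "\<lambda>i \<omega>. real (k choose i) * (\<Sum>j\<in>I. \<alpha> j * X j \<omega>) ^ i"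
  let ?b = "\<lambda>i \<omega>. (\<Sum>j\<in>I. \<beta> j * X j \<omega>) ^ (k - i)"
  let ?a' = "\<lambda>(f, T) \<omega>. \<Prod>r\<in>T. \<alpha> (f r) * X (f r) \<omega>"
  let ?b' = "\<lambda>(f, T) \<omega>. \<Prod>r\<in>{..<k} - T. \<beta> (f r) * X (f r) \<omega>"
  have im: "f ` T \<subseteq> {1..u}" if "f \<in> {..<k} \<rightarrow>\<^sub>E I" "T \<subseteq> {..<k}" for f T
    using letters_subset[OF that(1) I that(2)] .
  have "(\<Sum>i\<le>k. expectation (?a i) * expectation (?b i)) = (\<Sum>j\<in>?J. expectation (?a' j) * expectation (?b' j))"
  proof (rule expectation_bilinear_cong)
    show "integrable M (?a i) \<and> integrable M (?b i)" for i
      using weighted_sum_power_integrable[OF I] by auto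
    show "integrable M (?a' j) \<and> integrable M (?b' j)" if jJ: "j \<in> ?J" for j
    proof -
      obtain f T where j: "j = (f, T)" "f \<in> {..<k} \<rightarrow>\<^sub>E I" "T \<subseteq> {..<k}" using jJ by (cases j) auto
      have "integrable M (\<lambda>\<omega>. \<Prod>r\<in>T. X (f r) \<omega>)" "integrable M (\<lambda>\<omega>. \<Prod>r\<in>{..<k} - T. X (f r) \<omega>)"
        using word_integrable[OF im[OF j(2,3)]] word_integrable[OF im[OF j(2) Diff_subset]] by auto
      then show ?thesis by (simp add: j prod.distrib)
    qed
    fix \<omega> \<omega>'
    have "(\<Sum>i\<le>k. ?a i \<omega> * ?b i \<omega>') = ((\<Sum>j\<in>I. \<alpha> j * X j \<omega>) + (\<Sum>j\<in>I. \<beta> j * X j \<omega>')) ^ k"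
      by (simp add: binomial_ring)
    also have "\<dots> = (\<Prod>r\<in>{..<k}. \<Sum>j\<in>I. \<alpha> j * X j \<omega> + \<beta> j * X j \<omega>')"
      by (simp add: sum.distrib)
    also have "\<dots> = (\<Sum>f\<in>{..<k} \<rightarrow>\<^sub>E I. \<Prod>r\<in>{..<k}. \<alpha> (f r) * X (f r) \<omega> + \<beta> (f r) * X (f r) \<omega>')"
      using fI by (intro prod_sum_PiE) auto
    also have "\<dots> = (\<Sum>f\<in>{..<k} \<rightarrow>\<^sub>E I. \<Sum>T\<in>Pow {..<k}. ?a' (f, T) \<omega> * ?b' (f, T) \<omega>')"
      by (simp add: prod_add)
    also have "\<dots> = (\<Sum>j\<in>?J. ?a' j \<omega> * ?b' j \<omega>')"
      by (subst sum.cartesian_product) (auto intro!: sum.cong)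
    finally show "(\<Sum>i\<le>k. ?a i \<omega> * ?b i \<omega>') = (\<Sum>j\<in>?J. ?a' j \<omega> * ?b' j \<omega>')" .
  qed
  also have "\<dots> = (\<Sum>f\<in>{..<k} \<rightarrow>\<^sub>E I. \<Sum>T\<in>Pow {..<k}. expectation (?a' (f, T)) * expectation (?b' (f, T)))"
    by (subst sum.cartesian_product) (auto intro!: sum.cong)
  also have "\<dots> = (\<Sum>f\<in>{..<k} \<rightarrow>\<^sub>E I. \<Sum>T\<in>Pow {..<k}. (\<Prod>r\<in>T. \<alpha> (f r)) * (\<Prod>r\<in>{..<k} - T. \<beta> (f r)) * (word f T * word f ({..<k} - T)))"
    by (intro sum.cong refl) (simp add: prod.distrib word_def)
  finally show ?thesis by simp
qed

text \<open>Windows are encoded by indicator weights, so that products of different pairs of windows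
  become sums over the same words and can be subtracted term by term.\<close>

lemma F_mult_words:
  assumes I: "{l..t} \<subseteq> {1..u}" and sub: "{a..b} \<subseteq> {l..t}" "{a'..b'} \<subseteq> {l..t}"
  shows "fact k * (F a b * F a' b') $ k =
    (\<Sum>f\<in>{..<k} \<rightarrow>\<^sub>E {l..t}. \<Sum>T\<in>Pow {..<k}. (\<Prod>r\<in>T. indicator {a..b} (f r)) * (\<Prod>r\<in>{..<k} - T. indicator {a'..b'} (f r))
      * (word f T * word f ({..<k} - T)))"
proof -
  have ind: "(\<Sum>j\<in>{l..t}. indicator {a..b} j * X j \<omega>) = (\<Sum>j\<in>{a..b}. X j \<omega>)" if "{a..b} \<subseteq> {l..t}" for a b \<omega>
    using that by (intro sum.mono_neutral_cong_right) (auto simp: indicator_def)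
  have "fact k * (F a b * F a' b') $ k = (\<Sum>i\<le>k. real (k choose i) * expectation (\<lambda>\<omega>. (\<Sum>i\<in>{a..b}. X i \<omega>) ^ i) * expectation (\<lambda>\<omega>. (\<Sum>i\<in>{a'..b'}. X i \<omega>) ^ (k - i)))"
    unfolding fps_mult_nth sum_distrib_left atLeast0AtMost F_def
    by (intro sum.cong refl) (simp add: binomial_fact)
  then show ?thesis using moment_product_words[OF I, of k "indicator {a..b}" "indicator {a'..b'}"]
    unfolding ind[OF sub(1)] ind[OF sub(2)] by simp
qed

lemma F_nth_bound:
  assumes I: "{l..t} \<subseteq> {1..u}" and k: "k \<le> p"
  shows "\<bar>F l t $ k\<bar> \<le> (real (card {l..t}) * H) ^ k"
proof -
  have "expectation (\<lambda>\<omega>. (\<Sum>i\<in>{l..t}. X i \<omega>) ^ k) = (\<Sum>f\<in>{..<k} \<rightarrow>\<^sub>E {l..t}. word f {..<k})"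
  proof -
    have "expectation (\<lambda>\<omega>. (\<Sum>i\<in>{l..t}. X i \<omega>) ^ k) = expectation (\<lambda>\<omega>. \<Sum>f\<in>{..<k} \<rightarrow>\<^sub>E {l..t}. \<Prod>r<k. X (f r) \<omega>)"
    proof (intro Bochner_Integration.integral_cong refl)
      fix \<omega>
      have "(\<Sum>i\<in>{l..t}. X i \<omega>) ^ k = (\<Prod>r\<in>{..<k}. \<Sum>i\<in>{l..t}. X i \<omega>)" by simp
      also have "\<dots> = (\<Sum>f\<in>{..<k} \<rightarrow>\<^sub>E {l..t}. \<Prod>r<k. X (f r) \<omega>)" by (rule prod_sum_PiE) auto
      finally show "(\<Sum>i\<in>{l..t}. X i \<omega>) ^ k = (\<Sum>f\<in>{..<k} \<rightarrow>\<^sub>E {l..t}. \<Prod>r<k. X (f r) \<omega>)" .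
    qed
    also have "\<dots> = (\<Sum>f\<in>{..<k} \<rightarrow>\<^sub>E {l..t}. word f {..<k})"
      unfolding word_def by (intro Bochner_Integration.integral_sum word_integrable letters_subset[OF _ I]) auto
    finally show ?thesis .
  qed
  also have "\<bar>\<dots>\<bar> \<le> (\<Sum>f\<in>{..<k} \<rightarrow>\<^sub>E {l..t}. H ^ k)"
  proof (intro order.trans[OF sum_abs] sum_mono)
    fix f assume f: "f \<in> {..<k} \<rightarrow>\<^sub>E {l..t}"
    show "\<bar>word f {..<k}\<bar> \<le> H ^ k"
      using word_bound[of "{..<k}" f] letters_subset[OF f I, of "{..<k}"] k unfolding word_def by auto
  qed
  also have "\<dots> = (real (card {l..t}) * H) ^ k"
    by (simp add: card_PiE power_mult_distrib)
  finally have "\<bar>expectation (\<lambda>\<omega>. (\<Sum>i\<in>{l..t}. X i \<omega>) ^ k)\<bar> \<le> (real (card {l..t}) * H) ^ k" .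
  moreover have "\<bar>F l t $ k\<bar> \<le> \<bar>expectation (\<lambda>\<omega>. (\<Sum>i\<in>{l..t}. X i \<omega>) ^ k)\<bar> / 1"
    unfolding F_def fps_nth_Abs_fps abs_divide abs_of_pos[OF fact_gt_zero] by (intro divide_left_mono) (auto simp: fact_ge_1)
  ultimately show ?thesis by simp
qed

lemma F_0 [simp]: "F l t $ 0 = 1" by (simp add: F_def prob_space)

lemma F_empty: "t < l \<Longrightarrow> F l t = 1"
  by (rule fps_ext) (simp add: F_def power_0_left prob_space)

lemma F_1: "{l..t} \<subseteq> {1..u} \<Longrightarrow> F l t $ 1 = 0"
proof -
  assume I: "{l..t} \<subseteq> {1..u}"
  have "expectation (\<lambda>\<omega>. \<Sum>i\<in>{l..t}. X i \<omega>) = (\<Sum>i\<in>{l..t}. expectation (X i))"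
    using I X_rv X_bounded by (intro Bochner_Integration.integral_sum integrable_bounded[where c=c]) auto
  also have "\<dots> = 0" using I X_mean by (intro sum.neutral) auto
  finally show ?thesis by (simp add: F_def)
qed

text \<open>The two windows \<open>{l..t}\<close>, \<open>{l+1..t-1}\<close> contain the end points together, the windows
  \<open>{l+1..t}\<close>, \<open>{l..t-1}\<close> separately.  Across a gap of the word the weights factorise, and the
  left factor is odd under exchanging the two copies to the left of the gap.\<close>
lemma word_exchange_bound:
  assumes lt: "1 \<le> l" "l < t" "t \<le> u" and k: "1 \<le> k" "k \<le> p" and f: "f \<in> {..<k} \<rightarrow>\<^sub>E {l..t}"
  defines "wl \<equiv> \<lambda>T. of_bool (\<forall>r\<in>{..<k} - T. f r \<noteq> l) - of_bool (\<forall>r\<in>T. f r \<noteq> l) :: real"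
    and "wt \<equiv> \<lambda>T. of_bool (\<forall>r\<in>{..<k} - T. f r \<noteq> t) :: real"
  shows "\<bar>\<Sum>T\<in>Pow {..<k}. wl T * wt T * (word f T * word f ({..<k} - T))\<bar> \<le> 2 ^ k * (2 * \<epsilon> (Suc ((t - l) div k)) * H ^ k)"
proof (cases "\<exists>r<k. f r = l")
  case False
  then have "wl T = 0" if "T \<in> Pow {..<k}" for T using that unfolding wl_def by auto
  then have "(\<Sum>T\<in>Pow {..<k}. wl T * wt T * (word f T * word f ({..<k} - T))) = 0" by (intro sum.neutral) simp
  then show ?thesis using H0 eps0 by simp
next
  case True
  define h where "h = (t - l) div k"
  obtain r0 where "r0 < k" "f r0 = l" using True by auto
  \<comment> \<open>The letter \<open>l\<close> occupies one position, so among \<open>k\<close>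
    disjoint intervals of length \<open>h\<close> one contains no letter of the word.\<close>
  then obtain i where i: "i < k" "\<And>r. r < k \<Longrightarrow> \<not> (l + i * h < f r \<and> f r \<le> l + (i + 1) * h)"
    by (rule word_gap[where h=h]) blast
  define s where "s = l + i * h"
  have kh: "k * h \<le> t - l" unfolding h_def by simp
  have "(i + 1) * h \<le> k * h" using i by (intro mult_right_mono) auto
  then have sh: "s + h \<le> t" using kh lt unfolding s_def by simp
  have st: "s < t" using sh lt unfolding s_def by (cases "h = 0") auto
  have gap: "f r \<le> s \<or> s + Suc h \<le> f r" if "r < k" for r using i(2)[OF that] unfolding s_def by auto
  have fr: "l \<le> f r" "f r \<le> t" if "r < k" for r using f that by (auto simp: PiE_iff)
  define L where "L = {r\<in>{..<k}. f r \<le> s}"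
  define R where "R = {r\<in>{..<k}. s + Suc h \<le> f r}"
  have LR: "L \<union> R = {..<k}" "L \<inter> R = {}" "finite L" "finite R"
    using gap unfolding L_def R_def by auto
  have card: "card L + card R = k"
    using LR card_Un_disjoint[of L R] by simp
  have Lb: "f ` P \<subseteq> {1..s}" if "P \<subseteq> L" for P using that lt fr unfolding L_def by force
  have Rb: "f ` Q \<subseteq> {s + Suc h..u}" if "Q \<subseteq> R" for Q using that lt fr unfolding R_def by force
  define w1 where "w1 P = (of_bool (\<forall>r\<in>L - P. f r \<noteq> l) - of_bool (\<forall>r\<in>P. f r \<noteq> l) :: real)" for P
  define w2 where "w2 Q = (of_bool (\<forall>r\<in>R - Q. f r \<noteq> t) :: real)" for Q
  \<comment> \<open>The letter \<open>l\<close> can occur only left of the gap and \<open>t\<close>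
    only right of it, which makes the weights factorise.\<close>
  have lL: "f r \<noteq> l" if "r \<in> R" for r using that lt unfolding R_def s_def by auto
  have tR: "f r \<noteq> t" if "r \<in> L" for r using that st unfolding L_def by auto
  have w: "wl (P \<union> Q) = w1 P" "wt (P \<union> Q) = w2 Q" "{..<k} - (P \<union> Q) = (L - P) \<union> (R - Q)" if "P \<subseteq> L" "Q \<subseteq> R" for P Q
  proof -
    show c: "{..<k} - (P \<union> Q) = (L - P) \<union> (R - Q)" using that LR by auto
    show "wl (P \<union> Q) = w1 P" unfolding wl_def w1_def c using that lL by (intro arg_cong2[where f="(-)"] arg_cong[where f=of_bool]) auto
    show "wt (P \<union> Q) = w2 Q" unfolding wt_def w2_def c using that tR by (intro arg_cong[where f=of_bool]) auto
  qed
  have wb: "\<bar>word f P\<bar> \<le> H ^ card P" if "P \<subseteq> {..<k}" for P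
  proof -
    have "f ` P \<subseteq> {1..u}" using letters_subset[OF f _ that] lt by auto
    moreover have "card P \<le> k" using card_mono[OF _ that] by simp
    ultimately show ?thesis
      unfolding word_def using word_bound[of P f] k finite_subset[OF that] by simp
  qed
  \<comment> \<open>The error of replacing both words by the products of their left and right parts;
    each copy is decorrelated once, hence the factor 2 below.\<close>
  define D where "D P Q = word f (P \<union> Q) * word f ((L - P) \<union> (R - Q)) - (word f P * word f Q) * (word f (L - P) * word f (R - Q))" for P Q
  have D: "\<bar>D P Q\<bar> \<le> 2 * \<epsilon> (Suc h) * H ^ k" if PQ: "P \<subseteq> L" "Q \<subseteq> R" for P Q
  proof -
    have dec: "\<bar>word f (P' \<union> Q') - word f P' * word f Q'\<bar> \<le> \<epsilon> (Suc h) * H ^ (card P' + card Q')" if "P' \<subseteq> L" "Q' \<subseteq> R" for P' Q'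
    proof -
      have fin: "finite P'" "finite Q'" "P' \<inter> Q' = {}" using that LR finite_subset by blast+
      have "card P' \<le> card L" "card Q' \<le> card R" using that LR by (auto intro: card_mono)
      then have "card P' + card Q' \<le> p" using card k by linarith
      then show ?thesis
        unfolding word_def using word_dec[OF fin _ _ Lb[OF that(1)] Rb[OF that(2)]] fin sh lt
        by (simp add: prod.union_disjoint)
    qed
    have cP: "card P + card (L - P) = card L" "card Q + card (R - Q) = card R"
      using PQ LR card_mono[of L P] card_mono[of R Q] finite_subset[of P L] finite_subset[of Q R] by (auto simp: card_Diff_subset)
    have sub: "P \<subseteq> {..<k}" "Q \<subseteq> {..<k}" "L - P \<union> (R - Q) \<subseteq> {..<k}" using PQ LR by auto
    have cU: "card (L - P \<union> (R - Q)) = card (L - P) + card (R - Q)" using LR by (intro card_Un_disjoint) auto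
    have "D P Q = (word f (P \<union> Q) - word f P * word f Q) * word f ((L - P) \<union> (R - Q))
      + (word f P * word f Q) * (word f ((L - P) \<union> (R - Q)) - word f (L - P) * word f (R - Q))"
      unfolding D_def by (simp add: algebra_simps)
    also have "\<bar>\<dots>\<bar> \<le> (\<epsilon> (Suc h) * H ^ (card P + card Q)) * H ^ (card (L - P) + card (R - Q))
      + (H ^ card P * H ^ card Q) * (\<epsilon> (Suc h) * H ^ (card (L - P) + card (R - Q)))"
      using dec[OF PQ] dec[of "L - P" "R - Q"] wb[OF sub(1)] wb[OF sub(2)] wb[OF sub(3)] H0 eps0[of "Suc h"] unfolding cU
      by (intro order.trans[OF abs_triangle_ineq] add_mono) (auto simp: abs_mult intro!: mult_mono)
    also have "\<dots> = 2 * \<epsilon> (Suc h) * H ^ ((card P + card (L - P)) + (card Q + card (R - Q)))"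
      by (simp add: power_add)
    finally show ?thesis unfolding cP card .
  qed
  \<comment> \<open>Passing to the complement in \<open>L\<close> swaps the copies on the left: the
    product of words is symmetric, the weight \<open>w1\<close> changes sign.\<close>
  have anti: "(\<Sum>P\<in>Pow L. w1 P * (word f P * word f (L - P))) = 0"
  proof -
    have "(\<Sum>P\<in>Pow L. w1 P * (word f P * word f (L - P))) = (\<Sum>P\<in>Pow L. w1 (L - P) * (word f (L - P) * word f (L - (L - P))))"
      by (rule sum.reindex_bij_witness[of _ "\<lambda>P. L - P" "\<lambda>P. L - P"]) (auto simp: double_diff)
    also have "\<dots> = (\<Sum>P\<in>Pow L. - (w1 P * (word f P * word f (L - P))))"
      by (intro sum.cong refl) (auto simp: w1_def double_diff)
    finally show ?thesis by (simp add: sum_negf)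
  qed
  have "(\<Sum>T\<in>Pow {..<k}. wl T * wt T * (word f T * word f ({..<k} - T))) =
    (\<Sum>P\<in>Pow L. \<Sum>Q\<in>Pow R. w1 P * w2 Q * (word f (P \<union> Q) * word f ((L - P) \<union> (R - Q))))"
    unfolding LR(1)[symmetric] sum_Pow_Un_disjoint[OF LR(3,4,2)]
    by (intro sum.cong refl) (use w LR in auto)
  also have "\<dots> = (\<Sum>P\<in>Pow L. \<Sum>Q\<in>Pow R. w1 P * w2 Q * D P Q)
     + (\<Sum>P\<in>Pow L. \<Sum>Q\<in>Pow R. (w1 P * (word f P * word f (L - P))) * (w2 Q * (word f Q * word f (R - Q))))"
    unfolding sum.distrib[symmetric] D_def by (intro sum.cong refl) (simp add: algebra_simps)
  also have "(\<Sum>P\<in>Pow L. \<Sum>Q\<in>Pow R. (w1 P * (word f P * word f (L - P))) * (w2 Q * (word f Q * word f (R - Q)))) = 0"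
    unfolding sum_product[symmetric] anti by simp
  finally have "\<bar>\<Sum>T\<in>Pow {..<k}. wl T * wt T * (word f T * word f ({..<k} - T))\<bar> = \<bar>\<Sum>P\<in>Pow L. \<Sum>Q\<in>Pow R. w1 P * w2 Q * D P Q\<bar>"
    by simp
  also have "\<dots> \<le> (\<Sum>P\<in>Pow L. \<Sum>Q\<in>Pow R. 2 * \<epsilon> (Suc h) * H ^ k)"
  proof (intro order.trans[OF sum_abs] sum_mono)
    fix P Q assume "P \<in> Pow L" "Q \<in> Pow R"
    then have D': "\<bar>D P Q\<bar> \<le> 2 * \<epsilon> (Suc h) * H ^ k" by (intro D) auto
    have "\<bar>w1 P * w2 Q * D P Q\<bar> = \<bar>w1 P\<bar> * \<bar>w2 Q\<bar> * \<bar>D P Q\<bar>" by (simp add: abs_mult)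
    also have "\<dots> \<le> 1 * 1 * \<bar>D P Q\<bar>" by (intro mult_mono) (auto simp: w1_def w2_def)
    finally show "\<bar>w1 P * w2 Q * D P Q\<bar> \<le> 2 * \<epsilon> (Suc h) * H ^ k" using D' by simp
  qed
  also have "\<dots> = 2 ^ (card L + card R) * (2 * \<epsilon> (Suc h) * H ^ k)"
    using LR by (simp add: card_Pow power_add)
  finally show ?thesis unfolding card h_def .
qed

end

lemma prod_indicator_of_bool:
  "finite T \<Longrightarrow> (\<Prod>r\<in>T. indicator A (f r) :: real) = of_bool (\<forall>r\<in>T. f r \<in> A)"
  by (induction T rule: finite_induct) (auto simp: indicator_def)

lemma fps_mult_nth_bound:
  fixes f g :: "real fps"
  assumes "\<And>i. i \<le> k \<Longrightarrow> \<bar>f $ i\<bar> \<le> a * y ^ i" "\<And>i. i \<le> k \<Longrightarrow> \<bar>g $ i\<bar> \<le> b * y ^ i"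
    and "0 \<le> a" "0 \<le> b" "0 \<le> y"
  shows "\<bar>(f * g) $ k\<bar> \<le> real (k + 1) * (a * b * y ^ k)"
proof -
  have "\<bar>(f * g) $ k\<bar> \<le> (\<Sum>i=0..k. \<bar>f $ i * g $ (k - i)\<bar>)" unfolding fps_mult_nth by (rule sum_abs)
  also have "\<dots> \<le> (\<Sum>i=0..k. a * b * y ^ k)"
  proof (rule sum_mono)
    fix i assume i: "i \<in> {0..k}"
    have "\<bar>f $ i * g $ (k - i)\<bar> \<le> (a * y ^ i) * (b * y ^ (k - i))"
      unfolding abs_mult using assms i by (intro mult_mono) auto
    also have "\<dots> = a * b * y ^ (i + (k - i))" by (simp add: power_add)
    finally show "\<bar>f $ i * g $ (k - i)\<bar> \<le> a * b * y ^ k" using i by simp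
  qed
  finally show ?thesis by simp
qed

lemma Suc_le_two_power: "real (k + 1) \<le> 2 ^ k"
  by (induction k) auto

section \<open>Ratios of generating functions\<close>

locale weak_dependence_decay = weak_dependence +
  fixes G :: real
  assumes G1: "1 \<le> G" and eps_le: "1 \<le> h \<Longrightarrow> j \<le> p + 2 \<Longrightarrow> \<epsilon> h \<le> 4 * (G / real h) ^ j"
begin

definition exchange :: "nat \<Rightarrow> nat \<Rightarrow> real fps" where
  "exchange l t = F l t * F (Suc l) (t - 1) - F (Suc l) t * F l (t - 1)"

text \<open>In both products the second copy must avoid \<open>t\<close>. They differ only in which
  copy must avoid \<open>l\<close>, and the difference of these two conditions is the sign-changing
  weight.\<close>

lemma exchange_words:
  assumes lt: "1 \<le> l" "l < t" "t \<le> u"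
  shows "fact k * exchange l t $ k = (\<Sum>f\<in>{..<k} \<rightarrow>\<^sub>E {l..t}. \<Sum>T\<in>Pow {..<k}.
    (of_bool (\<forall>r\<in>{..<k} - T. f r \<noteq> l) - of_bool (\<forall>r\<in>T. f r \<noteq> l)) * of_bool (\<forall>r\<in>{..<k} - T. f r \<noteq> t)
      * (word f T * word f ({..<k} - T)))"
proof -
  have I: "{l..t} \<subseteq> {1..u}" using lt by auto
  have "fact k * exchange l t $ k = fact k * (F l t * F (Suc l) (t - 1)) $ k - fact k * (F (Suc l) t * F l (t - 1)) $ k"
    by (simp add: exchange_def right_diff_distrib)
  also have "\<dots> = (\<Sum>f\<in>{..<k} \<rightarrow>\<^sub>E {l..t}. \<Sum>T\<in>Pow {..<k}.
     ((\<Prod>r\<in>T. indicator {l..t} (f r)) * (\<Prod>r\<in>{..<k} - T. indicator {Suc l..t - 1} (f r))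
      - (\<Prod>r\<in>T. indicator {Suc l..t} (f r)) * (\<Prod>r\<in>{..<k} - T. indicator {l..t - 1} (f r)))
      * (word f T * word f ({..<k} - T)))"
    using lt by (simp add: F_mult_words[OF I] sum_subtractf left_diff_distrib)
  also have "\<dots> = (\<Sum>f\<in>{..<k} \<rightarrow>\<^sub>E {l..t}. \<Sum>T\<in>Pow {..<k}.
    (of_bool (\<forall>r\<in>{..<k} - T. f r \<noteq> l) - of_bool (\<forall>r\<in>T. f r \<noteq> l)) * of_bool (\<forall>r\<in>{..<k} - T. f r \<noteq> t)
      * (word f T * word f ({..<k} - T)))"
  proof (intro sum.cong refl arg_cong2[where f="(*)"])
    fix f T assume f: "f \<in> {..<k} \<rightarrow>\<^sub>E {l..t}" and T: "T \<in> Pow {..<k}"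
    have fr: "l \<le> f r \<and> f r \<le> t" if "r < k" for r using PiE_mem[OF f, of r] that by auto
    have m: "f r \<in> {l..t}" "f r \<in> {Suc l..t - 1} \<longleftrightarrow> f r \<noteq> l \<and> f r \<noteq> t"
      "f r \<in> {Suc l..t} \<longleftrightarrow> f r \<noteq> l" "f r \<in> {l..t - 1} \<longleftrightarrow> f r \<noteq> t" if "r < k" for r
      using fr[OF that] lt by auto
    have fin: "finite T" "finite ({..<k} - T)" using T finite_subset[of T "{..<k}"] by auto
    have "(\<forall>r\<in>T. f r \<in> {l..t}) \<longleftrightarrow> True"
         "(\<forall>r\<in>{..<k} - T. f r \<in> {Suc l..t - 1}) \<longleftrightarrow> (\<forall>r\<in>{..<k} - T. f r \<noteq> l) \<and> (\<forall>r\<in>{..<k} - T. f r \<noteq> t)"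
         "(\<forall>r\<in>T. f r \<in> {Suc l..t}) \<longleftrightarrow> (\<forall>r\<in>T. f r \<noteq> l)"
         "(\<forall>r\<in>{..<k} - T. f r \<in> {l..t - 1}) \<longleftrightarrow> (\<forall>r\<in>{..<k} - T. f r \<noteq> t)"
      using T m by (auto simp: subset_iff)
    then show "(\<Prod>r\<in>T. indicator {l..t} (f r)) * (\<Prod>r\<in>{..<k} - T. indicator {Suc l..t - 1} (f r))
      - (\<Prod>r\<in>T. indicator {Suc l..t} (f r)) * (\<Prod>r\<in>{..<k} - T. indicator {l..t - 1} (f r))
      = (of_bool (\<forall>r\<in>{..<k} - T. f r \<noteq> l) - of_bool (\<forall>r\<in>T. f r \<noteq> l)) * (of_bool (\<forall>r\<in>{..<k} - T. f r \<noteq> t) :: real)"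
      unfolding prod_indicator_of_bool[OF fin(1)] prod_indicator_of_bool[OF fin(2)]
      by (simp only: of_bool_conj) (simp add: algebra_simps)
  qed
  finally show ?thesis .
qed

text \<open>At most \<open>(2 * g) ^ i\<close> words with \<open>2 ^ i\<close> splittings each, and
  a gap of at least \<open>g / i\<close> between the parts. The separate index \<open>k\<close>
  keeps the decay factor the same for all coefficients \<open>i \<le> k\<close>, as needed for the
  convolution with the inverses.\<close>

lemma exchange_bound:
  assumes lt: "1 \<le> l" "l < t" "t \<le> u" and ik: "i \<le> k" "1 \<le> k" "k \<le> p"
  defines "g \<equiv> real (t - l)"
  shows "\<bar>exchange l t $ i\<bar> \<le> 8 * (G * real k / g) ^ (k + 2) * (4 * g * H) ^ i"
proof (cases "i = 0")
  case True
  have "exchange l t $ 0 = 0" by (simp add: exchange_def)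
  then show ?thesis using True G1 by (simp add: g_def)
next
  case False
  have g1: "1 \<le> g" using lt by (simp add: g_def)
  define B where "B = 2 ^ i * (2 * \<epsilon> (Suc ((t - l) div i)) * H ^ i)"
  have "fact i * \<bar>exchange l t $ i\<bar> = \<bar>fact i * exchange l t $ i\<bar>" by (simp add: abs_mult)
  also have "\<dots> \<le> (\<Sum>f\<in>{..<i} \<rightarrow>\<^sub>E {l..t}. B)"
  proof -
    have ip: "1 \<le> i" "i \<le> p" using False ik by auto
    show ?thesis unfolding exchange_words[OF lt] B_def
      by (intro order.trans[OF sum_abs] sum_mono word_exchange_bound[OF lt ip])
  qed
  also have "\<dots> = real (t - l + 1) ^ i * B" using lt by (simp add: card_PiE Suc_diff_le)
  also have "\<dots> \<le> (2 * g) ^ i * B"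
  proof -
    have "B \<ge> 0" unfolding B_def using H0 eps0 by simp
    then show ?thesis using g1 by (intro mult_right_mono power_mono) (auto simp: g_def)
  qed
  also have "\<dots> \<le> (2 * g) ^ i * (2 ^ i * (2 * (4 * (G * real k / g) ^ (k + 2)) * H ^ i))"
  proof -
    have hi: "g / real i \<le> real (Suc ((t - l) div i))"
    proof -
      have "t - l < i * Suc ((t - l) div i)" using False dividend_less_times_div[of i "t - l"] by simp
      then have "t - l \<le> i * Suc ((t - l) div i)" by simp
      then have "g \<le> real i * real (Suc ((t - l) div i))" unfolding g_def of_nat_mult[symmetric] of_nat_le_iff .
      then show ?thesis using False by (simp add: divide_le_eq mult.commute)
    qed
    have "\<epsilon> (Suc ((t - l) div i)) \<le> 4 * (G / real (Suc ((t - l) div i))) ^ (k + 2)"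
      using ik by (intro eps_le) auto
    also have "\<dots> \<le> 4 * (G * real k / g) ^ (k + 2)"
    proof (intro mult_left_mono power_mono)
      have "G / real (Suc ((t - l) div i)) \<le> G / (g / real i)"
        using hi G1 g1 False by (intro divide_left_mono) auto
      also have "\<dots> = G * real i / g" by simp
      also have "\<dots> \<le> G * real k / g" using ik G1 g1 by (intro divide_right_mono mult_left_mono) auto
      finally show "G / real (Suc ((t - l) div i)) \<le> G * real k / g" .
    qed (use G1 in auto)
    finally have "\<epsilon> (Suc ((t - l) div i)) \<le> 4 * (G * real k / g) ^ (k + 2)" .
    then show ?thesis unfolding B_def using H0 g1 by (intro mult_left_mono mult_right_mono) auto
  qed
  also have "\<dots> = 8 * (G * real k / g) ^ (k + 2) * ((2 * g) ^ i * 2 ^ i * H ^ i)" by simp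
  also have "(2 * g) ^ i * 2 ^ i * H ^ i = (4 * g * H) ^ i"
    unfolding power_mult_distrib[symmetric] by (simp add: mult_ac)
  finally have 1: "fact i * \<bar>exchange l t $ i\<bar> \<le> 8 * (G * real k / g) ^ (k + 2) * (4 * g * H) ^ i" .
  have "1 * \<bar>exchange l t $ i\<bar> \<le> fact i * \<bar>exchange l t $ i\<bar>" by (intro mult_right_mono) (auto simp: fact_ge_1)
  then show ?thesis using 1 by simp
qed

definition ratio :: "nat \<Rightarrow> nat \<Rightarrow> real fps" where
  "ratio l t = F l t * inverse (F l (t - 1))"

lemma inverse_F: "inverse (F l t) * F l t = 1"
  by (rule inverse_mult_eq_1) simp

lemma ratio_diff: "ratio l t - ratio (Suc l) t = exchange l t * (inverse (F l (t - 1)) * inverse (F (Suc l) (t - 1)))"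
proof -
  define a b c' d ib id' where "a = F l t" "b = F l (t - 1)" "c' = F (Suc l) t" "d = F (Suc l) (t - 1)"
    "ib = inverse (F l (t - 1))" "id' = inverse (F (Suc l) (t - 1))"
  note defs = this
  have 1: "b * ib = 1" "d * id' = 1" using inverse_F by (auto simp: defs mult.commute)
  have "(a * d - c' * b) * (ib * id') = a * ib * (d * id') - c' * id' * (b * ib)" by (simp add: algebra_simps)
  also have "\<dots> = a * ib - c' * id'" by (simp add: 1)
  finally show ?thesis by (simp add: ratio_def exchange_def defs)
qed

text \<open>Crude bounds suffice for the inverse series: the coefficients of the three factors grow
  at most like powers of \<open>4 * g * H\<close>, and order \<open>k + 2\<close> of decay cancels
  \<open>g ^ k\<close>, leaving the summable factor \<open>1 / g\<^sup>2\<close>.\<close>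

lemma ratio_diff_bound:
  assumes lt: "1 \<le> l" "l < t" "t \<le> u" and k: "1 \<le> k" "k \<le> p"
  shows "\<bar>(ratio l t - ratio (Suc l) t) $ k\<bar> \<le> 8 * real (k + 1) * (4 * H) ^ k * (G * real k) ^ (k + 2) * (1 / (real (t - l))\<^sup>2)"
proof -
  define g where "g = real (t - l)"
  have g1: "1 \<le> g" using lt by (simp add: g_def)
  have gH: "0 \<le> g * H" using g1 H0 by simp
  have aux: "r * (8 * (P / (Z * W)) * 1 * (Z * Q)) = 8 * r * Q * P * (1 / W)" if "Z \<noteq> 0" for r P Z W Q :: real
    using that by (simp add: field_simps)
  have inv: "\<bar>inverse (F l' (t - 1)) $ i\<bar> \<le> 1 * (2 * (g * H)) ^ i" if "i \<le> k" "l' = l \<or> l' = Suc l" for i l'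
  proof -
    have I: "{l'..t - 1} \<subseteq> {1..u}" using that lt by auto
    have "\<bar>F l' (t - 1) $ j\<bar> \<le> (g * H) ^ j" if "j \<le> k" for j
    proof -
      have "\<bar>F l' (t - 1) $ j\<bar> \<le> (real (card {l'..t - 1}) * H) ^ j"
        using that k by (intro F_nth_bound I) auto
      also have "\<dots> \<le> (g * H) ^ j"
        using \<open>l' = l \<or> l' = Suc l\<close> lt H0 by (intro power_mono mult_right_mono) (auto simp: g_def)
      finally show ?thesis .
    qed
    then show ?thesis using inverse_fps_nth_bound[OF F_0 gH, of k l' "t - 1" i] that by auto
  qed
  have inv2: "\<bar>(inverse (F l (t - 1)) * inverse (F (Suc l) (t - 1))) $ i\<bar> \<le> 1 * (4 * g * H) ^ i" if "i \<le> k" for i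
  proof -
    have "\<bar>(inverse (F l (t - 1)) * inverse (F (Suc l) (t - 1))) $ i\<bar> \<le> real (i + 1) * (1 * 1 * (2 * (g * H)) ^ i)"
      using inv gH that by (intro fps_mult_nth_bound) auto
    also have "\<dots> \<le> 2 ^ i * (1 * 1 * (2 * (g * H)) ^ i)"
      using gH by (intro mult_right_mono Suc_le_two_power) auto
    also have "\<dots> = 1 * (4 * g * H) ^ i" by (simp add: power_mult_distrib[symmetric] mult_ac)
    finally show ?thesis .
  qed
  have "\<bar>(ratio l t - ratio (Suc l) t) $ k\<bar> \<le> real (k + 1) * (8 * (G * real k / g) ^ (k + 2) * 1 * (4 * g * H) ^ k)"
    unfolding ratio_diff using exchange_bound[OF lt _ k] inv2 G1 g1 H0
    by (intro fps_mult_nth_bound) (auto simp: g_def)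
  also have "(G * real k / g) ^ (k + 2) = (G * real k) ^ (k + 2) / (g ^ k * g\<^sup>2)"
    by (simp only: power_divide power_add times_divide_times_eq)
  also have "(4 * g * H) ^ k = g ^ k * (4 * H) ^ k" by (simp add: power_mult_distrib)
  also have "real (k + 1) * (8 * ((G * real k) ^ (k + 2) / (g ^ k * g\<^sup>2)) * 1 * (g ^ k * (4 * H) ^ k)) =
     8 * real (k + 1) * (4 * H) ^ k * (G * real k) ^ (k + 2) * (1 / g\<^sup>2)"
    by (rule aux) (use g1 in simp)
  finally show ?thesis by (simp add: g_def)
qed

text \<open>Moving the left end of the window from 1 to \<open>t\<close> telescopes. The last ratio
  is the single block \<open>F t t\<close>, and the differences sum to a bound independent of
  \<open>t\<close>.\<close>

lemma ratio_bound:
  assumes t: "1 \<le> t" "t \<le> u" and k: "2 \<le> k" "k \<le> p"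
  shows "\<bar>ratio 1 t $ k\<bar> \<le> (136 * H * (G * real p)\<^sup>2) ^ k"
proof -
  define C where "C = 8 * real (k + 1) * (4 * H) ^ k * (G * real k) ^ (k + 2)"
  have C0: "0 \<le> C" unfolding C_def using H0 G1 by simp
  have tel: "ratio l t = ratio t t + (\<Sum>j\<in>{l..<t}. ratio j t - ratio (Suc j) t)" if "l \<le> t" for l
    using that
  proof (induction rule: inc_induct)
    case (step n)
    then show ?case by (simp add: sum.atLeast_Suc_lessThan)
  qed simp
  have rt: "ratio t t = F t t" using t by (simp add: ratio_def F_empty)
  have "\<bar>ratio 1 t $ k\<bar> = \<bar>F t t $ k + (\<Sum>j\<in>{1..<t}. (ratio j t - ratio (Suc j) t) $ k)\<bar>"
    using t by (subst tel) (auto simp: rt fps_sum_nth)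
  also have "\<dots> \<le> H ^ k + (\<Sum>j\<in>{1..<t}. C * (1 / (real (t - j))\<^sup>2))"
  proof (intro order.trans[OF abs_triangle_ineq] add_mono order.trans[OF sum_abs] sum_mono)
    show "\<bar>F t t $ k\<bar> \<le> H ^ k" using F_nth_bound[of t t k] t k by auto
    show "\<bar>(ratio j t - ratio (Suc j) t) $ k\<bar> \<le> C * (1 / (real (t - j))\<^sup>2)" if "j \<in> {1..<t}" for j
      unfolding C_def using that t k by (intro ratio_diff_bound) auto
  qed
  also have "(\<Sum>j\<in>{1..<t}. C * (1 / (real (t - j))\<^sup>2)) = C * (\<Sum>k=1..t-1. 1 / (real k)\<^sup>2)"
    unfolding sum_distrib_left by (rule sum.reindex_bij_witness[of _ "\<lambda>k. t - k" "\<lambda>j. t - j"]) auto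
  also have "C * (\<Sum>k=1..t-1. 1 / (real k)\<^sup>2) \<le> C * 2"
    using C0 by (intro mult_left_mono sum_inverse_squares_le)
  also have "H ^ k + C * 2 \<le> (136 * H * (G * real p)\<^sup>2) ^ k"
  proof -
    define y where "y = (G * real p)\<^sup>2"
    have Gp: "1 \<le> G * real p" using G1 k mult_mono[of 1 G 1 "real p"] by auto
    then have y1: "1 \<le> y" unfolding y_def by simp
    have "(G * real k) ^ (k + 2) \<le> (G * real p) ^ (k + 2)"
      using k G1 by (intro power_mono mult_left_mono) auto
    \<comment> \<open>Here \<open>k + 2 \<le> 2 * k\<close>, because \<open>k\<close> is at least
      2.\<close>
    also have "\<dots> \<le> (G * real p) ^ (2 * k)" using k Gp by (intro power_increasing) auto
    also have "\<dots> = y ^ k" by (simp add: y_def power_mult)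
    finally have 1: "(G * real k) ^ (k + 2) \<le> y ^ k" .
    have "C * 2 = 16 * (real (k + 1) * ((4 * H) ^ k * (G * real k) ^ (k + 2)))" by (simp add: C_def)
    also have "\<dots> \<le> 16 * (2 ^ k * ((4 * H) ^ k * y ^ k))"
      using 1 Suc_le_two_power[of k] H0 G1 by (intro mult_left_mono mult_mono) auto
    finally have "C * 2 \<le> 16 * 2 ^ k * (4 * H) ^ k * y ^ k" by simp
    moreover have "H ^ k \<le> 1 * 2 ^ k * (4 * H) ^ k * y ^ k"
    proof -
      have "H ^ k \<le> (2 * (4 * H) * y) ^ k" 
        using H0 y1 mult_mono[of H "2 * (4 * H)" 1 y] by (intro power_mono) auto
      also have "\<dots> = 1 * 2 ^ k * (4 * H) ^ k * y ^ k" by (simp only: power_mult_distrib mult_1_left)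
      finally show ?thesis .
    qed
    ultimately have "H ^ k + C * 2 \<le> 17 * (2 ^ k * (4 * H) ^ k * y ^ k)"
      by (simp only: mult.assoc mult_1_left)
    \<comment> \<open>Of the 17, one comes from \<open>F t t\<close> and 16 from
      \<open>C * 2\<close>; together with 2 * 4 this makes 136.\<close>
    also have "\<dots> \<le> 17 ^ k * (2 ^ k * (4 * H) ^ k * y ^ k)"
      using H0 y1 k by (intro mult_right_mono self_le_power) auto
    also have "\<dots> = (136 * H * y) ^ k" unfolding power_mult_distrib[symmetric] by (simp add: mult_ac)
    finally show ?thesis by (simp add: y_def)
  qed
  finally show ?thesis by simp
qed

lemma ratio_0: "ratio l t $ 0 = 1" by (simp add: ratio_def)

lemma ratio_1: "{l..t} \<subseteq> {1..u} \<Longrightarrow> ratio l t $ 1 = 0"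
proof -
  assume I: "{l..t} \<subseteq> {1..u}"
  have I': "{l..t - 1} \<subseteq> {1..u}" using I by auto
  have "F l t = ratio l t * F l (t - 1)" using inverse_F[of l "t - 1"] by (simp add: ratio_def mult.assoc)
  then have "F l t $ 1 = (ratio l t * F l (t - 1)) $ 1" by simp
  then show ?thesis using F_1[OF I] F_1[OF I'] by (simp add: fps_mult_nth ratio_0)
qed

lemma prod_ratio: "t \<le> u \<Longrightarrow> (\<Prod>s<t. ratio 1 (Suc s)) = F 1 t"
proof (induction t)
  case (Suc t)
  have "F 1 t * ratio 1 (Suc t) = F 1 (Suc t) * (inverse (F 1 t) * F 1 t)"
    by (simp add: ratio_def mult_ac)
  then show ?case using Suc by (simp add: inverse_F)
qed (simp add: F_empty)

text \<open>Linear coefficients vanish, so second coefficients add. The Gaussian parameter of the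
  product is therefore exactly half the variance of the full sum.\<close>

lemma prod_ratio_2: "t \<le> u \<Longrightarrow> F 1 t $ 2 = (\<Sum>s<t. ratio 1 (Suc s) $ 2)"
proof (induction t)
  case (Suc t)
  have "F 1 (Suc t) = F 1 t * ratio 1 (Suc t)" using prod_ratio[of "Suc t"] prod_ratio[of t] Suc by simp
  then have "F 1 (Suc t) $ 2 = F 1 t $ 2 + ratio 1 (Suc t) $ 2"
    using F_1[of 1 t] ratio_1[of 1 "Suc t"] Suc.prems by (simp add: fps_mult_nth numeral_2_eq_2 ratio_0)
  then show ?case using Suc by simp
qed (simp add: F_empty)

lemma moment_near_gauss:
  assumes p: "3 \<le> p"
  defines "q \<equiv> 136 * H * (G * real p)\<^sup>2" and "v \<equiv> expectation (\<lambda>\<omega>. (\<Sum>i=1..u. X i \<omega>)\<^sup>2) / 2"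
  shows "\<bar>expectation (\<lambda>\<omega>. (\<Sum>i=1..u. X i \<omega>) ^ p) / fact p - gauss_fps v $ p\<bar>
    \<le> (\<Sum>j | j \<in> {3..p} \<and> even (p - j). (4 * q) ^ j * real u ^ (j div 3) * v ^ ((p - j) div 2))"
proof -
  have q0: "0 \<le> q" using H0 by (simp add: q_def)
  have v: "(\<Sum>t<u. ratio 1 (Suc t) $ 2) = v"
    using prod_ratio_2[of u] by (simp add: v_def F_def)
  have "\<bar>(\<Prod>t<u. ratio 1 (Suc t)) $ p - gauss_fps (\<Sum>t<u. ratio 1 (Suc t) $ 2) $ p\<bar> \<le>
    (\<Sum>j | j \<in> {3..p} \<and> even (p - j). (4 * q) ^ j * real u ^ (j div 3) * \<bar>\<Sum>t<u. ratio 1 (Suc t) $ 2\<bar> ^ ((p - j) div 2))"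
  proof (rule prod_near_gauss_fps)
    show r1: "ratio 1 (Suc t) $ 1 = 0" if "t < u" for t using that by (intro ratio_1) auto
    show "\<bar>ratio 1 (Suc t) $ k\<bar> \<le> q ^ k" if "t < u" "k \<le> p" for t k
    proof (cases "k < 2")
      case True
      then have "k = 0 \<or> k = 1" by auto
      then show ?thesis using r1[OF that(1)] q0 by (auto simp: ratio_0)
    next
      case False
      then show ?thesis unfolding q_def using that by (intro ratio_bound) auto
    qed
  qed (use p q0 in \<open>auto simp: ratio_0\<close>)
  moreover have "\<bar>v\<bar> = v" by (simp add: v_def)
  ultimately show ?thesis unfolding prod_ratio[OF order_refl] v by (simp add: F_def)
qed

end

section \<open>Moments of a mixing row\<close>

text \<open>Bounding all factors by the largest replaces Hoelder's inequality, at the cost of a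
  factor \<open>card T\<close>.\<close>

lemma prod_power_le_sum_power:
  fixes y :: "'b \<Rightarrow> real"
  assumes "finite T" "T \<noteq> {}" "\<And>r. r \<in> T \<Longrightarrow> 0 \<le> y r"
  shows "(\<Prod>r\<in>T. y r ^ e r) \<le> (\<Sum>r\<in>T. y r ^ (\<Sum>r\<in>T. e r))"
proof -
  define m where "m = Max (y ` T)"
  have "m \<in> y ` T" unfolding m_def using assms by (intro Max_in) auto
  then obtain r0 where r0: "r0 \<in> T" "m = y r0" by auto
  have "y r \<le> m" if "r \<in> T" for r unfolding m_def using assms that by (intro Max_ge) auto
  then have "(\<Prod>r\<in>T. y r ^ e r) \<le> (\<Prod>r\<in>T. m ^ e r)" using assms by (intro prod_mono) (auto intro: power_mono)
  also have "\<dots> = y r0 ^ (\<Sum>r\<in>T. e r)" by (simp add: power_sum r0)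
  also have "\<dots> \<le> (\<Sum>r\<in>T. y r ^ (\<Sum>r\<in>T. e r))" using assms r0 by (intro member_le_sum) auto
  finally show ?thesis .
qed

text \<open>Stretched exponential decay restated as polynomial decay of every order
  \<open>k\<close>, with a constant that grows only polynomially in \<open>k\<close>. For the array,
  \<open>\<gamma>\<close> is the ceiling of 1/\<eta>.\<close>

locale decay_mixing_row = mixing_row +
  fixes \<Lambda> :: real and \<gamma> :: nat
  assumes Lam: "1 \<le> \<Lambda>" and n1: "1 \<le> n"
    and decay: "1 \<le> h \<Longrightarrow> sqrt (\<phi> h) \<le> (\<Lambda> * (real k + 1) ^ \<gamma> / real h) ^ k"
begin

text \<open>The decay constant of order \<open>k = 1\<close>, which after squaring gives the
  summable bound on \<open>\<phi>\<close>.\<close>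

definition \<Lambda>1 :: real where "\<Lambda>1 = \<Lambda> * 2 ^ \<gamma>"

lemma Lam1_ge: "1 \<le> \<Lambda>1"
  unfolding \<Lambda>1_def using Lam mult_mono[of 1 \<Lambda> 1 "2 ^ \<gamma> :: real"] by simp

sublocale sq_mixing_row M Fs x n K \<phi> \<Lambda>1
proof
  show "1 \<le> \<Lambda>1" by (rule Lam1_ge)
  show "\<phi> k \<le> (\<Lambda>1 / real k)\<^sup>2" if "1 \<le> k" for k
  proof -
    have "sqrt (\<phi> k) \<le> \<Lambda>1 / real k" using decay[OF that, of 1] by (simp add: \<Lambda>1_def)
    then have "sqrt (\<phi> k) ^ 2 \<le> (\<Lambda>1 / real k)\<^sup>2" using phi0 by (intro power_mono) auto
    then show ?thesis using phi0 by simp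
  qed
qed

text \<open>Chosen so that \<open>\<Lambda>1 / l\<close> is at most 1/4, that is,
  \<open>\<phi> l\<close> at most 1/16.\<close>

definition l :: nat where "l = nat \<lceil>4 * \<Lambda>1\<rceil>"

lemma l_props: "1 \<le> l" "\<phi> l \<le> 1 / 16" "K * (2 * l + 1) \<le> A"
proof -
  have l4: "4 * \<Lambda>1 \<le> real l" "real l \<le> 4 * \<Lambda>1 + 1" unfolding l_def using Lam1_ge by linarith+
  show l1: "1 \<le> l" using l4 Lam1_ge by linarith
  have "\<Lambda>1 / real l \<le> 1 / 4" using l4 Lam1_ge by (simp add: divide_le_eq)
  then have "(\<Lambda>1 / real l)\<^sup>2 \<le> (1 / 4)\<^sup>2" using Lam1_ge by (intro power_mono) auto
  then have "(\<Lambda>1 / real l)\<^sup>2 \<le> 1 / 16" by (simp add: power2_eq_square)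
  then show "\<phi> l \<le> 1 / 16" using phi_sq[OF l1] by linarith
  have "\<Lambda>1 \<le> \<Lambda>1 * \<Lambda>1" using mult_left_mono[of 1 \<Lambda>1 \<Lambda>1] Lam1_ge by simp
  then have "real (2 * l + 1) \<le> 72 * (\<Lambda>1 * \<Lambda>1)" using l4 Lam1_ge by linarith
  then have "real (2 * l + 1) \<le> 72 * \<Lambda>1\<^sup>2" by (simp add: power2_eq_square)
  then have "real (2 * l + 1) * K \<le> 72 * \<Lambda>1\<^sup>2 * K" using K1 by (intro mult_right_mono) auto
  then show "K * (2 * l + 1) \<le> A" by (simp add: A_def mult.commute)
qed

text \<open>With \<open>A \<le> z\<close> the step \<open>K * (2 * l + 1) + 8 * z\<close> of the
  tail estimate is at most \<open>9 * z\<close>, and 4 * 9 = 36.\<close>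

lemma suffix_moment:
  assumes "e \<le> n" "s0 \<le> e" "A \<le> z" "\<And>i. s0 \<le> i \<Longrightarrow> i \<le> e \<Longrightarrow> V i e \<le> z\<^sup>2"
  shows "expectation (\<lambda>\<omega>. \<bar>S s0 e \<omega>\<bar> ^ d) \<le> 6 * fact d * (36 * z) ^ d"
proof -
  interpret controlled_row M Fs x n K \<phi> s0 e l z
    by unfold_locales (use assms l_props A_ge in \<open>auto simp: V_def\<close>)
  have "expectation (\<lambda>\<omega>. \<bar>S s0 e \<omega>\<bar> ^ d) \<le> 6 * fact d * (4 * (9 * z)) ^ d"
    using l_props(3) assms(3) by (intro passage_moment_bound assms) linarith
  then show ?thesis by simp
qed

definition \<sigma> :: real where "\<sigma> = sqrt (V 0 n)"

lemma sigma_sq: "\<sigma>\<^sup>2 = V 0 n" "0 \<le> \<sigma>" unfolding \<sigma>_def using V_nonneg by auto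

lemma blocks:
  obtains u b where "1 \<le> u" "b 0 = 0" "b u = n" "\<And>i. i < u \<Longrightarrow> b i < b (Suc i)"
    "\<And>i t. i < u \<Longrightarrow> b i \<le> t \<Longrightarrow> t \<le> b (Suc i) \<Longrightarrow> V t (b (Suc i)) \<le> (3 * A)\<^sup>2"
    "real (u - 1) * (8 / 9 * A\<^sup>2) \<le> \<sigma>\<^sup>2" "\<And>i. i \<le> u \<Longrightarrow> V (b i) n \<le> \<sigma>\<^sup>2"
  using block_partition[of 0] n1 unfolding sigma_sq by auto

text \<open>The whole row is treated as a single block, at the level \<open>5 * \<sigma>\<close>
  that bounds all its tails; 36 * 5 = 180.\<close>

lemma crude_moment:
  assumes "A \<le> \<sigma>"
  shows "expectation (\<lambda>\<omega>. \<bar>S 0 n \<omega>\<bar> ^ d) \<le> 6 * fact d * (180 * \<sigma>) ^ d"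
proof -
  obtain u b where b: "1 \<le> u" "b 0 = 0" "b u = n" "\<And>i. i < u \<Longrightarrow> b i < b (Suc i)"
    "\<And>i t. i < u \<Longrightarrow> b i \<le> t \<Longrightarrow> t \<le> b (Suc i) \<Longrightarrow> V t (b (Suc i)) \<le> (3 * A)\<^sup>2"
    "real (u - 1) * (8 / 9 * A\<^sup>2) \<le> \<sigma>\<^sup>2" "\<And>i. i \<le> u \<Longrightarrow> V (b i) n \<le> \<sigma>\<^sup>2"
    by (rule blocks) blast
  have "V i n \<le> (5 * \<sigma>)\<^sup>2" if "i \<le> n" for i
    by (rule V_suffix_le[OF b(2,3,4,5,7) assms that])
  then have "expectation (\<lambda>\<omega>. \<bar>S 0 n \<omega>\<bar> ^ d) \<le> 6 * fact d * (36 * (5 * \<sigma>)) ^ d"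
    using assms sigma_sq by (intro suffix_moment) auto
  then show ?thesis by simp
qed

text \<open>\<open>h\<close> is \<open>4 * q / A\<close>, with 1410048 = 4 * 136 * 2 * 1296. One
  factor \<open>p\<close> comes from the block moments and two from
  \<open>(G * p)\<^sup>2\<close>.\<close>

lemma fine_moment:
  fixes p :: nat
  defines "h \<equiv> 1410048 * real p ^ 3 * (\<Lambda> * (real p + 3) ^ \<gamma>)\<^sup>2"
  assumes p: "3 \<le> p" and sig: "A * h ^ 3 \<le> \<sigma>"
  shows "\<bar>expectation (\<lambda>\<omega>. S 0 n \<omega> ^ p) / fact p - gauss_fps (\<sigma>\<^sup>2 / 2) $ p\<bar>
    \<le> real p * 3 ^ p * A\<^sup>2 * h ^ 6 * \<sigma> ^ (2 * ((p - 1) div 2))"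
proof -
  obtain u b where b: "1 \<le> u" "b 0 = 0" "b u = n" "\<And>i. i < u \<Longrightarrow> b i < b (Suc i)"
    "\<And>i t. i < u \<Longrightarrow> b i \<le> t \<Longrightarrow> t \<le> b (Suc i) \<Longrightarrow> V t (b (Suc i)) \<le> (3 * A)\<^sup>2"
    "real (u - 1) * (8 / 9 * A\<^sup>2) \<le> \<sigma>\<^sup>2" "\<And>i. i \<le> u \<Longrightarrow> V (b i) n \<le> \<sigma>\<^sup>2"
    by (rule blocks) blast
  \<comment> \<open>Decay is used up to order \<open>p + 2\<close>, hence the base
    \<open>p + 3\<close>.\<close>
  define G where "G = \<Lambda> * (real p + 3) ^ \<gamma>"
  define H1 where "H1 = 1296 * real p * A"
  define H where "H = 2 * H1"
  define X where "X i = S (b (i - 1)) (b i)" for i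
  have A0: "0 < A" "1 \<le> A" using A_ge by auto
  have H10: "0 < H1" unfolding H1_def using p A0 by simp
  have G1: "1 \<le> G"
    unfolding G_def using Lam mult_mono[of 1 \<Lambda> 1 "(real p + 3) ^ \<gamma>"] one_le_power[of "real p + 3" \<gamma>] by simp
  have bd: "b i + d \<le> b (i + d)" if "i + d \<le> u" for i d
    using that
  proof (induction d)
    case (Suc d)
    then show ?case using b(4)[of "i + d"] by simp
  qed simp
  have bn: "b i \<le> n" if "i \<le> u" for i using bd[of i "u - i"] that b(3) by simp
  have bmono: "b i \<le> b j" if "i \<le> j" "j \<le> u" for i j using bd[of i "j - i"] that by simp
  \<comment> \<open>Orders up to \<open>2 * p\<close> are needed because the covariance inequality
    squares one of its two factors. The constant is 6 * 2 * 36 * 3 = 1296.\<close>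
  have X_moment: "expectation (\<lambda>\<omega>. \<bar>X i \<omega>\<bar> ^ d) \<le> H1 ^ d" if i: "i \<in> {1..u}" and d: "1 \<le> d" "d \<le> 2 * p" for i d
  proof -
    have "expectation (\<lambda>\<omega>. \<bar>X i \<omega>\<bar> ^ d) \<le> 6 * fact d * (36 * (3 * A)) ^ d"
      unfolding X_def using i b(5)[of "i - 1"] bn[of i] bmono[of "i - 1" i] A0 by (intro suffix_moment) auto
    also have "\<dots> \<le> 6 ^ d * (2 * real p) ^ d * (36 * (3 * A)) ^ d"
    proof (intro mult_right_mono mult_mono)
      show "(6::real) \<le> 6 ^ d" using d by (intro self_le_power) auto
      have "(fact d :: real) \<le> real (d ^ d)" using fact_le_power[of d] by simp
      also have "\<dots> \<le> (2 * real p) ^ d" using power_mono[of "real d" "2 * real p" d] d by simp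
      finally show "fact d \<le> (2 * real p) ^ d" .
    qed (use A0 in auto)
    also have "\<dots> = H1 ^ d" unfolding H1_def power_mult_distrib[symmetric] by (simp add: mult_ac)
    finally show ?thesis .
  qed
  have X_rv: "X i \<in> borel_measurable M" if "i \<in> {1..u}" for i unfolding X_def using bn[of i] that by (intro S_rv) auto
  have X_bd: "\<bar>X i \<omega>\<bar> \<le> real n * K" if "i \<in> {1..u}" "\<omega> \<in> space M" for i \<omega>
  proof -
    have "\<bar>X i \<omega>\<bar> \<le> real (b i - b (i - 1)) * K" unfolding X_def using bn[of i] that by (intro S_bound) auto
    also have "\<dots> \<le> real n * K" using bn[of i] that K1 by (intro mult_right_mono) auto
    finally show ?thesis .
  qed
  have XdI: "integrable M (\<lambda>\<omega>. \<bar>X i \<omega>\<bar> ^ d)" if "i \<in> {1..u}" for i d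
    unfolding X_def using bn[of i] that by (intro S_abs_power_integrable) auto
  have nK: "0 \<le> real n * K" using K1 by simp
  have prod_moment: "expectation (\<lambda>\<omega>. \<Prod>r\<in>T. \<bar>X (f r) \<omega>\<bar> ^ e r) \<le> H ^ (\<Sum>r\<in>T. e r)"
    if T: "finite (T :: nat set)" "f ` T \<subseteq> {1..u}" "(\<Sum>r\<in>T. e r) \<le> 2 * p" "\<And>r. r \<in> T \<Longrightarrow> 1 \<le> e r" for T f e
  proof (cases "T = {}")
    case False
    define D where "D = (\<Sum>r\<in>T. e r)"
    have cD: "card T \<le> D" using T(4) sum_mono[of T "\<lambda>_. 1" e] by (simp add: D_def)
    have D1: "1 \<le> D" using cD False T(1) card_gt_0_iff[of T] by linarith
    have "expectation (\<lambda>\<omega>. \<Prod>r\<in>T. \<bar>X (f r) \<omega>\<bar> ^ e r) \<le> expectation (\<lambda>\<omega>. \<Sum>r\<in>T. \<bar>X (f r) \<omega>\<bar> ^ D)"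
    proof (rule integral_mono)
      show "integrable M (\<lambda>\<omega>. \<Prod>r\<in>T. \<bar>X (f r) \<omega>\<bar> ^ e r)"
      proof (rule integrable_bounded)
        show "(\<lambda>\<omega>. \<Prod>r\<in>T. \<bar>X (f r) \<omega>\<bar> ^ e r) \<in> borel_measurable M"
          using T(2) by (intro borel_measurable_prod borel_measurable_power borel_measurable_abs X_rv) auto
        show "\<bar>\<Prod>r\<in>T. \<bar>X (f r) \<omega>\<bar> ^ e r\<bar> \<le> (\<Prod>r\<in>T. (real n * K) ^ e r)" if "\<omega> \<in> space M" for \<omega>
          unfolding abs_prod using X_bd[OF _ that] T(2) by (intro prod_mono) (auto intro!: power_mono)
      qed
      show "integrable M (\<lambda>\<omega>. \<Sum>r\<in>T. \<bar>X (f r) \<omega>\<bar> ^ D)" using T(2) by (intro Bochner_Integration.integrable_sum XdI) auto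
      show "(\<Prod>r\<in>T. \<bar>X (f r) \<omega>\<bar> ^ e r) \<le> (\<Sum>r\<in>T. \<bar>X (f r) \<omega>\<bar> ^ D)" for \<omega>
        unfolding D_def using T False by (intro prod_power_le_sum_power) auto
    qed
    also have "\<dots> = (\<Sum>r\<in>T. expectation (\<lambda>\<omega>. \<bar>X (f r) \<omega>\<bar> ^ D))"
      using T(2) by (intro Bochner_Integration.integral_sum XdI) auto
    also have "\<dots> \<le> (\<Sum>r\<in>T. H1 ^ D)" using T D1 by (intro sum_mono X_moment) (auto simp: D_def)
    also have "\<dots> = real (card T) * H1 ^ D" by simp
    also have "\<dots> \<le> 2 ^ D * H1 ^ D"
    proof (intro mult_right_mono)
      have "real (card T) \<le> real D" using cD by simp
      also have "\<dots> \<le> 2 ^ D" using of_nat_less_two_power[of D, where 'a=real] by simp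
      finally show "real (card T) \<le> 2 ^ D" .
    qed (use H10 in auto)
    also have "\<dots> = H ^ D" by (simp add: H_def power_mult_distrib)
    finally show ?thesis by (simp add: D_def)
  qed (simp add: prob_space)
  have Hp: "0 < H" using H10 by (simp add: H_def)
  interpret W: weak_dependence_decay M X u p H "\<lambda>h. 4 * sqrt (\<phi> h)" "real n * K" G
  proof unfold_locales
    show "X i \<in> borel_measurable M" if "i \<in> {1..u}" for i by (rule X_rv[OF that])
    show "\<bar>X i \<omega>\<bar> \<le> real n * K" if "i \<in> {1..u}" "\<omega> \<in> space M" for i \<omega> by (rule X_bd[OF that])
    show "expectation (X i) = 0" if "i \<in> {1..u}" for i
      unfolding X_def using bn[of i] that by (intro S_mean) auto
    show "0 \<le> H" using Hp by simp
    show "0 \<le> 4 * sqrt (\<phi> h)" for h using phi0 by simp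
    show "\<bar>expectation (\<lambda>\<omega>. \<Prod>r\<in>T. X (f r) \<omega>)\<bar> \<le> H ^ card T"
      if T: "finite T" "card T \<le> p" "f ` T \<subseteq> {1..u}" for T :: "nat set" and f
    proof -
      have "\<bar>expectation (\<lambda>\<omega>. \<Prod>r\<in>T. X (f r) \<omega>)\<bar> \<le> expectation (\<lambda>\<omega>. \<bar>\<Prod>r\<in>T. X (f r) \<omega>\<bar>)"
        by (rule integral_abs_bound)
      also have "\<dots> = expectation (\<lambda>\<omega>. \<Prod>r\<in>T. \<bar>X (f r) \<omega>\<bar> ^ 1)" by (simp add: abs_prod)
      also have "\<dots> \<le> H ^ (\<Sum>r\<in>T. 1)" using T by (intro prod_moment) auto
      finally show ?thesis by simp
    qed
    show "1 \<le> G" by (rule G1)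
    show "4 * sqrt (\<phi> h) \<le> 4 * (G / real h) ^ j" if "1 \<le> h" "j \<le> p + 2" for h j
    proof -
      have "sqrt (\<phi> h) \<le> (\<Lambda> * (real j + 1) ^ \<gamma> / real h) ^ j" by (rule decay[OF that(1)])
      also have "\<dots> \<le> (G / real h) ^ j"
        unfolding G_def using that Lam by (intro power_mono divide_right_mono mult_left_mono) auto
      finally show ?thesis by simp
    qed
    fix L R :: "nat set" and h s :: nat and f :: "nat \<Rightarrow> nat"
    assume fin: "finite L" "finite R" "L \<inter> R = {}" "card L + card R \<le> p" and h: "1 \<le> h"
      and fL: "f ` L \<subseteq> {1..s}" and fR: "f ` R \<subseteq> {s + h..u}" and su: "s + h \<le> Suc u"
    have suu: "s \<le> u" using h su by simp
    have J: "{1..b s} \<subseteq> {1..n}" "{b s + h..n} \<subseteq> {1..n}" using bn[OF suu] h by auto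
    let ?U = "\<lambda>\<omega>. \<Prod>r\<in>L. X (f r) \<omega>"
    let ?V = "\<lambda>\<omega>. \<Prod>r\<in>R. X (f r) \<omega>"
    have fLu: "f ` L \<subseteq> {1..u}" and fRu: "f ` R \<subseteq> {1..u}" using fL fR suu h by fastforce+
    have "\<bar>expectation (\<lambda>\<omega>. ?U \<omega> * ?V \<omega>) - expectation ?U * expectation ?V\<bar> \<le> 4 * sqrt (\<phi> h) * H ^ card L * H ^ card R"
    proof (rule phi_covariance[OF sub[OF J(1)] sub[OF J(2)]])
      show "\<bar>prob (A \<inter> B) - prob A * prob B\<bar> \<le> \<phi> h * prob A"
        if "A \<in> sets (Fs {1..b s})" "B \<in> sets (Fs {b s + h..n})" for A B
        using mixing[of "b s" h A B] that bn[OF suu] h by auto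
      show "?U \<in> borel_measurable (Fs {1..b s})"
      proof (intro borel_measurable_prod)
        fix r assume "r \<in> L"
        then have r: "1 \<le> f r" "f r \<le> s" using fL by auto
        show "X (f r) \<in> borel_measurable (Fs {1..b s})"
          unfolding X_def using bmono[of "f r" s] r suu by (intro S_meas J) auto
      qed
      show "?V \<in> borel_measurable (Fs {b s + h..n})"
      proof (intro borel_measurable_prod)
        fix r assume "r \<in> R"
        then have r: "s + h \<le> f r" "f r \<le> u" using fR by auto
        \<comment> \<open>Every block contains at least one index, so a gap of \<open>h\<close>
          blocks is also a gap of \<open>h\<close> in the row.\<close>
        have "b s + (h - 1) \<le> b (s + (h - 1))" using r h by (intro bd) auto
        also have "\<dots> \<le> b (f r - 1)" using r h by (intro bmono) auto
        finally show "X (f r) \<in> borel_measurable (Fs {b s + h..n})"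
          unfolding X_def using bn[of "f r"] r h by (intro S_meas J) auto
      qed
      show "\<bar>?U \<omega>\<bar> \<le> (\<Prod>r\<in>L. real n * K)" if "\<omega> \<in> space M" for \<omega>
        unfolding abs_prod using X_bd[OF _ that] fLu by (intro prod_mono) auto
      show "\<bar>?V \<omega>\<bar> \<le> (\<Prod>r\<in>R. real n * K)" if "\<omega> \<in> space M" for \<omega>
        unfolding abs_prod using X_bd[OF _ that] fRu by (intro prod_mono) auto
      show "0 \<le> \<phi> h" "\<phi> h \<le> (sqrt (\<phi> h))\<^sup>2" "0 \<le> sqrt (\<phi> h)" using phi0 by auto
      show "expectation (\<lambda>\<omega>. \<bar>?U \<omega>\<bar>) \<le> H ^ card L"
        using prod_moment[OF fin(1) fLu, of "\<lambda>_. 1"] fin by (simp add: abs_prod)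
      show "0 < H ^ card R" using Hp by simp
      show "expectation (\<lambda>\<omega>. (?V \<omega>)\<^sup>2) \<le> (H ^ card R)\<^sup>2"
        using prod_moment[OF fin(2) fRu, of "\<lambda>_. 2"] fin by (simp add: prod_power_distrib power_mult[symmetric] mult.commute)
      show "expectation (\<lambda>\<omega>. \<bar>?U \<omega>\<bar> * (?V \<omega>)\<^sup>2) \<le> H ^ card L * (H ^ card R)\<^sup>2"
      proof -
        \<comment> \<open>Exponent 1 on \<open>L\<close> and 2 on \<open>R\<close> turn the mixed
          expectation into a single product moment.\<close>
        define e :: "nat \<Rightarrow> nat" where "e r = (if r \<in> L then 1 else 2)" for r
        have eR: "r \<in> R \<Longrightarrow> e r = 2" for r using fin by (auto simp: e_def)
        have "(\<Sum>r\<in>L. e r) = card L" "(\<Sum>r\<in>R. e r) = 2 * card R" using eR by (auto simp: e_def)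
        then have se: "(\<Sum>r\<in>L \<union> R. e r) = card L + 2 * card R" using fin by (simp add: sum.union_disjoint)
        have "expectation (\<lambda>\<omega>. \<Prod>r\<in>L \<union> R. \<bar>X (f r) \<omega>\<bar> ^ e r) \<le> H ^ (\<Sum>r\<in>L \<union> R. e r)"
          using fin fLu fRu se by (intro prod_moment) (auto simp: e_def)
        moreover have "(\<Prod>r\<in>L \<union> R. \<bar>X (f r) \<omega>\<bar> ^ e r) = \<bar>?U \<omega>\<bar> * (?V \<omega>)\<^sup>2" for \<omega>
          using fin eR by (simp add: prod.union_disjoint abs_prod prod_power_distrib e_def)
        ultimately show ?thesis unfolding se by (simp add: power_add power_mult[symmetric] mult.commute)
      qed
    qed
    then show "\<bar>expectation (\<lambda>\<omega>. ?U \<omega> * ?V \<omega>) - expectation ?U * expectation ?V\<bar> \<le> 4 * sqrt (\<phi> h) * H ^ (card L + card R)"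
      by (simp add: power_add mult.assoc)
  qed
  have sumX: "(\<Sum>i=1..t. X i \<omega>) = S 0 (b t) \<omega>" if "t \<le> u" for t \<omega>
    using that
  proof (induction t)
    case (Suc t)
    then show ?case using S_split[of 0 "b t" "b (Suc t)" \<omega>] bmono[of t "Suc t"] by (simp add: X_def)
  qed (simp add: b)
  have main: "\<bar>expectation (\<lambda>\<omega>. S 0 n \<omega> ^ p) / fact p - gauss_fps (\<sigma>\<^sup>2 / 2) $ p\<bar>
    \<le> (\<Sum>j | j \<in> {3..p} \<and> even (p - j). (4 * (136 * H * (G * real p)\<^sup>2)) ^ j * real u ^ (j div 3) * (\<sigma>\<^sup>2 / 2) ^ ((p - j) div 2))"
    using W.moment_near_gauss[OF p] unfolding sumX[OF order_refl] b(3) sigma_sq(1) V_def .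
  define s where "s = \<sigma> / A"
  have As: "A * s = \<sigma>" using A0 by (simp add: s_def)
  have h_eq: "4 * (136 * H * (G * real p)\<^sup>2) = A * h"
    by (simp add: h_def H_def H1_def G_def power2_eq_square power3_eq_cube)
  have h1: "1 \<le> h"
  proof -
    have "1 * 1 * 1 \<le> 1410048 * real p ^ 3 * G\<^sup>2" using p G1 by (intro mult_mono) auto
    then show ?thesis by (simp add: h_def G_def)
  qed
  have sh: "h ^ 3 \<le> s" using sig A0 by (simp add: s_def le_divide_eq mult.commute)
  have s1: "1 \<le> s" using sh h1 by (meson one_le_power order_trans)
  \<comment> \<open>\<open>u - 1\<close> is at most \<open>9 / 8 * s\<^sup>2\<close>, and the
    missing block is absorbed by \<open>s \<ge> 1\<close>.\<close>
  have u: "real u \<le> 3 * s\<^sup>2"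
  proof -
    have "real (u - 1) * (8 / 9) * A\<^sup>2 \<le> s\<^sup>2 * A\<^sup>2" using b(6) unfolding As[symmetric] by (simp add: power_mult_distrib mult_ac)
    then have "real (u - 1) * (8 / 9) \<le> s\<^sup>2" using A0 by (simp add: mult_le_cancel_right)
    moreover have "1 \<le> s\<^sup>2" using s1 by simp
    ultimately show ?thesis using b(1) by (simp add: of_nat_diff)
  qed
  note main
  also have "(\<Sum>j | j \<in> {3..p} \<and> even (p - j). (4 * (136 * H * (G * real p)\<^sup>2)) ^ j * real u ^ (j div 3) * (\<sigma>\<^sup>2 / 2) ^ ((p - j) div 2))
     \<le> real p * 3 ^ p * A ^ p * h ^ 6 * s ^ (2 * ((p - 1) div 2))"
    unfolding h_eq As[symmetric] by (rule gauss_error_numeric[OF A0(1) h1 sh u p])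
  also have "\<dots> \<le> real p * 3 ^ p * A\<^sup>2 * h ^ 6 * \<sigma> ^ (2 * ((p - 1) div 2))"
  proof -
    define m where "m = 2 * ((p - 1) div 2)"
    have m: "m \<le> p" "p - m \<le> 2" using p unfolding m_def by linarith+
    \<comment> \<open>All but \<open>p - m \<le> 2\<close> powers of \<open>A\<close> combine with
      \<open>s\<close> into \<sigma>; this is why only \<open>A\<^sup>2\<close> survives.\<close>
    have "A ^ p * s ^ m = A ^ (p - m) * (A ^ m * s ^ m)" using m by (simp flip: power_add mult.assoc)
    also have "\<dots> = A ^ (p - m) * \<sigma> ^ m" unfolding power_mult_distrib[symmetric] As ..
    also have "\<dots> \<le> A\<^sup>2 * \<sigma> ^ m" using A0 m sigma_sq by (intro mult_right_mono power_increasing) auto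
    finally have "(real p * 3 ^ p * h ^ 6) * (A ^ p * s ^ m) \<le> (real p * 3 ^ p * h ^ 6) * (A\<^sup>2 * \<sigma> ^ m)"
      using h1 by (intro mult_left_mono) auto
    then show ?thesis unfolding m_def[symmetric] by (simp add: mult_ac)
  qed
  finally show ?thesis .
qed

end

section \<open>Rows of the array\<close>

lemma Linf_norm_facts:
  assumes "prob_space M" "X \<in> borel_measurable M" "AE \<omega> in M. \<bar>X \<omega>\<bar> \<le> c"
  shows "0 \<le> Linf_norm M X" "AE \<omega> in M. \<bar>X \<omega>\<bar> \<le> Linf_norm M X"
proof -
  interpret prob_space M by fact
  let ?e = "esssup M (\<lambda>\<omega>. ereal \<bar>X \<omega>\<bar>)"
  have m: "(\<lambda>\<omega>. ereal \<bar>X \<omega>\<bar>) \<in> borel_measurable M" using assms(2) by measurable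
  have le: "?e \<le> ereal c" using m assms(3) by (intro esssup_I) auto
  have "esssup M (\<lambda>\<omega>. 0 :: ereal) \<le> ?e" by (intro esssup_mono) auto
  then have ge: "0 \<le> ?e" by (simp add: esssup_const emeasure_space_1)
  then have fin: "ereal (Linf_norm M X) = ?e"
    unfolding Linf_norm_def using le by (intro ereal_real') auto
  show "0 \<le> Linf_norm M X" unfolding Linf_norm_def using ge by (rule real_of_ereal_pos)
  have "AE \<omega> in M. ereal \<bar>X \<omega>\<bar> \<le> ?e" by (rule esssup_AE)
  then show "AE \<omega> in M. \<bar>X \<omega>\<bar> \<le> Linf_norm M X" unfolding fin[symmetric] by simp
qed

text \<open>The set under the supremum is bounded by 1, so each element lies below it. The
  multiplied form extends to null events, where both sides vanish.\<close>

lemma phi_coeff_upper: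
  assumes "prob_space M" "G \<subseteq> sets M" "H \<subseteq> sets M" "A \<in> G" "B \<in> H"
  shows "\<bar>measure M (A \<inter> B) - measure M A * measure M B\<bar> \<le> phi_coeff M G H * measure M A"
    and "measure M A > 0 \<Longrightarrow> \<bar>measure M (A \<inter> B) / measure M A - measure M B\<bar> \<le> phi_coeff M G H"
proof -
  interpret prob_space M by fact
  let ?S = "{\<bar>prob (A \<inter> B) / prob A - prob B\<bar> | A B. A \<in> G \<and> B \<in> H \<and> prob A > 0}"
  have le1: "\<bar>prob (A \<inter> B) / prob A - prob B\<bar> \<le> 1" if "A \<in> G" "B \<in> H" "prob A > 0" for A B
  proof -
    have "prob (A \<inter> B) \<le> prob A" using that assms by (intro finite_measure_mono) auto
    then have "prob (A \<inter> B) / prob A \<le> 1" "0 \<le> prob (A \<inter> B) / prob A" using that by auto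
    moreover have "0 \<le> prob B" "prob B \<le> 1" by auto
    ultimately show ?thesis by linarith
  qed
  then have bdd: "bdd_above ?S" by (intro bdd_aboveI[where M=1]) auto
  show 2: "\<bar>prob (A \<inter> B) / prob A - prob B\<bar> \<le> phi_coeff M G H" if "prob A > 0"
    unfolding phi_coeff_def using assms that by (intro cSup_upper bdd) auto
  show "\<bar>prob (A \<inter> B) - prob A * prob B\<bar> \<le> phi_coeff M G H * prob A"
  proof (cases "prob A > 0")
    case True
    have "prob (A \<inter> B) - prob A * prob B = (prob (A \<inter> B) / prob A - prob B) * prob A"
      using True by (simp add: left_diff_distrib)
    then have "\<bar>prob (A \<inter> B) - prob A * prob B\<bar> = \<bar>prob (A \<inter> B) / prob A - prob B\<bar> * prob A"
      by (simp only: abs_mult abs_of_nonneg[OF measure_nonneg])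
    also have "\<dots> \<le> phi_coeff M G H * prob A" using 2[OF True] True by (intro mult_right_mono) auto
    finally show ?thesis .
  next
    case False
    then have 0: "prob A = 0" by (simp add: zero_less_measure_iff)
    have "prob (A \<inter> B) \<le> prob A" using assms by (intro finite_measure_mono) auto
    then have "prob (A \<inter> B) = 0" using 0 by (simp add: measure_le_0_iff)
    then show ?thesis using 0 by simp
  qed
qed

text \<open>The set family \<open>gen_sigma\<close> wrapped as a measure space, so that
  measurability and \<open>subalgebra\<close> can be stated for it.\<close>

definition row_algebra :: "'a measure \<Rightarrow> (nat \<Rightarrow> 'b measure) \<Rightarrow> (nat \<Rightarrow> 'a \<Rightarrow> 'b) \<Rightarrow> nat set \<Rightarrow> 'a measure" where
  "row_algebra M N \<zeta> J = sigma (space M) (\<Union>j\<in>J. {\<zeta> j -` A \<inter> space M | A. A \<in> sets (N j)})"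

lemma space_row_algebra [simp]: "space (row_algebra M N \<zeta> J) = space M"
  unfolding row_algebra_def by (rule space_measure_of) auto

lemma sets_row_algebra: "sets (row_algebra M N \<zeta> J) = gen_sigma M N \<zeta> J"
  unfolding row_algebra_def gen_sigma_def by (rule sets_measure_of) auto

lemma gen_sigma_empty: "gen_sigma M N \<zeta> {} = {{}, space M}"
  by (simp add: gen_sigma_def sigma_sets_empty_eq)

lemma gen_sigma_sub:
  assumes "\<And>j. j \<in> J \<Longrightarrow> \<zeta> j \<in> measurable M (N j)"
  shows "gen_sigma M N \<zeta> J \<subseteq> sets M"
  unfolding gen_sigma_def by (rule sets.sigma_sets_subset) (use assms in \<open>auto intro: measurable_sets\<close>)

lemma coordinate_measurable:
  assumes "j \<in> J" "\<zeta> j \<in> measurable M (N j)"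
  shows "\<zeta> j \<in> measurable (row_algebra M N \<zeta> J) (N j)"
proof (rule measurableI)
  show "\<zeta> j \<omega> \<in> space (N j)" if "\<omega> \<in> space (row_algebra M N \<zeta> J)" for \<omega>
    using that assms by (auto dest: measurable_space)
  show "\<zeta> j -` A \<inter> space (row_algebra M N \<zeta> J) \<in> sets (row_algebra M N \<zeta> J)" if "A \<in> sets (N j)" for A
    unfolding sets_row_algebra gen_sigma_def using assms that by (intro sigma_sets.Basic) auto
qed

lemma phi_row_upper:
  assumes "prob_space M" "\<And>j. 1 \<le> j \<Longrightarrow> j \<le> n \<Longrightarrow> \<zeta> n j \<in> measurable M (N n j)"
    and "1 \<le> k" "s + k \<le> n" "A \<in> gen_sigma M (N n) (\<zeta> n) {1..s}" "B \<in> gen_sigma M (N n) (\<zeta> n) {s + k..n}"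
  shows "\<bar>measure M (A \<inter> B) - measure M A * measure M B\<bar> \<le> phi_row M N \<zeta> n k * measure M A"
proof -
  let ?c = "\<lambda>s. phi_coeff M (gen_sigma M (N n) (\<zeta> n) {1..s}) (gen_sigma M (N n) (\<zeta> n) {s + k..n})"
  have "\<bar>measure M (A \<inter> B) - measure M A * measure M B\<bar> \<le> ?c s * measure M A"
    using assms by (intro phi_coeff_upper gen_sigma_sub) auto
  also have "\<dots> \<le> phi_row M N \<zeta> n k * measure M A"
  proof (rule mult_right_mono)
    show "?c s \<le> phi_row M N \<zeta> n k"
      unfolding phi_row_def using assms by (intro cSUP_upper bdd_above_finite) auto
  qed simp
  finally show ?thesis .
qed

text \<open>The exponent \<open>1 / 32\<close> is small enough for the eighth power of this constant, all that the moment
  estimate needs, to be absorbed in \<open>B exp (a powr - v)\<close>.\<close>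

definition decay_const :: "real \<Rightarrow> real \<Rightarrow> real \<Rightarrow> real" where
  "decay_const \<eta> a B = 1 + B powr (1 / 32) * (32 / (\<eta> * a)) powr (1 / \<eta>)"

lemma exp_ge_powr:
  fixes y N :: real
  assumes "0 \<le> y" "0 < N"
  shows "(y / N) powr N \<le> exp y"
proof -
  have "y / N \<le> exp (y / N)" using exp_ge_add_one_self[of "y / N"] by linarith
  then have "(y / N) powr N \<le> exp (y / N) powr N" using assms by (intro powr_mono2) auto
  also have "\<dots> = exp y" using assms by (simp add: powr_def)
  finally show ?thesis .
qed

text \<open>Capping at 1 allows the exponent 1/2 to be lowered to 1/32, which shrinks the power of
  \<open>B\<close>. The exponential is then compared with a power of its argument.\<close>

lemma sqrt_decay:
  fixes a B \<eta> :: real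
  assumes a: "0 < a" and B: "1 \<le> B" and \<eta>: "0 < \<eta>" and h: "1 \<le> h"
  shows "sqrt (min 1 (B * exp (- a * real h powr \<eta>))) \<le>
    (decay_const \<eta> a B * (real k + 1) ^ nat \<lceil>1 / \<eta>\<rceil> / real h) ^ k"
proof (cases "k = 0")
  case True
  then show ?thesis by simp
next
  case False
  define y where "y = B * exp (- a * real h powr \<eta>)"
  \<comment> \<open>With this exponent the power of \<open>h powr \<eta>\<close> is exactly
    \<open>h ^ k\<close>.\<close>
  define N where "N = real k / \<eta>"
  define c where "c = (32 / (\<eta> * a)) powr (1 / \<eta>)"
  have y0: "0 < y" using B by (simp add: y_def)
  have N0: "0 < N" using False \<eta> by (simp add: N_def)
  have "sqrt (min 1 y) \<le> y powr (1 / 32)"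
  proof -
    have "sqrt (min 1 y) = min 1 y powr (1 / 2)" using y0 by (simp add: powr_half_sqrt)
    also have "\<dots> \<le> min 1 y powr (1 / 32)" using y0 by (intro powr_mono') auto
    also have "\<dots> \<le> y powr (1 / 32)" using y0 by (intro powr_mono2) auto
    finally show ?thesis .
  qed
  also have "y powr (1 / 32) = B powr (1 / 32) * exp (- (a * real h powr \<eta> / 32))"
    unfolding y_def using B by (subst powr_mult) (auto simp: powr_def)
  also have "\<dots> \<le> (B powr (1 / 32)) ^ k * (c * (real k + 1) ^ nat \<lceil>1 / \<eta>\<rceil> / real h) ^ k"
  proof (rule mult_mono)
    have B1: "1 \<le> B powr (1 / 32)" using B by (simp add: ge_one_powr_ge_zero)
    then show "B powr (1 / 32) \<le> (B powr (1 / 32)) ^ k" using False by (intro self_le_power) auto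
    have z: "0 \<le> a * real h powr \<eta> / 32" using a by simp
    have pos: "0 < a * real h powr \<eta> / 32 / N" using a h N0 by simp
    have "exp (- (a * real h powr \<eta> / 32)) = 1 / exp (a * real h powr \<eta> / 32)" by (simp add: exp_minus inverse_eq_divide)
    also have "\<dots> \<le> 1 / (a * real h powr \<eta> / 32 / N) powr N"
      using exp_ge_powr[OF z N0] pos h by (intro divide_left_mono mult_pos_pos) auto
    also have "\<dots> = (1 / (a * real h powr \<eta> / 32 / N)) powr N"
      using pos by (simp add: powr_divide)
    also have "1 / (a * real h powr \<eta> / 32 / N) = 32 / (\<eta> * a) * real k * (1 / real h powr \<eta>)"
      using a \<eta> h by (simp add: N_def)
    also have "(32 / (\<eta> * a) * real k * (1 / real h powr \<eta>)) powr N = ((32 / (\<eta> * a) * real k * (1 / real h powr \<eta>)) powr (1 / \<eta>)) powr real k"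
      by (simp add: powr_powr N_def)
    also have "(32 / (\<eta> * a) * real k * (1 / real h powr \<eta>)) powr (1 / \<eta>) = c * real k powr (1 / \<eta>) / real h"
      using a \<eta> h by (simp add: powr_mult c_def powr_divide powr_powr)
    also have "(c * real k powr (1 / \<eta>) / real h) powr real k = (c * real k powr (1 / \<eta>) / real h) ^ k"
      using False h \<eta> a by (intro powr_realpow) (auto simp: c_def)
    also have "\<dots> \<le> (c * (real k + 1) ^ nat \<lceil>1 / \<eta>\<rceil> / real h) ^ k"
    proof (intro power_mono divide_right_mono mult_left_mono)
      have "real k powr (1 / \<eta>) \<le> (real k + 1) powr (1 / \<eta>)" using \<eta> by (intro powr_mono2) auto
      also have "\<dots> \<le> (real k + 1) powr real (nat \<lceil>1 / \<eta>\<rceil>)" by (intro powr_mono) (auto simp: real_nat_ceiling_ge)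
      also have "\<dots> = (real k + 1) ^ nat \<lceil>1 / \<eta>\<rceil>" by (intro powr_realpow) auto
      finally show "real k powr (1 / \<eta>) \<le> (real k + 1) ^ nat \<lceil>1 / \<eta>\<rceil>" .
    qed (auto simp: c_def)
    finally show "exp (- (a * real h powr \<eta> / 32)) \<le> (c * (real k + 1) ^ nat \<lceil>1 / \<eta>\<rceil> / real h) ^ k" .
  qed (use B in auto)
  also have "\<dots> = (B powr (1 / 32) * c * (real k + 1) ^ nat \<lceil>1 / \<eta>\<rceil> / real h) ^ k"
    by (simp add: power_mult_distrib[symmetric] mult.assoc)
  also have "\<dots> \<le> (decay_const \<eta> a B * (real k + 1) ^ nat \<lceil>1 / \<eta>\<rceil> / real h) ^ k"
    by (intro power_mono divide_right_mono mult_right_mono) (auto simp: decay_const_def c_def)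
  finally show ?thesis by (simp add: y_def)
qed

text \<open>The critical factor a^(-1/\<eta>) is the power 1/(\<eta> v) of z = a^(-v), and any fixed
  power of z is dominated by a constant times exp(z/32). What remains is the power 1/32 of B
  exp(z).\<close>

lemma decay_const_bound:
  fixes a B \<eta> v :: real
  assumes a: "0 < a" and B: "1 \<le> B" and \<eta>: "0 < \<eta>" and v: "0 < v"
  shows "decay_const \<eta> a B \<le> (1 + (32 / \<eta>) powr (1 / \<eta>) * (32 / (\<eta> * v)) powr (1 / (\<eta> * v))) * (B * exp (a powr (- v))) powr (1 / 32)"
proof -
  define N where "N = 1 / (\<eta> * v)"
  define z where "z = a powr (- v)"
  define d where "d = (32 / (\<eta> * v)) powr (1 / (\<eta> * v))"
  have N0: "0 < N" using \<eta> v by (simp add: N_def)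
  have z0: "0 < z" using a by (simp add: z_def)
  have "(1 / a) powr (1 / \<eta>) = z powr N"
    using a \<eta> v by (simp add: z_def N_def powr_powr powr_minus_divide powr_divide)
  also have "\<dots> = (32 * N * (z / 32 / N)) powr N" using N0 by simp
  also have "\<dots> = (32 * N) powr N * (z / 32 / N) powr N" by (rule powr_mult)
  also have "\<dots> \<le> (32 * N) powr N * exp (z / 32)" using z0 N0 by (intro mult_left_mono exp_ge_powr) auto
  also have "(32 * N) powr N = d" by (simp add: N_def d_def)
  finally have 1: "(1 / a) powr (1 / \<eta>) \<le> d * exp (z / 32)" .
  have W: "(B * exp z) powr (1 / 32) = B powr (1 / 32) * exp (z / 32)"
    using B by (subst powr_mult) (auto simp: powr_def)
  have W1: "1 \<le> B powr (1 / 32) * exp (z / 32)"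
    using mult_mono[of 1 "B powr (1 / 32)" 1 "exp (z / 32)"] B z0 by (simp add: ge_one_powr_ge_zero)
  have "(32 / (\<eta> * a)) powr (1 / \<eta>) = (32 / \<eta>) powr (1 / \<eta>) * (1 / a) powr (1 / \<eta>)"
    using a \<eta> by (subst powr_mult[symmetric]) auto
  also have "\<dots> \<le> (32 / \<eta>) powr (1 / \<eta>) * (d * exp (z / 32))" using 1 by (intro mult_left_mono) auto
  finally have "B powr (1 / 32) * (32 / (\<eta> * a)) powr (1 / \<eta>) \<le> B powr (1 / 32) * ((32 / \<eta>) powr (1 / \<eta>) * (d * exp (z / 32)))"
    by (intro mult_left_mono) auto
  then show ?thesis using W1 unfolding decay_const_def z_def[symmetric] d_def[symmetric] W by (simp add: algebra_simps)
qed

lemma std_normal_power_moment: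
  assumes "distributed Q lborel Z std_normal_density"
  shows "s ^ p * (\<integral>\<omega>. Z \<omega> ^ p \<partial>Q) = fact p * gauss_fps (s\<^sup>2 / 2) $ p"
proof -
  have "(\<integral>\<omega>. Z \<omega> ^ p \<partial>Q) = (\<integral>y. std_normal_density y * y ^ p \<partial>lborel)"
    by (rule distributed_integral[symmetric, OF assms]) auto
  also have "s ^ p * \<dots> = fact p * gauss_fps (s\<^sup>2 / 2) $ p"
  proof (cases "even p")
    case True
    then obtain m where m: "p = 2 * m" by (elim evenE)
    show ?thesis unfolding m integral_std_normal_moment_even
      by (simp add: gauss_fps_nth power_divide power_mult)
  next
    case False
    then obtain m where m: "p = 2 * m + 1" by (elim oddE)
    show ?thesis unfolding m integral_std_normal_moment_odd by (simp add: gauss_fps_nth)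
  qed
  finally show ?thesis .
qed

section \<open>A single row of the array\<close>

locale array_row = prob_space M for M :: "'a measure" +
  fixes N :: "nat \<Rightarrow> nat \<Rightarrow> 'b measure" and \<zeta> :: "nat \<Rightarrow> nat \<Rightarrow> 'a \<Rightarrow> 'b"
    and g :: "nat \<Rightarrow> nat \<Rightarrow> 'b \<Rightarrow> real" and \<xi> :: "nat \<Rightarrow> nat \<Rightarrow> 'a \<Rightarrow> real"
    and n :: nat and a B \<eta> :: real
  assumes zeta_measurable: "\<And>j. 1 \<le> j \<Longrightarrow> j \<le> n \<Longrightarrow> \<zeta> n j \<in> measurable M (N n j)"
    and g_measurable: "\<And>j. 1 \<le> j \<Longrightarrow> j \<le> n \<Longrightarrow> g n j \<in> borel_measurable (N n j)"
    and xi_eq: "\<xi> = (\<lambda>n j \<omega>. g n j (\<zeta> n j \<omega>))"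
    and bounded: "\<And>j. 1 \<le> j \<Longrightarrow> j \<le> n \<Longrightarrow> \<exists>c. AE \<omega> in M. \<bar>\<xi> n j \<omega>\<bar> \<le> c"
    and centered: "\<And>j. 1 \<le> j \<Longrightarrow> j \<le> n \<Longrightarrow> (\<integral>\<omega>. \<xi> n j \<omega> \<partial>M) = 0"
    and n_pos: "1 \<le> n" and a_pos: "0 < a" and B_ge: "1 \<le> B" and eta_pos: "0 < \<eta>"
    and phi_bound: "\<And>k. 1 \<le> k \<Longrightarrow> k \<le> n \<Longrightarrow> phi_row M N \<zeta> n k \<le> B * exp (- a * real k powr \<eta>)"
begin

definition K :: real where "K = K_inf M \<xi> n + 1"

text \<open>Clipping makes the almost sure bound hold everywhere.\<close>

definition x :: "nat \<Rightarrow> 'a \<Rightarrow> real" where "x j \<omega> = max (- K) (min K (\<xi> n j \<omega>))"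

definition \<phi> :: "nat \<Rightarrow> real" where "\<phi> k = min 1 (B * exp (- a * real k powr \<eta>))"

lemma xi_rv: "1 \<le> j \<Longrightarrow> j \<le> n \<Longrightarrow> \<xi> n j \<in> borel_measurable M"
  unfolding xi_eq by (rule measurable_compose[OF zeta_measurable g_measurable])

lemma K_inf_bound: "1 \<le> j \<Longrightarrow> j \<le> n \<Longrightarrow> AE \<omega> in M. \<bar>\<xi> n j \<omega>\<bar> \<le> K_inf M \<xi> n"
proof -
  assume j: "1 \<le> j" "j \<le> n"
  obtain c where "AE \<omega> in M. \<bar>\<xi> n j \<omega>\<bar> \<le> c" using bounded[OF j] by blast
  then have "AE \<omega> in M. \<bar>\<xi> n j \<omega>\<bar> \<le> Linf_norm M (\<xi> n j)"
    by (intro Linf_norm_facts(2)[OF prob_space_axioms xi_rv[OF j]])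
  moreover have "Linf_norm M (\<xi> n j) \<le> K_inf M \<xi> n"
    unfolding K_inf_def using j by (intro Max_ge) auto
  ultimately show ?thesis by (auto elim!: eventually_mono)
qed

lemma K_inf_nonneg: "0 \<le> K_inf M \<xi> n"
proof -
  have "AE \<omega> in M. 0 \<le> K_inf M \<xi> n" by (rule eventually_mono[OF K_inf_bound[OF order_refl n_pos]]) linarith
  then show ?thesis by simp
qed

lemma K_ge: "1 \<le> K" using K_inf_nonneg by (simp add: K_def)

lemma x_eq_xi: "1 \<le> j \<Longrightarrow> j \<le> n \<Longrightarrow> AE \<omega> in M. x j \<omega> = \<xi> n j \<omega>"
  using K_inf_bound[of j] by (auto elim!: eventually_mono simp: x_def K_def)

sublocale row: decay_mixing_row M "row_algebra M (N n) (\<zeta> n)" x n K \<phi> "decay_const \<eta> a B" "nat \<lceil>1 / \<eta>\<rceil>"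
proof unfold_locales
  show "subalgebra M (row_algebra M (N n) (\<zeta> n) J)" if "J \<subseteq> {1..n}" for J
  proof -
    have "gen_sigma M (N n) (\<zeta> n) J \<subseteq> events" using that by (intro gen_sigma_sub zeta_measurable) auto
    then show ?thesis unfolding subalgebra_def sets_row_algebra by simp
  qed
  show meas: "x j \<in> borel_measurable (row_algebra M (N n) (\<zeta> n) J)" if "J \<subseteq> {1..n}" "j \<in> J" for J j
  proof -
    have "\<zeta> n j \<in> measurable (row_algebra M (N n) (\<zeta> n) J) (N n j)"
      using that by (intro coordinate_measurable zeta_measurable) auto
    moreover have "g n j \<in> borel_measurable (N n j)" using that by (intro g_measurable) auto
    ultimately have "\<xi> n j \<in> borel_measurable (row_algebra M (N n) (\<zeta> n) J)"
      unfolding xi_eq by (rule measurable_compose)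
    then show ?thesis unfolding x_def by measurable
  qed
  show "\<bar>x j \<omega>\<bar> \<le> K" for j \<omega> using K_ge by (auto simp: x_def)
  show "expectation (x j) = 0" if "j \<in> {1..n}" for j
  proof -
    have j: "1 \<le> j" "j \<le> n" using that by auto
    have "x j \<in> borel_measurable M" unfolding x_def using xi_rv[OF j] by measurable
    then have "expectation (x j) = expectation (\<xi> n j)"
      using x_eq_xi[OF j] xi_rv[OF j] by (intro integral_cong_AE) auto
    then show ?thesis using centered[OF j] by simp
  qed
  show "1 \<le> K" by (rule K_ge)
  show "0 \<le> \<phi> k" for k using B_ge by (simp add: \<phi>_def)
  show "\<bar>prob (A \<inter> C) - prob A * prob C\<bar> \<le> \<phi> k * prob A"
    if s: "s \<le> n" "1 \<le> k" and A: "A \<in> sets (row_algebra M (N n) (\<zeta> n) {1..s})"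
      and C: "C \<in> sets (row_algebra M (N n) (\<zeta> n) {s+k..n})" for s k A C
  proof -
    have sub: "gen_sigma M (N n) (\<zeta> n) {1..s} \<subseteq> events" "gen_sigma M (N n) (\<zeta> n) {s+k..n} \<subseteq> events"
      using s zeta_measurable by (intro gen_sigma_sub; auto)+
    have AC: "A \<in> events" "C \<in> events" using A C sub unfolding sets_row_algebra by auto
    have triv: "\<bar>prob (A \<inter> C) - prob A * prob C\<bar> \<le> 1 * prob A"
    proof -
      have "prob (A \<inter> C) \<le> prob A" using AC by (intro finite_measure_mono) auto
      moreover have "0 \<le> prob A * prob C" by simp
      moreover have "prob A * prob C \<le> prob A * 1" by (intro mult_left_mono) (rule prob_le_1, simp)
      ultimately show ?thesis using measure_nonneg[of M "A \<inter> C"] by linarith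
    qed
    have "\<bar>prob (A \<inter> C) - prob A * prob C\<bar> \<le> (B * exp (- a * real k powr \<eta>)) * prob A"
    proof (cases "s + k \<le> n")
      case True
      have "\<bar>prob (A \<inter> C) - prob A * prob C\<bar> \<le> phi_row M N \<zeta> n k * prob A"
        using A C s True zeta_measurable unfolding sets_row_algebra
        by (intro phi_row_upper prob_space_axioms) auto
      also have "\<dots> \<le> (B * exp (- a * real k powr \<eta>)) * prob A"
        using phi_bound[of k] s True by (intro mult_right_mono) auto
      finally show ?thesis .
    next
      case False
      \<comment> \<open>Beyond the end of the row the future algebra is generated by no coordinate
        and hence trivial.\<close>
      then have "C = {} \<or> C = space M" using C unfolding sets_row_algebra by (simp add: gen_sigma_empty)
      then have "prob (A \<inter> C) = prob A * prob C" using AC by (auto simp: prob_space sets.Int_space_eq2)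
      then show ?thesis using B_ge by simp
    qed
    then show ?thesis using triv unfolding \<phi>_def by (simp add: min_def)
  qed
  show "1 \<le> decay_const \<eta> a B" by (simp add: decay_const_def)
  show "1 \<le> n" by (rule n_pos)
  show "sqrt (\<phi> h) \<le> (decay_const \<eta> a B * (real k + 1) ^ nat \<lceil>1 / \<eta>\<rceil> / real h) ^ k" if "1 \<le> h" for h k
    unfolding \<phi>_def by (rule sqrt_decay[OF a_pos B_ge eta_pos that])
qed

lemma row_sum_rv: "row_sum \<xi> n \<in> borel_measurable M"
  unfolding row_sum_def using xi_rv by (intro borel_measurable_sum) auto

lemma row_sum_eq_S: "AE \<omega> in M. row_sum \<xi> n \<omega> = row.S 0 n \<omega>"
proof -
  have "AE \<omega> in M. \<forall>j\<in>{1..n}. x j \<omega> = \<xi> n j \<omega>" using x_eq_xi by (intro AE_finite_allI) auto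
  then show ?thesis
  proof (rule eventually_mono)
    fix \<omega> assume "\<forall>j\<in>{1..n}. x j \<omega> = \<xi> n j \<omega>"
    moreover have "{0<..n} = {1..n}" by auto
    ultimately show "row_sum \<xi> n \<omega> = row.S 0 n \<omega>" unfolding row_sum_def row.S_def by simp
  qed
qed

lemma row_sum_expectation:
  assumes "f \<in> borel_measurable borel"
  shows "expectation (\<lambda>\<omega>. f (row_sum \<xi> n \<omega>)) = expectation (\<lambda>\<omega>. f (row.S 0 n \<omega>) :: real)"
proof (rule integral_cong_AE)
  show "(\<lambda>\<omega>. f (row_sum \<xi> n \<omega>)) \<in> borel_measurable M" by (rule measurable_compose[OF row_sum_rv assms])
  show "(\<lambda>\<omega>. f (row.S 0 n \<omega>)) \<in> borel_measurable M" by (rule measurable_compose[OF row.S_rv assms]) simp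
  show "AE \<omega> in M. f (row_sum \<xi> n \<omega>) = f (row.S 0 n \<omega>)" using row_sum_eq_S by (auto elim!: eventually_mono)
qed

lemma row_sum_mean: "expectation (row_sum \<xi> n) = 0"
  using row_sum_expectation[of "\<lambda>y. y"] row.S_mean[of n 0] by simp

lemma row_sd_sq: "(row_sd M \<xi> n)\<^sup>2 = expectation (\<lambda>\<omega>. (row_sum \<xi> n \<omega>)\<^sup>2)" "0 \<le> row_sd M \<xi> n"
  unfolding row_sd_def row_sum_mean by auto

lemma row_sd_eq: "row_sd M \<xi> n = row.\<sigma>"
proof -
  have "expectation (\<lambda>\<omega>. (row_sum \<xi> n \<omega>)\<^sup>2) = row.V 0 n"
    unfolding row.V_def by (rule row_sum_expectation[where f="\<lambda>y. y\<^sup>2"]) measurable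
  then show ?thesis unfolding row.\<sigma>_def row_sd_def row_sum_mean by simp
qed

end

text \<open>The factor in front of the power 1/32 in the bound for \<open>decay_const\<close>; it
  depends on \<eta> and v alone.\<close>

definition envelope_const :: "real \<Rightarrow> real \<Rightarrow> real" where
  "envelope_const \<eta> v = 1 + (32 / \<eta>) powr (1 / \<eta>) * (32 / (\<eta> * v)) powr (1 / (\<eta> * v))"

text \<open>Together with \<open>block_exp\<close> this bounds \<open>A * h ^ 3\<close> by
  \<open>block_const \<eta> v * (p + 3) ^ block_exp \<eta> * R\<close>. The third power is that of
  \<open>h\<close>, which itself contributes \<open>3 + 2 * \<gamma>\<close> powers of
  \<open>p + 3\<close>.\<close>

definition block_const :: "real \<Rightarrow> real \<Rightarrow> real" where
  "block_const \<eta> v = 72 * 4 ^ nat \<lceil>1 / \<eta>\<rceil> * (envelope_const \<eta> v)\<^sup>2 * (1410048 * (envelope_const \<eta> v)\<^sup>2) ^ 3"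

definition block_exp :: "real \<Rightarrow> nat" where "block_exp \<eta> = 3 * (3 + 2 * nat \<lceil>1 / \<eta>\<rceil>)"

text \<open>1260 = 7 * 180 comes from the crude estimate and also covers the factor 6 of the fine
  one. The cube and 64 = 4^3 come from bounding \<sigma>^2 by a third power in the crude
  case.\<close>

definition moment_const :: "real \<Rightarrow> real \<Rightarrow> real" where
  "moment_const \<eta> v = 1260 * block_const \<eta> v ^ 3 * 64 ^ block_exp \<eta>"

lemma envelope_const_ge: "1 \<le> envelope_const \<eta> v" by (simp add: envelope_const_def)

lemma one_le_mult: "1 \<le> y \<Longrightarrow> 1 \<le> z \<Longrightarrow> 1 \<le> y * (z :: real)"
  using mult_mono[of 1 y 1 z] by simp

lemma block_const_ge: "1 \<le> block_const \<eta> v"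
proof -
  have e: "1 \<le> (envelope_const \<eta> v)\<^sup>2" using envelope_const_ge by simp
  have k: "(1::real) \<le> 72 * 4 ^ nat \<lceil>1 / \<eta>\<rceil>" using one_le_power[of "4::real" "nat \<lceil>1 / \<eta>\<rceil>"] by linarith
  have "1 \<le> 72 * 4 ^ nat \<lceil>1 / \<eta>\<rceil> * (envelope_const \<eta> v)\<^sup>2"
    using mult_mono[OF k e] by simp
  moreover have "1 \<le> (1410048 * (envelope_const \<eta> v)\<^sup>2) ^ 3" using e by (intro one_le_power) linarith
  ultimately show ?thesis unfolding block_const_def by (rule one_le_mult)
qed

lemma add_three_le: "1 \<le> p \<Longrightarrow> real p + 3 \<le> 4 ^ p"
  by (induction p rule: dec_induct) auto

lemma poly_le_exp: "1 \<le> p \<Longrightarrow> (real p + 3) ^ c \<le> (4 ^ c) ^ p"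
proof -
  assume "1 \<le> p"
  then have "(real p + 3) ^ c \<le> (4 ^ p) ^ c" using add_three_le by (intro power_mono) auto
  then show ?thesis by (simp add: power_mult[symmetric] mult.commute)
qed

lemma gauss_fps_abs_le: "0 \<le> s \<Longrightarrow> \<bar>gauss_fps (s\<^sup>2 / 2) $ p\<bar> \<le> s ^ p"
proof (cases "even p")
  case True
  assume s: "0 \<le> s"
  obtain m where m: "p = 2 * m" using True by (elim evenE)
  have "gauss_fps (s\<^sup>2 / 2) $ p = (s\<^sup>2 / 2) ^ m / fact m" by (simp add: m gauss_fps_nth)
  also have "\<dots> \<le> (s\<^sup>2 / 2) ^ m / 1" by (intro divide_left_mono) (auto simp: fact_ge_1)
  also have "\<dots> \<le> (s\<^sup>2) ^ m / 1" by (intro divide_right_mono power_mono) auto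
  finally have "gauss_fps (s\<^sup>2 / 2) $ p \<le> s ^ p" by (simp add: m power_mult)
  moreover have "0 \<le> gauss_fps (s\<^sup>2 / 2) $ p" by (simp add: gauss_fps_nth)
  ultimately show ?thesis by simp
qed (simp add: gauss_fps_nth)

lemma sq_fact_le_fact: "2 * m \<le> p \<Longrightarrow> (fact m :: real)\<^sup>2 \<le> fact p"
proof -
  assume mp: "2 * m \<le> p"
  have "(fact m * fact m :: nat) dvd fact (m + m)" by (rule fact_fact_dvd_fact)
  then have "(fact m * fact m :: nat) \<le> fact (m + m)" by (intro dvd_imp_le) auto
  also have "\<dots> \<le> fact p" using mp by (intro fact_mono) auto
  finally have "real (fact m * fact m) \<le> real (fact p)" by (rule of_nat_mono)
  then show ?thesis by (simp add: power2_eq_square)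
qed

text \<open>Only the summand with \<open>u = (p - 1) div 2\<close> is kept. Its denominator is
  absorbed by one factorial, since the square of \<open>fact m\<close> is at most
  \<open>fact p\<close> for \<open>2 * m \<le> p\<close>, and
  \<open>R\<^sup>2 \<le> R * R ^ m\<close> as \<open>m\<close> is at least 1.\<close>

lemma leading_term_le:
  fixes R C \<sigma> \<eta> :: real
  assumes "3 \<le> p" "1 \<le> R" "0 \<le> C" "0 \<le> \<sigma>" "0 < \<eta>"
  shows "fact p * C ^ p * R\<^sup>2 * \<sigma> ^ (2 * ((p - 1) div 2)) \<le>
    R * C ^ p * (fact p powr (2 + 1 / \<eta>)) * (\<Sum>u = 1..(p - 1) div 2. R ^ u * \<sigma> ^ (2 * u) * real p ^ u / (fact u)\<^sup>2)"
proof -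
  define m where "m = (p - 1) div 2"
  have m: "1 \<le> m" "2 * m \<le> p" using assms(1) unfolding m_def by linarith+
  have f1: "(1::real) \<le> fact p" by (rule fact_ge_1)
  have "fact p * (R * R ^ 1 * \<sigma> ^ (2 * m)) \<le> (fact p)\<^sup>2 * (R * (R ^ m * \<sigma> ^ (2 * m) * real p ^ m / (fact m)\<^sup>2))"
  proof -
    have "fact p * (R * R ^ 1 * \<sigma> ^ (2 * m)) \<le> fact p * (R * R ^ m * \<sigma> ^ (2 * m))"
      using assms m by (intro mult_left_mono mult_right_mono power_increasing) auto
    also have "\<dots> = fact p * (R * R ^ m * \<sigma> ^ (2 * m)) * 1" by simp
    also have "\<dots> \<le> fact p * (R * R ^ m * \<sigma> ^ (2 * m)) * (fact p * real p ^ m / (fact m)\<^sup>2)"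
    proof (intro mult_left_mono)
      have "(fact m)\<^sup>2 * 1 \<le> fact p * real p ^ m"
        using sq_fact_le_fact[OF m(2)] assms(1) by (intro mult_mono) auto
      then show "1 \<le> fact p * real p ^ m / (fact m)\<^sup>2" by (simp add: le_divide_eq)
    qed (use assms in auto)
    finally show ?thesis by (simp add: power2_eq_square mult_ac)
  qed
  also have "\<dots> \<le> fact p powr (2 + 1 / \<eta>) * (R * (\<Sum>u = 1..m. R ^ u * \<sigma> ^ (2 * u) * real p ^ u / (fact u)\<^sup>2))"
  proof (intro mult_mono)
    have "(fact p :: real)\<^sup>2 = fact p powr 2" by (simp add: powr_numeral)
    also have "\<dots> \<le> fact p powr (2 + 1 / \<eta>)" using f1 assms by (intro powr_mono) auto
    finally show "(fact p :: real)\<^sup>2 \<le> fact p powr (2 + 1 / \<eta>)" .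
    show "R ^ m * \<sigma> ^ (2 * m) * real p ^ m / (fact m)\<^sup>2 \<le> (\<Sum>u = 1..m. R ^ u * \<sigma> ^ (2 * u) * real p ^ u / (fact u)\<^sup>2)"
      using m assms by (intro member_le_sum[of m "{1..m}" "\<lambda>u. R ^ u * \<sigma> ^ (2 * u) * real p ^ u / (fact u)\<^sup>2"]) auto
  qed (use assms in \<open>auto intro!: mult_nonneg_nonneg divide_nonneg_nonneg\<close>)
  finally have "C ^ p * (fact p * (R * R ^ 1 * \<sigma> ^ (2 * m))) \<le> C ^ p * (fact p powr (2 + 1 / \<eta>) * (R * (\<Sum>u = 1..m. R ^ u * \<sigma> ^ (2 * u) * real p ^ u / (fact u)\<^sup>2)))"
    using assms by (intro mult_left_mono) auto
  then show ?thesis unfolding m_def[symmetric] by (simp add: mult_ac power2_eq_square)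
qed

context array_row
begin

text \<open>\<open>row.A\<close> is quadratic in the decay constant and \<open>h ^ 3\<close> is of
  degree six. The resulting eighth power of \<open>w\<close> is \<open>W powr (1 / 4)\<close>, hence
  at most \<open>W\<close>, and the factor \<open>K\<close> is supplied by the hypothesis on
  \<open>R\<close>.\<close>

lemma block_size_le:
  fixes v R :: real and p :: nat
  assumes v: "0 < v" and R: "K * (B * exp (a powr (- v))) \<le> R" and p: "1 \<le> p"
  shows "row.A \<le> block_const \<eta> v * R"
    and "row.A * (1410048 * real p ^ 3 * (decay_const \<eta> a B * (real p + 3) ^ nat \<lceil>1 / \<eta>\<rceil>)\<^sup>2) ^ 3
      \<le> block_const \<eta> v * (real p + 3) ^ block_exp \<eta> * R"
proof -
  define W where "W = B * exp (a powr (- v))"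
  define w where "w = W powr (1 / 32)"
  define \<gamma> where "\<gamma> = nat \<lceil>1 / \<eta>\<rceil>"
  define e where "e = envelope_const \<eta> v"
  define D where "D = decay_const \<eta> a B"
  have W1: "1 \<le> W" using mult_mono[of 1 B 1 "exp (a powr (- v))"] B_ge by (simp add: W_def)
  have w1: "1 \<le> w" unfolding w_def using W1 by (simp add: ge_one_powr_ge_zero)
  have w8: "w ^ 8 \<le> W"
  proof -
    have "w ^ 8 = W powr (1 / 4)" unfolding w_def using W1 by (simp add: powr_power)
    also have "\<dots> \<le> W powr 1" using W1 by (intro powr_mono) auto
    finally show ?thesis using W1 by simp
  qed
  have e1: "1 \<le> e" by (simp add: e_def envelope_const_ge)
  have D: "D \<le> e * w" "0 \<le> D"
    using decay_const_bound[OF a_pos B_ge eta_pos v] by (auto simp: D_def e_def envelope_const_def w_def W_def decay_const_def)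
  have D2: "D\<^sup>2 \<le> e\<^sup>2 * w\<^sup>2" using power_mono[OF D, of 2] by (simp add: power_mult_distrib)
  have A_eq: "row.A = 72 * 4 ^ \<gamma> * D\<^sup>2 * K"
  proof -
    have "row.A = 72 * (D * 2 ^ \<gamma>)\<^sup>2 * K"
      using row.A_def unfolding row.\<Lambda>1_def D_def \<gamma>_def .
    moreover have "(2 ^ \<gamma>)\<^sup>2 = (4::real) ^ \<gamma>" by (simp add: power2_eq_square power_mult_distrib[symmetric])
    ultimately show ?thesis by (simp add: power_mult_distrib)
  qed
  have A_le: "row.A \<le> 72 * 4 ^ \<gamma> * (e\<^sup>2 * w\<^sup>2) * K"
    unfolding A_eq using D2 K_ge by (intro mult_right_mono mult_left_mono) auto
  define Q where "Q = 1410048 * e\<^sup>2"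
  have Q1: "1 \<le> Q" using one_le_power[OF e1, of 2] unfolding Q_def by linarith
  have KW: "K * W \<le> R" using R by (simp add: W_def)
  have C1: "block_const \<eta> v = 72 * 4 ^ \<gamma> * e\<^sup>2 * Q ^ 3" by (simp add: block_const_def e_def \<gamma>_def Q_def)
  have h: "(1410048 * real p ^ 3 * (D * (real p + 3) ^ \<gamma>)\<^sup>2) ^ 3 \<le> Q ^ 3 * w ^ 6 * (real p + 3) ^ block_exp \<eta>"
  proof -
    have "1410048 * real p ^ 3 * (D * (real p + 3) ^ \<gamma>)\<^sup>2 = 1410048 * D\<^sup>2 * (real p ^ 3 * (real p + 3) ^ (2 * \<gamma>))"
      by (simp add: power_mult_distrib power_mult[symmetric] mult.commute)
    also have "\<dots> \<le> 1410048 * (e\<^sup>2 * w\<^sup>2) * ((real p + 3) ^ 3 * (real p + 3) ^ (2 * \<gamma>))"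
      using D2 by (intro mult_mono power_mono) auto
    also have "\<dots> = Q * w\<^sup>2 * (real p + 3) ^ (3 + 2 * \<gamma>)" by (simp add: Q_def power_add)
    finally have "(1410048 * real p ^ 3 * (D * (real p + 3) ^ \<gamma>)\<^sup>2) ^ 3 \<le> (Q * w\<^sup>2 * (real p + 3) ^ (3 + 2 * \<gamma>)) ^ 3"
      by (intro power_mono) auto
    also have "\<dots> = Q ^ 3 * w ^ 6 * (real p + 3) ^ block_exp \<eta>"
      by (simp add: power_mult_distrib power_mult[symmetric] block_exp_def \<gamma>_def mult.commute)
    finally show ?thesis .
  qed
  have e0: "0 \<le> e\<^sup>2" "0 \<le> Q ^ 3" using Q1 by auto
  have C0: "0 \<le> 72 * 4 ^ \<gamma> * e\<^sup>2 * Q ^ 3" using e0 by simp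
  show "row.A \<le> block_const \<eta> v * R"
  proof -
    note A_le
    also have "72 * 4 ^ \<gamma> * (e\<^sup>2 * w\<^sup>2) * K = 72 * 4 ^ \<gamma> * e\<^sup>2 * 1 * (K * w\<^sup>2)" by simp
    also have "\<dots> \<le> 72 * 4 ^ \<gamma> * e\<^sup>2 * Q ^ 3 * (K * W)"
    proof (intro mult_mono)
      show "1 \<le> Q ^ 3" using Q1 by simp
      have "w\<^sup>2 \<le> w ^ 8" using w1 by (intro power_increasing) auto
      then show "w\<^sup>2 \<le> W" using w8 by simp
    qed (use K_ge W1 e0 in auto)
    also have "\<dots> \<le> 72 * 4 ^ \<gamma> * e\<^sup>2 * Q ^ 3 * R" using KW C0 by (intro mult_left_mono) auto
    finally show ?thesis by (simp add: C1)
  qed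
  show "row.A * (1410048 * real p ^ 3 * (decay_const \<eta> a B * (real p + 3) ^ nat \<lceil>1 / \<eta>\<rceil>)\<^sup>2) ^ 3
      \<le> block_const \<eta> v * (real p + 3) ^ block_exp \<eta> * R"
  proof -
    have "row.A * (1410048 * real p ^ 3 * (D * (real p + 3) ^ \<gamma>)\<^sup>2) ^ 3
      \<le> (72 * 4 ^ \<gamma> * (e\<^sup>2 * w\<^sup>2) * K) * (Q ^ 3 * w ^ 6 * (real p + 3) ^ block_exp \<eta>)"
      using A_le h K_ge by (intro mult_mono) auto
    also have "\<dots> = 72 * 4 ^ \<gamma> * e\<^sup>2 * Q ^ 3 * (real p + 3) ^ block_exp \<eta> * (K * (w\<^sup>2 * w ^ 6))" by simp
    also have "w\<^sup>2 * w ^ 6 = w ^ 8" by (simp flip: power_add)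
    also have "72 * 4 ^ \<gamma> * e\<^sup>2 * Q ^ 3 * (real p + 3) ^ block_exp \<eta> * (K * w ^ 8)
      \<le> 72 * 4 ^ \<gamma> * e\<^sup>2 * Q ^ 3 * (real p + 3) ^ block_exp \<eta> * (K * W)"
      using w8 K_ge C0 by (intro mult_left_mono) auto
    also have "\<dots> \<le> 72 * 4 ^ \<gamma> * e\<^sup>2 * Q ^ 3 * (real p + 3) ^ block_exp \<eta> * R"
      using KW C0 by (intro mult_left_mono) auto
    finally show ?thesis by (simp add: C1 D_def \<gamma>_def)
  qed
qed

text \<open>If \<sigma> exceeds \<open>C * P * R\<close>, where \<open>P\<close> is a fixed power of
  \<open>p + 3\<close>, the Gaussian comparison applies. Otherwise
  \<open>R ^ 3 \<le> \<sigma>\<close> makes \<sigma>^2 at most exponential in \<open>p\<close>, and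
  the crude moment differs from the claim by at most two powers of \<sigma>.\<close>

lemma moment_comparison_large:
  fixes v R :: real and p :: nat
  assumes v: "0 < v" and R: "K * (B * exp (a powr (- v))) \<le> R" and p: "3 \<le> p"
    and R3: "R ^ 3 \<le> row_sd M \<xi> n" and RC: "block_const \<eta> v * R \<le> row_sd M \<xi> n" and R1: "1 \<le> R"
  shows "\<bar>expectation (\<lambda>\<omega>. row_sum \<xi> n \<omega> ^ p) - fact p * gauss_fps ((row_sd M \<xi> n)\<^sup>2 / 2) $ p\<bar>
    \<le> fact p * moment_const \<eta> v ^ p * R\<^sup>2 * row_sd M \<xi> n ^ (2 * ((p - 1) div 2))"
proof -
  define \<sigma> where "\<sigma> = row_sd M \<xi> n"
  define C where "C = block_const \<eta> v"
  define c where "c = block_exp \<eta>"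
  define m where "m = 2 * ((p - 1) div 2)"
  define P where "P = (real p + 3) ^ c"
  have m: "m \<le> p" "p - m \<le> 2" using p unfolding m_def by linarith+
  have C1: "1 \<le> C" by (simp add: C_def block_const_ge)
  have P1: "1 \<le> P" unfolding P_def by simp
  have Pe: "P \<le> (4 ^ c) ^ p" unfolding P_def using p by (intro poly_le_exp) auto
  have s_row: "\<sigma> = row.\<sigma>" by (simp add: \<sigma>_def row_sd_eq)
  have s1: "1 \<le> \<sigma>" using RC C1 R1 mult_mono[of 1 C 1 R] unfolding \<sigma>_def C_def by simp
  have ES: "expectation (\<lambda>\<omega>. row_sum \<xi> n \<omega> ^ p) = expectation (\<lambda>\<omega>. row.S 0 n \<omega> ^ p)"
    by (rule row_sum_expectation[where f="\<lambda>y. y ^ p"]) measurable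
  have Cp: "C ^ k \<le> (C ^ k) ^ p" "1 \<le> C ^ k" for k using C1 p by (auto intro!: self_le_power)
  have "\<bar>expectation (\<lambda>\<omega>. row.S 0 n \<omega> ^ p) - fact p * gauss_fps (\<sigma>\<^sup>2 / 2) $ p\<bar> \<le> fact p * moment_const \<eta> v ^ p * R\<^sup>2 * \<sigma> ^ m"
  proof (cases "C * P * R \<le> \<sigma>")
    case True
    define h where "h = 1410048 * real p ^ 3 * (decay_const \<eta> a B * (real p + 3) ^ nat \<lceil>1 / \<eta>\<rceil>)\<^sup>2"
    have Ah: "row.A * h ^ 3 \<le> C * P * R"
      using block_size_le(2)[OF v R, of p] p unfolding h_def C_def P_def c_def by auto
    have A0: "0 \<le> row.A" using row.A_ge by simp
    have h0: "0 \<le> h" unfolding h_def by simp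
    have sq: "(row.A * h ^ 3)\<^sup>2 \<le> (C * P * R)\<^sup>2" using A0 h0 by (intro power_mono[OF Ah]) auto
    have "\<bar>expectation (\<lambda>\<omega>. row.S 0 n \<omega> ^ p) / fact p - gauss_fps (\<sigma>\<^sup>2 / 2) $ p\<bar>
      \<le> real p * 3 ^ p * (row.A)\<^sup>2 * h ^ 6 * \<sigma> ^ m"
      using row.fine_moment[OF p] Ah True unfolding h_def[symmetric] s_row m_def by auto
    also have "\<dots> = real p * 3 ^ p * (row.A * h ^ 3)\<^sup>2 * \<sigma> ^ m"
      by (simp add: power_mult_distrib power_mult[symmetric])
    also have "\<dots> \<le> 2 ^ p * 3 ^ p * (C * P * R)\<^sup>2 * \<sigma> ^ m"
    proof (intro mult_right_mono mult_mono[OF _ sq])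
      show "real p \<le> 2 ^ p" using of_nat_less_two_power[of p, where 'a=real] by simp
    qed (use s1 in auto)
    also have "\<dots> \<le> 2 ^ p * 3 ^ p * ((C ^ 3) ^ p * (64 ^ c) ^ p * R\<^sup>2) * \<sigma> ^ m"
    proof (intro mult_right_mono mult_left_mono)
      have "P\<^sup>2 \<le> P ^ 3" using P1 by (intro power_increasing) auto
      also have "\<dots> \<le> ((4 ^ c) ^ p) ^ 3" using Pe P1 by (intro power_mono) auto
      also have "\<dots> = ((4 ^ 3) ^ c) ^ p" by (simp only: power_mult[symmetric] mult_ac)
      finally have P2: "P\<^sup>2 \<le> (64 ^ c) ^ p" by simp
      have "C\<^sup>2 \<le> C ^ 3" using C1 by (intro power_increasing) auto
      also have "\<dots> \<le> (C ^ 3) ^ p" by (rule Cp)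
      finally have C2: "C\<^sup>2 \<le> (C ^ 3) ^ p" .
      show "(C * P * R)\<^sup>2 \<le> (C ^ 3) ^ p * (64 ^ c) ^ p * R\<^sup>2"
        unfolding power_mult_distrib using C2 P2 C1 by (intro mult_right_mono mult_mono) auto
    qed (use s1 in auto)
    also have "\<dots> = (6 * C ^ 3 * 64 ^ c) ^ p * R\<^sup>2 * \<sigma> ^ m"
      proof -
      have "(2::real) ^ p * 3 ^ p = 6 ^ p" by (simp flip: power_mult_distrib)
      then show ?thesis unfolding power_mult_distrib[of _ _ p] by (simp add: mult_ac)
    qed
    also have "\<dots> \<le> moment_const \<eta> v ^ p * R\<^sup>2 * \<sigma> ^ m"
      using C1 s1 unfolding moment_const_def C_def c_def by (intro mult_right_mono power_mono) auto
    finally have "fact p * \<bar>expectation (\<lambda>\<omega>. row.S 0 n \<omega> ^ p) / fact p - gauss_fps (\<sigma>\<^sup>2 / 2) $ p\<bar> \<le> fact p * (moment_const \<eta> v ^ p * R\<^sup>2 * \<sigma> ^ m)"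
      by (intro mult_left_mono) auto
    moreover have "fact p * \<bar>expectation (\<lambda>\<omega>. row.S 0 n \<omega> ^ p) / fact p - gauss_fps (\<sigma>\<^sup>2 / 2) $ p\<bar>
      = \<bar>expectation (\<lambda>\<omega>. row.S 0 n \<omega> ^ p) - fact p * gauss_fps (\<sigma>\<^sup>2 / 2) $ p\<bar>"
    proof -
      have "expectation (\<lambda>\<omega>. row.S 0 n \<omega> ^ p) - fact p * gauss_fps (\<sigma>\<^sup>2 / 2) $ p
        = fact p * (expectation (\<lambda>\<omega>. row.S 0 n \<omega> ^ p) / fact p - gauss_fps (\<sigma>\<^sup>2 / 2) $ p)"
        by (simp add: right_diff_distrib)
      then show ?thesis by (simp only: abs_mult abs_of_pos[OF fact_gt_zero])
    qed
    ultimately show ?thesis by (simp add: mult_ac)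
  next
    case False
    have "\<sigma> ^ 3 \<le> (C * P * R) ^ 3" using False s1 by (intro power_mono) auto
    also have "\<dots> = (C * P) ^ 3 * R ^ 3" by (simp add: power_mult_distrib)
    also have "\<dots> \<le> (C * P) ^ 3 * \<sigma>" using R3 C1 P1 by (intro mult_left_mono) (auto simp: \<sigma>_def)
    \<comment> \<open>One factor \<sigma> cancels; this is where the exponent 1/3 in the smallness
      of \<open>R\<close> is used.\<close>
    finally have "\<sigma>\<^sup>2 * \<sigma> \<le> (C * P) ^ 3 * \<sigma>" by (simp add: power3_eq_cube power2_eq_square)
    then have "\<sigma>\<^sup>2 \<le> (C * P) ^ 3" using s1 by simp
    also have "\<dots> = C ^ 3 * P ^ 3" by (simp add: power_mult_distrib)
    also have "\<dots> \<le> (C ^ 3) ^ p * (64 ^ c) ^ p"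
    proof (intro mult_mono Cp)
      have "P ^ 3 \<le> ((4 ^ c) ^ p) ^ 3" using Pe P1 by (intro power_mono) auto
      also have "\<dots> = ((4 ^ 3) ^ c) ^ p" by (simp only: power_mult[symmetric] mult_ac)
      finally show "P ^ 3 \<le> (64 ^ c) ^ p" by simp
    qed (use C1 P1 in auto)
    finally have s2: "\<sigma>\<^sup>2 \<le> (C ^ 3) ^ p * (64 ^ c) ^ p" .
    have "row.A \<le> row.\<sigma>"
      using block_size_le(1)[OF v R, of p] p RC by (simp add: row_sd_eq)
    then have "expectation (\<lambda>\<omega>. \<bar>row.S 0 n \<omega>\<bar> ^ p) \<le> 6 * fact p * (180 * \<sigma>) ^ p"
      unfolding s_row by (rule row.crude_moment)
    moreover have "\<bar>expectation (\<lambda>\<omega>. row.S 0 n \<omega> ^ p)\<bar> \<le> expectation (\<lambda>\<omega>. \<bar>row.S 0 n \<omega>\<bar> ^ p)"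
      using integral_abs_bound[of M "\<lambda>\<omega>. row.S 0 n \<omega> ^ p"] by (simp add: power_abs)
    moreover have "\<bar>fact p * gauss_fps (\<sigma>\<^sup>2 / 2) $ p\<bar> \<le> fact p * \<sigma> ^ p"
      unfolding abs_mult using gauss_fps_abs_le[of \<sigma> p] s1 by (auto intro!: mult_left_mono)
    ultimately have "\<bar>expectation (\<lambda>\<omega>. row.S 0 n \<omega> ^ p) - fact p * gauss_fps (\<sigma>\<^sup>2 / 2) $ p\<bar>
       \<le> 6 * fact p * (180 * \<sigma>) ^ p + fact p * \<sigma> ^ p" by linarith
    also have "\<dots> = fact p * \<sigma> ^ p * (6 * 180 ^ p + 1)" by (simp add: power_mult_distrib algebra_simps)
    also have "\<dots> \<le> fact p * \<sigma> ^ p * 1260 ^ p"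
    proof (intro mult_left_mono)
      have "6 * 180 ^ p + 1 \<le> (7::real) * 180 ^ p" using one_le_power[of "180::real" p] by simp
      also have "\<dots> \<le> 7 ^ p * 180 ^ p" using p by (intro mult_right_mono self_le_power) auto
      also have "\<dots> = (7 * 180) ^ p" by (simp only: power_mult_distrib)
      finally show "6 * 180 ^ p + 1 \<le> (1260::real) ^ p" by simp
    qed (use s1 in auto)
    also have "\<dots> \<le> fact p * ((C ^ 3) ^ p * (64 ^ c) ^ p * R\<^sup>2 * \<sigma> ^ m) * 1260 ^ p"
    proof (intro mult_right_mono mult_left_mono)
      have "\<sigma> ^ p = \<sigma> ^ (p - m) * \<sigma> ^ m" using m by (simp flip: power_add)
      also have "\<dots> \<le> \<sigma>\<^sup>2 * \<sigma> ^ m" using m s1 by (intro mult_right_mono power_increasing) auto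
      also have "\<dots> \<le> ((C ^ 3) ^ p * (64 ^ c) ^ p * 1) * \<sigma> ^ m" using s2 s1 by (intro mult_right_mono) auto
      also have "\<dots> \<le> ((C ^ 3) ^ p * (64 ^ c) ^ p * R\<^sup>2) * \<sigma> ^ m"
        using R1 s1 C1 by (intro mult_right_mono mult_left_mono) auto
      finally show "\<sigma> ^ p \<le> (C ^ 3) ^ p * (64 ^ c) ^ p * R\<^sup>2 * \<sigma> ^ m" .
    qed auto
    also have "\<dots> = fact p * moment_const \<eta> v ^ p * R\<^sup>2 * \<sigma> ^ m"
      unfolding moment_const_def C_def[symmetric] c_def[symmetric] power_mult_distrib[of _ _ p] by (simp add: mult_ac)
    finally show ?thesis .
  qed
  then show ?thesis unfolding ES m_def \<sigma>_def .
qed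

text \<open>For the finitely many rows before the asymptotic regime any constant will do, as long as
  it serves all \<open>p\<close> at once; it may depend on the row through \<open>n\<close>,
  \<open>K\<close> and \<sigma>.\<close>

lemma moment_comparison_fixed:
  fixes R :: real
  assumes R1: "1 \<le> R"
  shows "\<exists>C\<ge>0. \<forall>p\<ge>3. \<bar>expectation (\<lambda>\<omega>. row_sum \<xi> n \<omega> ^ p) - fact p * gauss_fps ((row_sd M \<xi> n)\<^sup>2 / 2) $ p\<bar>
    \<le> fact p * C ^ p * R\<^sup>2 * row_sd M \<xi> n ^ (2 * ((p - 1) div 2))"
proof -
  define \<sigma> where "\<sigma> = row_sd M \<xi> n"
  have s0: "0 \<le> \<sigma>" using row_sd_sq by (simp add: \<sigma>_def)
  have Rsq: "1 \<le> R\<^sup>2" using R1 by simp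
  show ?thesis
  proof (cases "\<sigma> = 0")
    \<comment> \<open>A row of variance zero vanishes almost surely, and so do the Gaussian
      coefficients of positive order.\<close>
    case True
    have sqI: "integrable M (\<lambda>\<omega>. (row.S 0 n \<omega>)\<^sup>2)" by (rule row.S_power_integrable) simp
    have "expectation (\<lambda>\<omega>. (row.S 0 n \<omega>)\<^sup>2) = 0"
      using True row_sd_sq(1) row_sum_expectation[where f="\<lambda>y. y\<^sup>2"] by (simp add: \<sigma>_def)
    then have "AE \<omega> in M. (row.S 0 n \<omega>)\<^sup>2 = 0"
      using integral_nonneg_eq_0_iff_AE[OF sqI] by simp
    then have "AE \<omega> in M. row_sum \<xi> n \<omega> = 0" using row_sum_eq_S by eventually_elim simp
    then have "expectation (\<lambda>\<omega>. row_sum \<xi> n \<omega> ^ p) = 0" if "3 \<le> p" for p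
      using that by (intro integral_eq_zero_AE) (auto elim!: eventually_mono)
    moreover have "gauss_fps (0\<^sup>2 / 2) $ p = 0" if "3 \<le> p" for p
      using gauss_fps_abs_le[of 0 p] that by (simp add: power_0_left)
    ultimately show ?thesis using True unfolding \<sigma>_def[symmetric] by (intro exI[of _ 0]) simp
  next
    case False
    then have sp: "0 < \<sigma>" using s0 by simp
    define D where "D = real n * K / \<sigma>"
    have D0: "0 \<le> D" using K_ge sp by (simp add: D_def)
    \<comment> \<open>\<open>D + 1\<close> covers the moment and its Gaussian value,
      \<open>(1 + \<sigma>)\<^sup>2\<close> the at most two missing powers of \<sigma>.\<close>
    define C where "C = (D + 1) * (1 + \<sigma>)\<^sup>2"
    have "\<bar>expectation (\<lambda>\<omega>. row_sum \<xi> n \<omega> ^ p) - fact p * gauss_fps (\<sigma>\<^sup>2 / 2) $ p\<bar> \<le> fact p * C ^ p * R\<^sup>2 * \<sigma> ^ (2 * ((p - 1) div 2))"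
      if p: "3 \<le> p" for p
    proof -
      define m where "m = 2 * ((p - 1) div 2)"
      have m: "m \<le> p" "p - m \<le> 2" using p unfolding m_def by linarith+
      have "expectation (\<lambda>\<omega>. row_sum \<xi> n \<omega> ^ p) = expectation (\<lambda>\<omega>. row.S 0 n \<omega> ^ p)"
        by (rule row_sum_expectation[where f="\<lambda>y. y ^ p"]) measurable
      also have "\<bar>\<dots>\<bar> \<le> (real n * K) ^ p"
        using row.S_bound[of n _ 0] by (intro abs_expectation_le) (auto simp: power_abs intro!: power_mono)
      also have "\<dots> = D ^ p * \<sigma> ^ p" unfolding power_mult_distrib[symmetric] using sp by (simp add: D_def)
      finally have 1: "\<bar>expectation (\<lambda>\<omega>. row_sum \<xi> n \<omega> ^ p)\<bar> \<le> D ^ p * \<sigma> ^ p" .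
      have 2: "\<bar>fact p * gauss_fps (\<sigma>\<^sup>2 / 2) $ p\<bar> \<le> fact p * \<sigma> ^ p"
        unfolding abs_mult using gauss_fps_abs_le[of \<sigma> p] s0 by (auto intro!: mult_left_mono)
      have 3: "D ^ p * \<sigma> ^ p \<le> fact p * (D ^ p * \<sigma> ^ p)"
        using D0 s0 mult_right_mono[OF fact_ge_1[of p], of "D ^ p * \<sigma> ^ p"] by simp
      have "\<bar>expectation (\<lambda>\<omega>. row_sum \<xi> n \<omega> ^ p) - fact p * gauss_fps (\<sigma>\<^sup>2 / 2) $ p\<bar> \<le> fact p * (D ^ p * \<sigma> ^ p) + fact p * \<sigma> ^ p"
        using 1 2 3 by linarith
      also have "\<dots> = fact p * (D ^ p + 1 ^ p) * \<sigma> ^ p" by (simp add: algebra_simps)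
      also have "\<dots> \<le> fact p * (D + 1) ^ p * \<sigma> ^ p"
      proof (intro mult_right_mono mult_left_mono)
        obtain k where k: "p = Suc k" using p by (cases p) auto
        have "D ^ p + 1 ^ p = D * D ^ k + 1" by (simp add: k)
        also have "\<dots> \<le> D * (D + 1) ^ k + (D + 1) ^ k"
          using D0 by (intro add_mono mult_left_mono power_mono) auto
        also have "\<dots> = (D + 1) ^ p" by (simp add: k algebra_simps)
        finally show "D ^ p + 1 ^ p \<le> (D + 1) ^ p" .
      qed (use s0 in auto)
      also have "\<sigma> ^ p \<le> ((1 + \<sigma>)\<^sup>2) ^ p * \<sigma> ^ m"
      proof -
        have "\<sigma> ^ p = \<sigma> ^ (p - m) * \<sigma> ^ m" using m by (simp flip: power_add)
        also have "\<dots> \<le> (1 + \<sigma>) ^ (p - m) * \<sigma> ^ m" using s0 by (intro mult_right_mono power_mono) auto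
        also have "\<dots> \<le> (1 + \<sigma>) ^ (2 * p) * \<sigma> ^ m" using s0 m p by (intro mult_right_mono power_increasing) auto
        finally show ?thesis by (simp add: power_mult)
      qed
      also have "fact p * (D + 1) ^ p * (((1 + \<sigma>)\<^sup>2) ^ p * \<sigma> ^ m) = fact p * C ^ p * 1 * \<sigma> ^ m"
        unfolding C_def power_mult_distrib[of "D + 1"] by (simp add: mult_ac)
      also have "\<dots> \<le> fact p * C ^ p * R\<^sup>2 * \<sigma> ^ m"
        using Rsq D0 s0 by (intro mult_right_mono mult_left_mono) (auto simp: C_def)
      finally show ?thesis using D0 by (simp add: m_def)
    qed
    then show ?thesis unfolding \<sigma>_def[symmetric] using D0 by (intro exI[of _ C]) (auto simp: C_def)
  qed
qed

end

section \<open>The array\<close>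

definition moment_bound :: "(nat \<Rightarrow> real) \<Rightarrow> (nat \<Rightarrow> real) \<Rightarrow> real \<Rightarrow> real \<Rightarrow> nat \<Rightarrow> nat \<Rightarrow> real" where
  "moment_bound R \<sigma> \<eta> C p n = R n * C ^ p * (fact p powr (2 + 1 / \<eta>)) *
     (\<Sum>u = 1..(p - 1) div 2. R n ^ u * \<sigma> n ^ (2 * u) * real p ^ u / (fact u)\<^sup>2)"

lemma K_norm_nonneg: "1 \<le> n \<Longrightarrow> 0 \<le> K_norm M \<xi> r n"
proof -
  assume n: "1 \<le> n"
  have "0 \<le> Lp_norm M r (\<xi> n 1)" by (simp add: Lp_norm_def)
  also have "\<dots> \<le> K_norm M \<xi> r n" unfolding K_norm_def using n by (intro Max_ge) auto
  finally show ?thesis .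
qed

lemma (in array_row) K_norm_le_K_inf: "0 < r \<Longrightarrow> K_norm M \<xi> r n \<le> K_inf M \<xi> n"
proof -
  assume r: "0 < r"
  have "Lp_norm M r (\<xi> n j) \<le> K_inf M \<xi> n" if j: "1 \<le> j" "j \<le> n" for j
  proof -
    have ae: "AE \<omega> in M. \<bar>\<xi> n j \<omega>\<bar> powr r \<le> K_inf M \<xi> n powr r"
      using K_inf_bound[OF j] by (rule eventually_mono) (use r in \<open>auto intro: powr_mono2\<close>)
    have rv: "(\<lambda>\<omega>. \<bar>\<xi> n j \<omega>\<bar> powr r) \<in> borel_measurable M" using xi_rv[OF j] by measurable
    have "integrable M (\<lambda>\<omega>. \<bar>\<xi> n j \<omega>\<bar> powr r)"
      using ae by (intro integrable_const_bound[OF _ rv, of "K_inf M \<xi> n powr r"]) simp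
    then have "(\<integral>\<omega>. \<bar>\<xi> n j \<omega>\<bar> powr r \<partial>M) \<le> (\<integral>\<omega>. K_inf M \<xi> n powr r \<partial>M)"
      using ae by (intro integral_mono_AE) auto
    then have "(\<integral>\<omega>. \<bar>\<xi> n j \<omega>\<bar> powr r \<partial>M) \<le> K_inf M \<xi> n powr r" by (simp add: prob_space)
    then have "Lp_norm M r (\<xi> n j) \<le> (K_inf M \<xi> n powr r) powr (1 / r)"
      unfolding Lp_norm_def using r by (intro powr_mono2 integral_nonneg) auto
    then show ?thesis using r K_inf_nonneg by (simp add: powr_powr)
  qed
  then show ?thesis unfolding K_norm_def using n_pos by (intro Max.boundedI) auto
qed

text \<open>\<open>A_row\<close> is at least 1 because \<open>r_row\<close> is, and a positive gap
  \<open>j n\<close> leaves at least \<open>K_inf + 1\<close> in the middle factor.\<close>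

lemma R_row_ge:
  assumes "array_row M N \<zeta> g \<xi> n (a n) (B n) \<eta>" "1 \<le> j n"
  shows "(K_inf M \<xi> n + 1) * (B n * exp (a n powr (- v))) \<le> R_row M N \<zeta> \<xi> p0 q0 v a B j n"
    and "1 \<le> R_row M N \<zeta> \<xi> p0 q0 v a B j n"
proof -
  interpret array_row M N \<zeta> g \<xi> n "a n" "B n" \<eta> by fact
  define W where "W = B n * exp (a n powr (- v))"
  have W1: "1 \<le> W" unfolding W_def using B_ge by (intro one_le_mult) auto
  have A1: "1 \<le> A_row M N \<zeta> \<xi> p0 q0 n"
    unfolding A_row_def r_row_def using K_norm_nonneg[OF n_pos, of M \<xi> 2]
    by (intro one_le_mult) auto
  have Kj: "K_inf M \<xi> n + 1 \<le> K_inf M \<xi> n * real (j n) + 1"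
    using assms(2) K_inf_nonneg mult_left_mono[of 1 "real (j n)" "K_inf M \<xi> n"] by simp
  have "1 * (K_inf M \<xi> n + 1) * W \<le> A_row M N \<zeta> \<xi> p0 q0 n * (K_inf M \<xi> n * real (j n) + 1) * W"
    using A1 Kj W1 K_inf_nonneg by (intro mult_mono) auto
  then show 1: "(K_inf M \<xi> n + 1) * (B n * exp (a n powr (- v))) \<le> R_row M N \<zeta> \<xi> p0 q0 v a B j n"
    by (simp add: R_row_def W_def mult.assoc)
  have "1 \<le> (K_inf M \<xi> n + 1) * W" using K_inf_nonneg W1 by (intro one_le_mult) auto
  then show "1 \<le> R_row M N \<zeta> \<xi> p0 q0 v a B j n" using 1 by (simp add: W_def)
qed

text \<open>The whole space belongs to both families, so the suprema range over nonempty sets; an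
  \<alpha> term is a \<phi> term multiplied by a probability.\<close>

lemma coeff_bounds:
  assumes "prob_space M" "G \<subseteq> sets M" "H \<subseteq> sets M" "space M \<in> G" "space M \<in> H"
  shows "phi_coeff M G H \<le> 1" "0 \<le> alpha_coeff M G H" "alpha_coeff M G H \<le> phi_coeff M G H"
proof -
  interpret prob_space M by fact
  let ?S = "{\<bar>prob (A \<inter> B) / prob A - prob B\<bar> | A B. A \<in> G \<and> B \<in> H \<and> prob A > 0}"
  let ?T = "{\<bar>prob (A \<inter> B) - prob A * prob B\<bar> | A B. A \<in> G \<and> B \<in> H}"
  have "\<bar>prob (space M \<inter> space M) / prob (space M) - prob (space M)\<bar> \<in> ?S"
    using assms by (auto simp: prob_space intro!: exI[of _ "space M"])
  then have Sne: "?S \<noteq> {}" by blast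
  have Tel: "\<bar>prob (space M \<inter> space M) - prob (space M) * prob (space M)\<bar> \<in> ?T" using assms by blast
  have up: "\<bar>prob (A \<inter> B) - prob A * prob B\<bar> \<le> phi_coeff M G H * prob A" if "A \<in> G" "B \<in> H" for A B
    using that assms by (intro phi_coeff_upper) auto
  have phi0: "0 \<le> phi_coeff M G H" using up[OF assms(4,5)] by (simp add: prob_space)
  have T_le: "y \<le> phi_coeff M G H" if yT: "y \<in> ?T" for y
  proof -
    obtain A B where AB: "y = \<bar>prob (A \<inter> B) - prob A * prob B\<bar>" "A \<in> G" "B \<in> H" using yT by blast
    have "y \<le> phi_coeff M G H * prob A" using up AB by simp
    also have "\<dots> \<le> phi_coeff M G H * 1" using phi0 by (intro mult_left_mono) auto
    finally show ?thesis by simp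
  qed
  show "phi_coeff M G H \<le> 1"
    unfolding phi_coeff_def
  proof (rule cSup_least[OF Sne])
    fix y assume "y \<in> ?S"
    then obtain A B where AB: "y = \<bar>prob (A \<inter> B) / prob A - prob B\<bar>" "A \<in> G" "B \<in> H" "prob A > 0" by blast
    have "prob (A \<inter> B) \<le> prob A" using AB assms by (intro finite_measure_mono) auto
    then have "prob (A \<inter> B) / prob A \<le> 1" "0 \<le> prob (A \<inter> B) / prob A" using AB by auto
    moreover have "0 \<le> prob B" "prob B \<le> 1" by auto
    ultimately show "y \<le> 1" unfolding AB(1) by linarith
  qed
  show "alpha_coeff M G H \<le> phi_coeff M G H"
    unfolding alpha_coeff_def using Tel T_le by (intro cSup_least) blast+
  have "bdd_above ?T" using T_le by (intro bdd_aboveI) blast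
  then have "\<bar>prob (space M \<inter> space M) - prob (space M) * prob (space M)\<bar> \<le> alpha_coeff M G H"
    unfolding alpha_coeff_def by (intro cSup_upper Tel)
  then show "0 \<le> alpha_coeff M G H" by (simp add: prob_space)
qed

text \<open>Comparison with 1/j^2 makes the series converge, so one starting index \<open>m\<close>
  serves all finite sums, uniformly in \<open>n\<close>.\<close>

lemma stretched_exp_tail:
  fixes A a \<eta> \<delta> y :: real
  assumes A: "0 < A" and a: "0 < a" and \<eta>: "0 < \<eta>" and \<delta>: "0 < \<delta>" and y: "0 < y"
  obtains m where "1 \<le> m" "\<And>n. (\<Sum>j = m..n. (A * exp (- a * real j powr \<eta>)) powr \<delta>) \<le> y"
proof -
  define t where "t j = (A * exp (- a * real j powr \<eta>)) powr \<delta>" for j :: nat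
  define N where "N = 2 / \<eta>"
  define c where "c = A powr \<delta> * (N / (\<delta> * a)) powr N"
  have N0: "0 < N" using \<eta> by (simp add: N_def)
  have t_le: "norm (t j) \<le> c * inverse (real j ^ 2)" if j: "1 \<le> j" for j
  proof -
    define z where "z = \<delta> * a * real j powr \<eta>"
    have z: "0 < z" using \<delta> a j by (simp add: z_def)
    have "t j = A powr \<delta> * exp (- z)"
      unfolding t_def z_def using A by (subst powr_mult) (auto simp: powr_def mult_ac)
    also have "\<dots> \<le> A powr \<delta> * (N / z) powr N"
    proof (intro mult_left_mono)
      have "(z / N) powr N \<le> exp z" using z N0 by (intro exp_ge_powr) auto
      moreover have "0 < (z / N) powr N" using z N0 by simp
      ultimately have "inverse (exp z) \<le> inverse ((z / N) powr N)" by (rule le_imp_inverse_le)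
      also have "\<dots> = (N / z) powr N" using z N0 by (simp add: powr_divide)
      finally show "exp (- z) \<le> (N / z) powr N" by (simp add: exp_minus)
    qed simp
    also have "(N / z) powr N = (N / (\<delta> * a)) powr N * inverse (real j ^ 2)"
    proof -
      have "N / z = N / (\<delta> * a) * real j powr (- \<eta>)" by (simp add: z_def powr_minus divide_inverse)
      then have "(N / z) powr N = (N / (\<delta> * a)) powr N * (real j powr (- \<eta>)) powr N" by (simp only: powr_mult)
      also have "(real j powr (- \<eta>)) powr N = real j powr (- 2)" using \<eta> by (simp add: powr_powr N_def)
      also have "\<dots> = inverse (real j ^ 2)" using j by (simp add: powr_minus powr_numeral)
      finally show ?thesis .
    qed
    finally show ?thesis by (simp add: t_def c_def mult.assoc)
  qed
  have "summable t"
  proof (rule summable_comparison_test)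
    show "\<exists>N. \<forall>n\<ge>N. norm (t n) \<le> c * inverse (real n ^ 2)" using t_le by blast
    show "summable (\<lambda>n. c * inverse (real n ^ 2))" by (intro summable_mult inverse_power_summable) auto
  qed
  then obtain m where m: "\<And>k. m \<le> k \<Longrightarrow> norm (\<Sum>i. t (i + k)) < y"
    using suminf_exist_split[OF y] by blast
  have "(\<Sum>j = m + 1..n. t j) \<le> y" for n
  proof -
    have t0: "0 \<le> t j" for j by (simp add: t_def)
    have "(\<Sum>j = m + 1..n. t j) = (\<Sum>i<n - m. t (i + (m + 1)))"
      by (rule sum.reindex_bij_witness[of _ "\<lambda>i. i + (m + 1)" "\<lambda>j. j - (m + 1)"]) auto
    also have "\<dots> \<le> (\<Sum>i. t (i + (m + 1)))"
      using t0 summable_ignore_initial_segment[OF \<open>summable t\<close>, of "m + 1"] by (intro sum_le_suminf) auto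
    also have "\<dots> \<le> y" using m[of "m + 1"] by simp
    finally show ?thesis .
  qed
  then show thesis using that[of "m + 1"] by (auto simp: t_def)
qed

section \<open>The whole array: moment estimate and convergence\<close>

locale mixing_array =
  fixes M :: "'a measure" and N :: "nat \<Rightarrow> nat \<Rightarrow> 'b measure" and \<zeta> :: "nat \<Rightarrow> nat \<Rightarrow> 'a \<Rightarrow> 'b"
    and g :: "nat \<Rightarrow> nat \<Rightarrow> 'b \<Rightarrow> real" and \<xi> :: "nat \<Rightarrow> nat \<Rightarrow> 'a \<Rightarrow> real"
    and p0 q0 :: real and Q :: "'c measure" and Z :: "'c \<Rightarrow> real"
  assumes prob_M: "prob_space M"
    and zeta_measurable: "\<And>n j. 1 \<le> j \<Longrightarrow> j \<le> n \<Longrightarrow> \<zeta> n j \<in> measurable M (N n j)"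
    and g_measurable: "\<And>n j. 1 \<le> j \<Longrightarrow> j \<le> n \<Longrightarrow> g n j \<in> borel_measurable (N n j)"
    and xi_eq: "\<xi> = (\<lambda>n j \<omega>. g n j (\<zeta> n j \<omega>))"
    and bounded: "\<And>n j. 1 \<le> j \<Longrightarrow> j \<le> n \<Longrightarrow> \<exists>c. AE \<omega> in M. \<bar>\<xi> n j \<omega>\<bar> \<le> c"
    and centered: "\<And>n j. 1 \<le> j \<Longrightarrow> j \<le> n \<Longrightarrow> (\<integral>\<omega>. \<xi> n j \<omega> \<partial>M) = 0"
    and sigma_infinity: "filterlim (row_sd M \<xi>) at_top sequentially"
    and exponents: "2 < p0" "p0 < q0"
    and prob_Q: "prob_space Q"
    and Z_normal: "distributed Q lborel Z std_normal_density"
begin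

abbreviation S where "S \<equiv> row_sum \<xi>"
abbreviation \<sigma> where "\<sigma> \<equiv> row_sd M \<xi>"

lemma sigma_ge: "eventually (\<lambda>n. c \<le> \<sigma> n) sequentially"
  using sigma_infinity by (simp add: filterlim_at_top)

context
  fixes a B :: "nat \<Rightarrow> real" and \<eta> v :: real and j :: "nat \<Rightarrow> nat" and n0 :: nat and R :: "nat \<Rightarrow> real"
  defines "R \<equiv> R_row M N \<zeta> \<xi> p0 q0 v a B j"
  assumes a_pos: "\<And>n. 1 \<le> n \<Longrightarrow> 0 < a n" and B_ge: "\<And>n. 1 \<le> n \<Longrightarrow> 1 \<le> B n"
    and eta_pos: "0 < \<eta>" and v_gt: "1 < v"
    and phi_bound: "\<And>n k. 1 \<le> n \<Longrightarrow> 1 \<le> k \<Longrightarrow> k \<le> n \<Longrightarrow> phi_row M N \<zeta> n k \<le> B n * exp (- a n * real k powr \<eta>)"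
    and j_bounds: "\<And>n. n0 \<le> n \<Longrightarrow> 1 \<le> j n \<and> j n < n"
    and R_small: "R \<in> o(\<lambda>n. \<sigma> n powr (1 / 3))"
begin

lemma array_row: "1 \<le> n \<Longrightarrow> array_row M N \<zeta> g \<xi> n (a n) (B n) \<eta>"
  using prob_M zeta_measurable g_measurable xi_eq bounded centered a_pos B_ge eta_pos phi_bound
  by (intro array_row.intro array_row_axioms.intro) auto

lemma n_ge: "n0 \<le> n \<Longrightarrow> 1 \<le> n" using j_bounds[of n] by linarith

lemma R_ge: "n0 \<le> n \<Longrightarrow> 1 \<le> R n" "n0 \<le> n \<Longrightarrow> (K_inf M \<xi> n + 1) * (B n * exp (a n powr (- v))) \<le> R n"
  unfolding R_def using R_row_ge[where a=a and B=B and n=n and j=j, OF array_row[OF n_ge]] j_bounds by auto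

lemma moment_estimate:
  "\<exists>C>0. \<forall>p>2. \<forall>n\<ge>n0. \<bar>(\<integral>\<omega>. S n \<omega> ^ p \<partial>M) - \<sigma> n ^ p * (\<integral>\<omega>. Z \<omega> ^ p \<partial>Q)\<bar> \<le> moment_bound R \<sigma> \<eta> C p n"
proof -
  define L where "L = block_const \<eta> v"
  have L1: "1 \<le> L" by (simp add: L_def block_const_ge)
  have v0: "0 < v" using v_gt by simp
  \<comment> \<open>The small constant \<open>1 / L\<close> yields both requirements of the
    large-row estimate at once.\<close>
  have "eventually (\<lambda>n. norm (R n) \<le> 1 / L * norm (\<sigma> n powr (1 / 3))) sequentially"
    using L1 by (intro landau_o.smallD[OF R_small]) auto
  then have "eventually (\<lambda>n. R n ^ 3 \<le> \<sigma> n \<and> L * R n \<le> \<sigma> n) sequentially"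
    using sigma_ge[of 1] eventually_ge_at_top[of n0]
  proof eventually_elim
    case (elim n)
    have R1: "1 \<le> R n" using R_ge(1)[OF elim(3)] .
    have LR: "L * R n \<le> \<sigma> n powr (1 / 3)" using elim(1) R1 L1 by (simp add: field_simps)
    have "\<sigma> n powr (1 / 3) \<le> \<sigma> n powr 1" using elim(2) by (intro powr_mono) auto
    then have 1: "L * R n \<le> \<sigma> n" using LR elim(2) by simp
    have "R n \<le> L * R n" using mult_right_mono[of 1 L "R n"] L1 R1 by simp
    then have "R n \<le> \<sigma> n powr (1 / 3)" using LR by linarith
    then have "R n ^ 3 \<le> (\<sigma> n powr (1 / 3)) ^ 3" using R1 by (intro power_mono) auto
    also have "\<dots> = \<sigma> n" using elim(2) by (simp add: powr_power)
    finally show ?case using 1 by simp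
  qed
  then obtain n1 where n1: "\<And>n. n1 \<le> n \<Longrightarrow> R n ^ 3 \<le> \<sigma> n \<and> L * R n \<le> \<sigma> n"
    by (auto simp: eventually_sequentially)
  let ?P = "\<lambda>n C. 0 \<le> C \<and> (\<forall>p\<ge>3. \<bar>(\<integral>\<omega>. S n \<omega> ^ p \<partial>M) - fact p * gauss_fps ((\<sigma> n)\<^sup>2 / 2) $ p\<bar>
    \<le> fact p * C ^ p * (R n)\<^sup>2 * \<sigma> n ^ (2 * ((p - 1) div 2)))"
  have "\<exists>C. ?P n C" if n: "n0 \<le> n" for n
    using array_row.moment_comparison_fixed[OF array_row[OF n_ge[OF n]] R_ge(1)[OF n]] by auto
  then obtain c where c: "\<And>n. n0 \<le> n \<Longrightarrow> ?P n (c n)" by metis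
  \<comment> \<open>Summing the constants of the finitely many exceptional rows makes
    \<open>C\<close> independent of both \<open>n\<close> and \<open>p\<close>.\<close>
  define C where "C = moment_const \<eta> v + (\<Sum>n\<in>{n0..<n1}. c n)"
  have mc: "1 \<le> moment_const \<eta> v"
    unfolding moment_const_def using block_const_ge[of \<eta> v] by (intro one_le_mult one_le_power) auto
  have sum0: "0 \<le> (\<Sum>n\<in>{n0..<n1}. c n)" using c by (intro sum_nonneg) auto
  have C0: "0 < C" using mc sum0 by (simp add: C_def)
  have "\<bar>(\<integral>\<omega>. S n \<omega> ^ p \<partial>M) - \<sigma> n ^ p * (\<integral>\<omega>. Z \<omega> ^ p \<partial>Q)\<bar> \<le> moment_bound R \<sigma> \<eta> C p n"
    if p: "2 < p" and n: "n0 \<le> n" for p n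
  proof -
    interpret ar: array_row M N \<zeta> g \<xi> n "a n" "B n" \<eta> by (rule array_row[OF n_ge[OF n]])
    have s0: "0 \<le> \<sigma> n" by (rule ar.row_sd_sq)
    have "\<exists>C'. 0 \<le> C' \<and> C' \<le> C \<and> \<bar>(\<integral>\<omega>. S n \<omega> ^ p \<partial>M) - fact p * gauss_fps ((\<sigma> n)\<^sup>2 / 2) $ p\<bar>
      \<le> fact p * C' ^ p * (R n)\<^sup>2 * \<sigma> n ^ (2 * ((p - 1) div 2))"
    proof (cases "n1 \<le> n")
      case True
      have "\<bar>(\<integral>\<omega>. S n \<omega> ^ p \<partial>M) - fact p * gauss_fps ((\<sigma> n)\<^sup>2 / 2) $ p\<bar>
        \<le> fact p * moment_const \<eta> v ^ p * (R n)\<^sup>2 * \<sigma> n ^ (2 * ((p - 1) div 2))"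
        using n1[OF True] R_ge[OF n] p v0 unfolding L_def
        by (intro ar.moment_comparison_large) (auto simp: ar.K_def)
      then show ?thesis using mc sum0 by (intro exI[of _ "moment_const \<eta> v"]) (simp add: C_def)
    next
      case False
      have "c n \<le> (\<Sum>n\<in>{n0..<n1}. c n)" using c n False by (intro member_le_sum) auto
      then have "c n \<le> C" using mc by (simp add: C_def)
      then show ?thesis using c[OF n] p by (intro exI[of _ "c n"]) auto
    qed
    then obtain C' where C': "0 \<le> C'" "C' \<le> C" "\<bar>(\<integral>\<omega>. S n \<omega> ^ p \<partial>M) - fact p * gauss_fps ((\<sigma> n)\<^sup>2 / 2) $ p\<bar>
      \<le> fact p * C' ^ p * (R n)\<^sup>2 * \<sigma> n ^ (2 * ((p - 1) div 2))" by blast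
    note C'(3)
    also have "fact p * C' ^ p * (R n)\<^sup>2 * \<sigma> n ^ (2 * ((p - 1) div 2)) \<le> fact p * C ^ p * (R n)\<^sup>2 * \<sigma> n ^ (2 * ((p - 1) div 2))"
      using C' s0 by (intro mult_right_mono mult_left_mono power_mono) auto
    also have "\<dots> \<le> moment_bound R \<sigma> \<eta> C p n"
      unfolding moment_bound_def using p R_ge[OF n] C0 s0 eta_pos by (intro leading_term_le) auto
    finally show ?thesis unfolding std_normal_power_moment[OF Z_normal] .
  qed
  then show ?thesis using C0 by blast
qed

text \<open>Each summand has at most \<open>p\<close> powers of \<open>R\<close> and
  \<open>p - 1\<close> of \<sigma>, and eventually both quantities are at least 1.\<close>

lemma moment_bound_bigo:
  assumes "0 < C" "2 < p"
  shows "moment_bound R \<sigma> \<eta> C p \<in> O(\<lambda>n. R n ^ p * \<sigma> n ^ (p - 1))"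
proof -
  define D where "D = C ^ p * (fact p powr (2 + 1 / \<eta>)) * (\<Sum>u = 1..(p - 1) div 2. real p ^ u / (fact u)\<^sup>2)"
  have "eventually (\<lambda>n. norm (moment_bound R \<sigma> \<eta> C p n) \<le> D * norm (R n ^ p * \<sigma> n ^ (p - 1))) sequentially"
    using sigma_ge[of 1] eventually_ge_at_top[of n0]
  proof eventually_elim
    case (elim n)
    have R1: "1 \<le> R n" using R_ge(1)[OF elim(2)] .
    have s1: "1 \<le> \<sigma> n" using elim by simp
    have "R n * (\<Sum>u = 1..(p - 1) div 2. R n ^ u * \<sigma> n ^ (2 * u) * real p ^ u / (fact u)\<^sup>2)
      \<le> (\<Sum>u = 1..(p - 1) div 2. real p ^ u / (fact u)\<^sup>2) * (R n ^ p * \<sigma> n ^ (p - 1))"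
      unfolding sum_distrib_left sum_distrib_right
    proof (rule sum_mono)
      fix u assume u: "u \<in> {1..(p - 1) div 2}"
      have u2: "Suc u \<le> p" "2 * u \<le> p - 1" using u assms by auto
      have "R n ^ Suc u * \<sigma> n ^ (2 * u) \<le> R n ^ p * \<sigma> n ^ (p - 1)"
        using R1 s1 u2 by (intro mult_mono power_increasing) auto
      then have "real p ^ u / (fact u)\<^sup>2 * (R n ^ Suc u * \<sigma> n ^ (2 * u)) \<le> real p ^ u / (fact u)\<^sup>2 * (R n ^ p * \<sigma> n ^ (p - 1))"
        by (intro mult_left_mono) auto
      then show "R n * (R n ^ u * \<sigma> n ^ (2 * u) * real p ^ u / (fact u)\<^sup>2) \<le> real p ^ u / (fact u)\<^sup>2 * (R n ^ p * \<sigma> n ^ (p - 1))"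
        by (simp add: mult_ac)
    qed
    then have "C ^ p * (fact p powr (2 + 1 / \<eta>)) * (R n * (\<Sum>u = 1..(p - 1) div 2. R n ^ u * \<sigma> n ^ (2 * u) * real p ^ u / (fact u)\<^sup>2))
      \<le> C ^ p * (fact p powr (2 + 1 / \<eta>)) * ((\<Sum>u = 1..(p - 1) div 2. real p ^ u / (fact u)\<^sup>2) * (R n ^ p * \<sigma> n ^ (p - 1)))"
      using assms by (intro mult_left_mono) auto
    then have "moment_bound R \<sigma> \<eta> C p n \<le> D * (R n ^ p * \<sigma> n ^ (p - 1))"
      unfolding moment_bound_def D_def by (simp add: mult_ac)
    moreover have "0 \<le> moment_bound R \<sigma> \<eta> C p n"
      unfolding moment_bound_def using R1 s1 assms by (intro mult_nonneg_nonneg sum_nonneg) auto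
    ultimately show ?case using R1 s1 by simp
  qed
  then show ?thesis by (rule bigoI)
qed

lemma moment_convergence:
  assumes p: "2 < p" and small: "(\<lambda>n. R n ^ p / \<sigma> n) \<in> o(\<lambda>_. 1)"
  shows "(\<lambda>n. \<integral>\<omega>. (S n \<omega> / \<sigma> n) ^ p \<partial>M) \<longlonglongrightarrow> (\<integral>\<omega>. Z \<omega> ^ p \<partial>Q)"
proof -
  let ?z = "\<integral>\<omega>. Z \<omega> ^ p \<partial>Q"
  obtain C where C: "C > 0" "\<And>n. n0 \<le> n \<Longrightarrow> \<bar>(\<integral>\<omega>. S n \<omega> ^ p \<partial>M) - \<sigma> n ^ p * ?z\<bar> \<le> moment_bound R \<sigma> \<eta> C p n"
    using moment_estimate p by blast
  obtain D where D: "D > 0" "eventually (\<lambda>n. norm (moment_bound R \<sigma> \<eta> C p n) \<le> D * norm (R n ^ p * \<sigma> n ^ (p - 1))) sequentially"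
    using landau_o.bigE[OF moment_bound_bigo[OF C(1) p]] by blast
  have lim: "(\<lambda>n. D * (R n ^ p / \<sigma> n)) \<longlonglongrightarrow> 0"
    using smalloD_tendsto[OF small] by (intro tendsto_mult_right_zero) simp
  have "(\<lambda>n. (\<integral>\<omega>. (S n \<omega> / \<sigma> n) ^ p \<partial>M) - ?z) \<longlonglongrightarrow> 0"
  proof (rule Lim_null_comparison[OF _ lim])
    show "eventually (\<lambda>n. norm ((\<integral>\<omega>. (S n \<omega> / \<sigma> n) ^ p \<partial>M) - ?z) \<le> D * (R n ^ p / \<sigma> n)) sequentially"
      using D(2) sigma_ge[of 1] eventually_ge_at_top[of n0]
    proof eventually_elim
      case (elim n)
      have s1: "1 \<le> \<sigma> n" and R1: "1 \<le> R n" using elim R_ge by auto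
      have "(\<integral>\<omega>. (S n \<omega> / \<sigma> n) ^ p \<partial>M) = (\<integral>\<omega>. S n \<omega> ^ p \<partial>M) / \<sigma> n ^ p"
        by (simp add: power_divide)
      then have "(\<integral>\<omega>. (S n \<omega> / \<sigma> n) ^ p \<partial>M) - ?z = ((\<integral>\<omega>. S n \<omega> ^ p \<partial>M) - \<sigma> n ^ p * ?z) / \<sigma> n ^ p"
        using s1 by (simp add: diff_divide_distrib)
      then have "norm ((\<integral>\<omega>. (S n \<omega> / \<sigma> n) ^ p \<partial>M) - ?z) = \<bar>(\<integral>\<omega>. S n \<omega> ^ p \<partial>M) - \<sigma> n ^ p * ?z\<bar> / \<sigma> n ^ p"
        using s1 by (simp add: abs_divide)
      also have "\<dots> \<le> D * (R n ^ p * \<sigma> n ^ (p - 1)) / \<sigma> n ^ p"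
      proof (rule divide_right_mono)
        have "\<bar>(\<integral>\<omega>. S n \<omega> ^ p \<partial>M) - \<sigma> n ^ p * ?z\<bar> \<le> norm (moment_bound R \<sigma> \<eta> C p n)" using C(2)[OF elim(3)] by simp
        also have "\<dots> \<le> D * (R n ^ p * \<sigma> n ^ (p - 1))" using elim(1) R1 s1 by simp
        finally show "\<bar>(\<integral>\<omega>. S n \<omega> ^ p \<partial>M) - \<sigma> n ^ p * ?z\<bar> \<le> D * (R n ^ p * \<sigma> n ^ (p - 1))" .
      qed (use s1 in auto)
      also have "\<sigma> n ^ p = \<sigma> n ^ (p - 1) * \<sigma> n" using p by (simp flip: power_Suc2)
      also have "D * (R n ^ p * \<sigma> n ^ (p - 1)) / (\<sigma> n ^ (p - 1) * \<sigma> n) = D * (R n ^ p / \<sigma> n)" using s1 by simp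
      finally show ?case .
    qed
  qed
  then show ?thesis by (simp add: LIM_zero_iff)
qed

text \<open>Orders 0, 1 and 2 agree with the Gaussian by normalisation; above 2 the hypothesis with
  \<epsilon> = 1/p yields the smallness of \<open>R n ^ p / \<sigma> n\<close>.\<close>

lemma all_moments_convergence:
  assumes small: "\<And>\<epsilon>. 0 < \<epsilon> \<Longrightarrow> R \<in> o(\<lambda>n. \<sigma> n powr \<epsilon>)"
  shows "(\<lambda>n. \<integral>\<omega>. (S n \<omega> / \<sigma> n) ^ p \<partial>M) \<longlonglongrightarrow> (\<integral>\<omega>. Z \<omega> ^ p \<partial>Q)"
proof -
  interpret M: prob_space M by (rule prob_M)
  interpret Q: prob_space Q by (rule prob_Q)
  have Zp: "(\<integral>\<omega>. Z \<omega> ^ p \<partial>Q) = fact p * gauss_fps (1 / 2) $ p" for p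
    using std_normal_power_moment[OF Z_normal, of 1 p] by simp
  consider "p = 0" | "p = 1" | "p = 2" | "2 < p" by linarith
  then show ?thesis
  proof cases
    case 1
    then show ?thesis by (simp add: M.prob_space Q.prob_space)
  next
    case 2
    have "eventually (\<lambda>n. (\<integral>\<omega>. (S n \<omega> / \<sigma> n) ^ p \<partial>M) = 0) sequentially"
      using eventually_ge_at_top[of 1]
    proof eventually_elim
      case (elim n)
      then show ?case using array_row.row_sum_mean[OF array_row[OF elim]] 2 by simp
    qed
    moreover have "(\<integral>\<omega>. Z \<omega> ^ p \<partial>Q) = 0" unfolding Zp using 2 by (simp add: gauss_fps_nth)
    ultimately show ?thesis by (simp add: tendsto_eventually)
  next
    case 3
    have "eventually (\<lambda>n. (\<integral>\<omega>. (S n \<omega> / \<sigma> n) ^ p \<partial>M) = 1) sequentially"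
      using eventually_ge_at_top[of 1] sigma_ge[of 1]
    proof eventually_elim
      case (elim n)
      have "(\<integral>\<omega>. (S n \<omega> / \<sigma> n) ^ p \<partial>M) = (\<integral>\<omega>. (S n \<omega>)\<^sup>2 \<partial>M) / (\<sigma> n)\<^sup>2" using 3 by (simp add: power_divide)
      also have "\<dots> = 1" unfolding array_row.row_sd_sq(1)[OF array_row[OF elim(1)], symmetric] using elim(2) by simp
      finally show ?case .
    qed
    moreover have "(\<integral>\<omega>. Z \<omega> ^ p \<partial>Q) = 1" unfolding Zp using 3 by (simp add: gauss_fps_nth)
    ultimately show ?thesis by (simp add: tendsto_eventually)
  next
    case 4
    have "(\<lambda>n. R n ^ p / \<sigma> n) \<in> o(\<lambda>_. 1)"
    proof (rule landau_o.smallI)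
      fix c :: real assume c: "0 < c"
      \<comment> \<open>The minimum with 1 ensures \<open>d ^ p \<le> c\<close>.\<close>
      define d where "d = min c 1"
      have d: "0 < d" "d \<le> 1" "d \<le> c" using c by (auto simp: d_def)
      have "eventually (\<lambda>n. norm (R n) \<le> d * norm (\<sigma> n powr (1 / real p))) sequentially"
        using 4 by (intro landau_o.smallD[OF small] d) auto
      then show "eventually (\<lambda>n. norm (R n ^ p / \<sigma> n) \<le> c * norm (1::real)) sequentially"
        using sigma_ge[of 1] eventually_ge_at_top[of n0]
      proof eventually_elim
        case (elim n)
        have R1: "1 \<le> R n" and s1: "1 \<le> \<sigma> n" using elim R_ge by auto
        have "R n \<le> d * \<sigma> n powr (1 / real p)" using elim(1) R1 by simp
        then have "R n ^ p \<le> (d * \<sigma> n powr (1 / real p)) ^ p" using R1 by (intro power_mono) auto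
        also have "\<dots> = d ^ p * \<sigma> n" using s1 4 by (simp add: power_mult_distrib powr_power)
        also have "\<dots> \<le> c * \<sigma> n"
        proof (intro mult_right_mono)
          have "d ^ p \<le> d ^ 1" using d 4 by (intro power_decreasing) auto
          then show "d ^ p \<le> c" using d by simp
        qed (use s1 in auto)
        finally show ?case using s1 R1 by (simp add: divide_le_eq)
      qed
    qed
    then show ?thesis using 4 by (intro moment_convergence)
  qed
qed

end

lemma gen_sigma_facts:
  assumes "1 \<le> i" "j' \<le> n"
  shows "gen_sigma M (N n) (\<zeta> n) {i..j'} \<subseteq> sets M" "space M \<in> gen_sigma M (N n) (\<zeta> n) {i..j'}"
proof -
  show "gen_sigma M (N n) (\<zeta> n) {i..j'} \<subseteq> sets M"
    using zeta_measurable assms by (intro gen_sigma_sub) auto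
  show "space M \<in> gen_sigma M (N n) (\<zeta> n) {i..j'}" unfolding gen_sigma_def by (rule sigma_sets_top)
qed

text \<open>The bound by 1 is uniform in \<open>n\<close>; it makes the supremum
  \<open>phi_sup\<close> over all rows an actual upper bound.\<close>

lemma row_coeff_bounds:
  assumes k: "1 \<le> k" "k \<le> n"
  shows "phi_row M N \<zeta> n k \<le> 1" "0 \<le> alpha_row M N \<zeta> n k" "alpha_row M N \<zeta> n k \<le> phi_row M N \<zeta> n k"
    "phi_row M N \<zeta> n k \<le> phi_sup M N \<zeta> k"
proof -
  let ?G = "\<lambda>n s. gen_sigma M (N n) (\<zeta> n) {1..s}" and ?H = "\<lambda>n s. gen_sigma M (N n) (\<zeta> n) {s + k..n}"
  have cb: "phi_coeff M (?G n s) (?H n s) \<le> 1" "0 \<le> alpha_coeff M (?G n s) (?H n s)"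
    "alpha_coeff M (?G n s) (?H n s) \<le> phi_coeff M (?G n s) (?H n s)" if "s \<in> {0..n - k}" "k \<le> n" for s n
    using that k by (intro coeff_bounds[OF prob_M] gen_sigma_facts; auto)+
  have le1: "phi_row M N \<zeta> n k \<le> 1" if "k \<le> n" for n
    unfolding phi_row_def using cb that by (intro cSUP_least) auto
  show "phi_row M N \<zeta> n k \<le> 1" using k by (intro le1)
  have "alpha_coeff M (?G n 0) (?H n 0) \<le> alpha_row M N \<zeta> n k"
    unfolding alpha_row_def by (intro cSUP_upper bdd_above_finite) auto
  then show "0 \<le> alpha_row M N \<zeta> n k" using cb(2)[of 0 n] k by simp
  show "alpha_row M N \<zeta> n k \<le> phi_row M N \<zeta> n k"
    unfolding alpha_row_def phi_row_def
  proof (rule cSUP_mono)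
    show "\<exists>m\<in>{0..n - k}. alpha_coeff M (?G n s) (?H n s) \<le> phi_coeff M (?G n m) (?H n m)"
      if "s \<in> {0..n - k}" for s using cb(3)[OF that k(2)] that by (rule bexI)
  qed auto
  show "phi_row M N \<zeta> n k \<le> phi_sup M N \<zeta> k"
    unfolding phi_sup_def using k le1 by (intro cSUP_upper bdd_aboveI2[where M=1]) auto
qed

section \<open>Uniformly bounded arrays\<close>

context
  fixes A a \<eta> v :: real
  assumes A_pos: "0 < A" and a_pos: "0 < a" and eta_pos: "0 < \<eta>" and v_gt: "1 < v"
    and K_bdd: "bdd_above (K_inf M \<xi> ` {1..})"
    and phi_sup_bound: "\<And>k. 1 \<le> k \<Longrightarrow> phi_sup M N \<zeta> k \<le> A * exp (- a * real k powr \<eta>)"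
begin

lemma uniform_phi_row: "1 \<le> k \<Longrightarrow> k \<le> n \<Longrightarrow> phi_row M N \<zeta> n k \<le> A * exp (- a * real k powr \<eta>)"
  using row_coeff_bounds(4) phi_sup_bound by (meson order_trans)

lemma uniform_phi_row_max: "1 \<le> k \<Longrightarrow> k \<le> n \<Longrightarrow> phi_row M N \<zeta> n k \<le> max A 1 * exp (- a * real k powr \<eta>)"
  using uniform_phi_row by (rule order_trans) (auto intro: mult_right_mono)

lemma uniform_array_row: "1 \<le> n \<Longrightarrow> array_row M N \<zeta> g \<xi> n a (max A 1) \<eta>"
  using prob_M zeta_measurable g_measurable xi_eq bounded centered a_pos eta_pos uniform_phi_row_max
  by (intro array_row.intro array_row_axioms.intro) auto

lemma small_gap_exists: "\<exists>j0\<ge>1. \<exists>\<epsilon>0>0. \<forall>n>j0. phi_row M N \<zeta> n j0 < 1 / 2 - \<epsilon>0"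
proof -
  obtain m where m: "1 \<le> m" "\<And>n. (\<Sum>j = m..n. (A * exp (- a * real j powr \<eta>)) powr 1) \<le> 1 / 8"
    using stretched_exp_tail[OF A_pos a_pos eta_pos, of 1 "1 / 8"] by auto
  \<comment> \<open>For \<open>n = m\<close> the tail sum is a single term.\<close>
  have "A * exp (- a * real m powr \<eta>) \<le> 1 / 8" using m(2)[of m] A_pos by simp
  then have "phi_row M N \<zeta> n m < 1 / 2 - 1 / 4" if "m < n" for n
    using uniform_phi_row[of m n] m that by linarith
  then show ?thesis using m(1) by (intro exI[of _ m] conjI exI[of _ "1 / 4"]) auto
qed

lemma uniform_K: obtains k where "0 \<le> k" "\<And>n. 1 \<le> n \<Longrightarrow> 0 \<le> K_inf M \<xi> n \<and> K_inf M \<xi> n \<le> k"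
proof -
  obtain k where k: "\<And>n. 1 \<le> n \<Longrightarrow> K_inf M \<xi> n \<le> k" using K_bdd by (auto simp: bdd_above_def)
  have 0: "0 \<le> K_inf M \<xi> n" if "1 \<le> n" for n by (rule array_row.K_inf_nonneg[OF uniform_array_row[OF that]])
  show thesis using that[of k] 0 k 0[of 1] k[of 1] by fastforce
qed

text \<open>\<alpha> is at most \<phi>, so the sum defining \<open>Gamma_row\<close> from
  \<open>m\<close> on is a tail of a convergent series. One \<open>m\<close> puts it below
  \<open>1 / (8 * (k + 1))\<close>, hence below every threshold
  \<open>1 / (8 * K_norm M \<xi> q0 n)\<close>.\<close>

lemma uniform_r: obtains m where "\<And>n. 1 \<le> n \<Longrightarrow> r_row M N \<zeta> \<xi> p0 q0 n \<le> m"
proof -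
  obtain k where k: "0 \<le> k" "\<And>n. 1 \<le> n \<Longrightarrow> 0 \<le> K_inf M \<xi> n \<and> K_inf M \<xi> n \<le> k" using uniform_K by blast
  define \<delta> where "\<delta> = 1 / p0 - 1 / q0"
  have \<delta>: "0 < \<delta>" unfolding \<delta>_def using exponents by (simp add: field_simps)
  define y where "y = 1 / (8 * (k + 1))"
  have y: "0 < y" using k by (simp add: y_def)
  obtain m where m: "1 \<le> m" "\<And>n. (\<Sum>j = m..n. (A * exp (- a * real j powr \<eta>)) powr \<delta>) \<le> y"
    using stretched_exp_tail[OF A_pos a_pos eta_pos \<delta> y] by blast
  have "r_row M N \<zeta> \<xi> p0 q0 n \<le> m" if n: "1 \<le> n" for n
  proof -
    have "Gamma_row M N \<zeta> p0 q0 n m \<le> (\<Sum>j = m..n. (A * exp (- a * real j powr \<eta>)) powr \<delta>)"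
      unfolding Gamma_row_def \<delta>_def[symmetric]
    proof (intro sum_mono powr_mono2)
      fix j assume j: "j \<in> {m..n}"
      then have j1: "1 \<le> j" "j \<le> n" using m by auto
      show "0 \<le> alpha_row M N \<zeta> n j" using row_coeff_bounds(2)[OF j1] .
      show "alpha_row M N \<zeta> n j \<le> A * exp (- a * real j powr \<eta>)"
        using row_coeff_bounds(3)[OF j1] uniform_phi_row[OF j1] by linarith
    qed (use \<delta> in auto)
    then have G: "Gamma_row M N \<zeta> p0 q0 n m \<le> y" using m(2)[of n] by linarith
    define Kq where "Kq = K_norm M \<xi> q0 n"
    have Kq: "0 \<le> Kq" "Kq \<le> k"
      unfolding Kq_def using K_norm_nonneg[OF n] k(2)[OF n] exponents
        array_row.K_norm_le_K_inf[OF uniform_array_row[OF n], of q0] by auto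
    have "ereal (Gamma_row M N \<zeta> p0 q0 n m) \<le> 1 / (8 * ereal Kq)"
    proof (cases "Kq = 0")
      \<comment> \<open>In the extended reals the threshold is infinite for a vanishing
        norm.\<close>
      case True
      then show ?thesis by (simp add: divide_ereal_def zero_ereal_def[symmetric])
    next
      case False
      then have "y \<le> 1 / (8 * Kq)" unfolding y_def using Kq by (intro divide_left_mono) auto
      moreover have "1 / (8 * ereal Kq) = ereal (1 / (8 * Kq))" using False by (simp add: one_ereal_def)
      ultimately show ?thesis using G by simp
    qed
    then have "Gamma_inv M N \<zeta> p0 q0 n (1 / (8 * ereal Kq)) \<le> m"
      unfolding Gamma_inv_def using m(1) by (intro Least_le) auto
    then show ?thesis using m(1) by (simp add: r_row_def Kq_def)
  qed
  then show thesis using that by blast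
qed

text \<open>Every factor of \<open>R_row\<close> is bounded once \<open>K_inf\<close> and
  \<open>r_row\<close> are; boundedness gives the second claim because \<sigma> tends to
  infinity.\<close>

lemma uniform_R:
  fixes j0 :: nat
  defines "R \<equiv> R_row M N \<zeta> \<xi> p0 q0 v (\<lambda>_. a) (\<lambda>_. max A 1) (\<lambda>_. j0)"
  shows "Bseq R" and "0 < \<epsilon> \<Longrightarrow> R \<in> o(\<lambda>n. \<sigma> n powr \<epsilon>)"
proof -
  obtain k where k: "0 \<le> k" "\<And>n. 1 \<le> n \<Longrightarrow> 0 \<le> K_inf M \<xi> n \<and> K_inf M \<xi> n \<le> k" using uniform_K by blast
  obtain m where m: "\<And>n. 1 \<le> n \<Longrightarrow> r_row M N \<zeta> \<xi> p0 q0 n \<le> m" using uniform_r by blast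
  define b where "b = 18 * real m * (1 + k) * (k * real j0 + 1) * max A 1 * exp (a powr (- v))"
  have Rb: "norm (R n) \<le> b" if n: "1 \<le> n" for n
  proof -
    have K2: "0 \<le> K_norm M \<xi> 2 n" "K_norm M \<xi> 2 n \<le> k"
      using K_norm_nonneg[OF n] k(2)[OF n] array_row.K_norm_le_K_inf[OF uniform_array_row[OF n], of 2] by auto
    have "R n \<le> b"
      unfolding R_def R_row_def A_row_def b_def using K2 m[OF n] k(2)[OF n] k(1)
      by (intro mult_mono add_mono mult_nonneg_nonneg add_nonneg_nonneg) auto
    moreover have "0 \<le> R n"
      unfolding R_def R_row_def A_row_def using K2 k(2)[OF n] by (intro mult_nonneg_nonneg add_nonneg_nonneg) auto
    ultimately show ?thesis by simp
  qed
  show "Bseq R"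
  proof (rule BseqI')
    \<comment> \<open>Row 0 has no entries and its value is bounded separately.\<close>
    show "norm (R n) \<le> max b (norm (R 0))" for n using Rb[of n] by (cases "n = 0") auto
  qed
  assume \<epsilon>: "0 < \<epsilon>"
  show "R \<in> o(\<lambda>n. \<sigma> n powr \<epsilon>)"
  proof (rule landau_o.smallI)
    fix c :: real assume c: "0 < c"
    have "filterlim (\<lambda>n. \<sigma> n powr \<epsilon>) at_top sequentially"
      using filterlim_compose[OF real_powr_at_top[OF \<epsilon>] sigma_infinity] .
    then have "eventually (\<lambda>n. b / c \<le> \<sigma> n powr \<epsilon>) sequentially" by (simp add: filterlim_at_top)
    then show "eventually (\<lambda>n. norm (R n) \<le> c * norm (\<sigma> n powr \<epsilon>)) sequentially"
      using eventually_ge_at_top[of 1]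
    proof eventually_elim
      case (elim n)
      have "b \<le> c * \<sigma> n powr \<epsilon>" using elim(1) c by (simp add: divide_le_eq mult.commute)
      then show ?case using Rb[OF elim(2)] by simp
    qed
  qed
qed

text \<open>The general statement for constant sequences, with \<open>B = max A 1\<close>, gap 1 and
  \<open>n0 = 2\<close>, so that the gap is below \<open>n\<close>.\<close>

lemma uniform_convergence: "(\<lambda>n. \<integral>\<omega>. (S n \<omega> / \<sigma> n) ^ p \<partial>M) \<longlonglongrightarrow> (\<integral>\<omega>. Z \<omega> ^ p \<partial>Q)"
proof (rule all_moments_convergence)
  show "0 < a" "1 < v" "0 < \<eta>" using a_pos v_gt eta_pos by auto
  show "1 \<le> max A 1" by simp
  show "phi_row M N \<zeta> n k \<le> max A 1 * exp (- a * real k powr \<eta>)" if "1 \<le> k" "k \<le> n" for n k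
    using that by (rule uniform_phi_row_max)
  show "1 \<le> (1::nat) \<and> 1 < n" if "2 \<le> n" for n :: nat using that by auto
qed (use uniform_R in auto)

end

end

theorem theorem2p13:
  fixes M :: "'a measure"
    and N :: "nat \<Rightarrow> nat \<Rightarrow> 'b measure"
    and \<zeta> :: "nat \<Rightarrow> nat \<Rightarrow> 'a \<Rightarrow> 'b"
    and g :: "nat \<Rightarrow> nat \<Rightarrow> 'b \<Rightarrow> real"
    and \<xi> :: "nat \<Rightarrow> nat \<Rightarrow> 'a \<Rightarrow> real"
    and S :: "nat \<Rightarrow> 'a \<Rightarrow> real"
    and \<sigma> :: "nat \<Rightarrow> real"
    and p0 q0 :: real
    and Q :: "'c measure"
    and Z :: "'c \<Rightarrow> real"
  assumes prob_M: "prob_space M"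
    and zeta_measurable: "\<And>n j. 1 \<le> j \<Longrightarrow> j \<le> n \<Longrightarrow> \<zeta> n j \<in> measurable M (N n j)"
    and g_measurable: "\<And>n j. 1 \<le> j \<Longrightarrow> j \<le> n \<Longrightarrow> g n j \<in> borel_measurable (N n j)"
    and xi_eq: "\<xi> = (\<lambda>n j \<omega>. g n j (\<zeta> n j \<omega>))"
    and S_eq: "S = row_sum \<xi>"
    and sigma_eq: "\<sigma> = row_sd M \<xi>"
    and bounded: "\<And>n j. 1 \<le> j \<Longrightarrow> j \<le> n \<Longrightarrow> \<exists>c. AE \<omega> in M. \<bar>\<xi> n j \<omega>\<bar> \<le> c"
    and centered: "\<And>n j. 1 \<le> j \<Longrightarrow> j \<le> n \<Longrightarrow> (\<integral>\<omega>. \<xi> n j \<omega> \<partial>M) = 0"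
    and sigma_infinity: "filterlim \<sigma> at_top sequentially"
    and exponents: "2 < p0" "p0 < q0"
    and prob_Q: "prob_space Q"
    and Z_normal: "distributed Q lborel Z std_normal_density"
  shows
    "(\<forall>(a :: nat \<Rightarrow> real) (B :: nat \<Rightarrow> real) (\<eta> :: real) (v :: real)
        (j :: nat \<Rightarrow> nat) (n0 :: nat) (\<epsilon>0 :: real).
        let R = R_row M N \<zeta> \<xi> p0 q0 v a B j;
            bound = (\<lambda>(C :: real) (p :: nat) n.
              R n * C ^ p * (fact p powr (2 + 1 / \<eta>)) *
              (\<Sum>u = 1..(p - 1) div 2.
                 R n ^ u * \<sigma> n ^ (2 * u) * real p ^ u / (fact u)\<^sup>2))
        in
          (\<forall>n\<ge>1. a n > 0) \<longrightarrow> bdd_above (a ` {1..}) \<longrightarrow> (\<forall>n\<ge>1. B n \<ge> 1) \<longrightarrow>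
          \<eta> > 0 \<longrightarrow> v > 1 \<longrightarrow>
          (\<forall>n\<ge>1. \<forall>k\<in>{1..n}. phi_row M N \<zeta> n k \<le> B n * exp (- a n * real k powr \<eta>)) \<longrightarrow>
          \<epsilon>0 > 0 \<longrightarrow>
          (\<forall>n\<ge>n0. 1 \<le> j n \<and> j n < n \<and> phi_row M N \<zeta> n (j n) < 1 / 2 - \<epsilon>0) \<longrightarrow>
          R \<in> o(\<lambda>n. \<sigma> n powr (1 / 3)) \<longrightarrow>
            (\<exists>C>0. \<forall>p>2.
               (\<forall>n\<ge>n0. \<bar>(\<integral>\<omega>. S n \<omega> ^ p \<partial>M) - \<sigma> n ^ p * (\<integral>\<omega>. Z \<omega> ^ p \<partial>Q)\<bar> \<le> bound C p n) \<and>
               bound C p \<in> O(\<lambda>n. R n ^ p * \<sigma> n ^ (p - 1))) \<and>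
            (\<forall>p>2. (\<lambda>n. R n ^ p / \<sigma> n) \<in> o(\<lambda>_. 1) \<longrightarrow>
               (\<lambda>n. \<integral>\<omega>. (S n \<omega> / \<sigma> n) ^ p \<partial>M) \<longlonglongrightarrow> (\<integral>\<omega>. Z \<omega> ^ p \<partial>Q)) \<and>
            ((\<forall>\<epsilon>>0. R \<in> o(\<lambda>n. \<sigma> n powr \<epsilon>)) \<longrightarrow>
               (\<forall>p. (\<lambda>n. \<integral>\<omega>. (S n \<omega> / \<sigma> n) ^ p \<partial>M) \<longlonglongrightarrow> (\<integral>\<omega>. Z \<omega> ^ p \<partial>Q))))
     \<and>
     (\<forall>(A :: real) (a :: real) (\<eta> :: real) (v :: real).
        A > 0 \<longrightarrow> a > 0 \<longrightarrow> \<eta> > 0 \<longrightarrow> v > 1 \<longrightarrow>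
        bdd_above (K_inf M \<xi> ` {1..}) \<longrightarrow>
        (\<forall>k\<ge>1. phi_sup M N \<zeta> k \<le> A * exp (- a * real k powr \<eta>)) \<longrightarrow>
          (\<forall>n\<ge>1. \<forall>k\<in>{1..n}. phi_row M N \<zeta> n k \<le> max A 1 * exp (- a * real k powr \<eta>)) \<and>
          (\<exists>j0\<ge>1. \<exists>\<epsilon>0>0. \<forall>n>j0. phi_row M N \<zeta> n j0 < 1 / 2 - \<epsilon>0) \<and>
          (\<forall>j0\<ge>1. (\<exists>\<epsilon>0>0. \<forall>n>j0. phi_row M N \<zeta> n j0 < 1 / 2 - \<epsilon>0) \<longrightarrow>
             (let R = R_row M N \<zeta> \<xi> p0 q0 v (\<lambda>_. a) (\<lambda>_. max A 1) (\<lambda>_. j0) in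
                Bseq R \<and> (\<forall>\<epsilon>>0. R \<in> o(\<lambda>n. \<sigma> n powr \<epsilon>)))) \<and>
          (\<forall>p. (\<lambda>n. \<integral>\<omega>. (S n \<omega> / \<sigma> n) ^ p \<partial>M) \<longlonglongrightarrow> (\<integral>\<omega>. Z \<omega> ^ p \<partial>Q)))"
proof -
  interpret arr: mixing_array M N \<zeta> g \<xi> p0 q0 Q Z
    using prob_M zeta_measurable g_measurable xi_eq bounded centered sigma_infinity exponents prob_Q Z_normal
    unfolding sigma_eq by (intro mixing_array.intro) auto
  have part1: "let R = R_row M N \<zeta> \<xi> p0 q0 v a B j;
            bound = (\<lambda>(C :: real) (p :: nat) n.
              R n * C ^ p * (fact p powr (2 + 1 / \<eta>)) *
              (\<Sum>u = 1..(p - 1) div 2.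
                 R n ^ u * \<sigma> n ^ (2 * u) * real p ^ u / (fact u)\<^sup>2))
        in
          (\<forall>n\<ge>1. a n > 0) \<longrightarrow> bdd_above (a ` {1..}) \<longrightarrow> (\<forall>n\<ge>1. B n \<ge> 1) \<longrightarrow>
          \<eta> > 0 \<longrightarrow> v > 1 \<longrightarrow>
          (\<forall>n\<ge>1. \<forall>k\<in>{1..n}. phi_row M N \<zeta> n k \<le> B n * exp (- a n * real k powr \<eta>)) \<longrightarrow>
          \<epsilon>0 > 0 \<longrightarrow>
          (\<forall>n\<ge>n0. 1 \<le> j n \<and> j n < n \<and> phi_row M N \<zeta> n (j n) < 1 / 2 - \<epsilon>0) \<longrightarrow>
          R \<in> o(\<lambda>n. \<sigma> n powr (1 / 3)) \<longrightarrow>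
            (\<exists>C>0. \<forall>p>2.
               (\<forall>n\<ge>n0. \<bar>(\<integral>\<omega>. S n \<omega> ^ p \<partial>M) - \<sigma> n ^ p * (\<integral>\<omega>. Z \<omega> ^ p \<partial>Q)\<bar> \<le> bound C p n) \<and>
               bound C p \<in> O(\<lambda>n. R n ^ p * \<sigma> n ^ (p - 1))) \<and>
            (\<forall>p>2. (\<lambda>n. R n ^ p / \<sigma> n) \<in> o(\<lambda>_. 1) \<longrightarrow>
               (\<lambda>n. \<integral>\<omega>. (S n \<omega> / \<sigma> n) ^ p \<partial>M) \<longlonglongrightarrow> (\<integral>\<omega>. Z \<omega> ^ p \<partial>Q)) \<and>
            ((\<forall>\<epsilon>>0. R \<in> o(\<lambda>n. \<sigma> n powr \<epsilon>)) \<longrightarrow>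
               (\<forall>p. (\<lambda>n. \<integral>\<omega>. (S n \<omega> / \<sigma> n) ^ p \<partial>M) \<longlonglongrightarrow> (\<integral>\<omega>. Z \<omega> ^ p \<partial>Q)))"
    for a B :: "nat \<Rightarrow> real" and \<eta> v \<epsilon>0 :: real and j :: "nat \<Rightarrow> nat" and n0 :: nat
  proof -
    define R where "R = R_row M N \<zeta> \<xi> p0 q0 v a B j"
    \<comment> \<open>The bound of the statement occurs both as a function of \<open>n\<close> and
      applied to \<open>n\<close>; both forms are folded into \<open>moment_bound\<close>.\<close>
    have bound: "(\<lambda>n. R n * C ^ p * (fact p powr (2 + 1 / \<eta>)) * (\<Sum>u = 1..(p - 1) div 2. R n ^ u * \<sigma> n ^ (2 * u) * real p ^ u / (fact u)\<^sup>2))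
      = moment_bound R \<sigma> \<eta> C p" for C and p :: nat
      by (rule ext) (simp add: moment_bound_def)
    have bound': "R n * C ^ p * (fact p powr (2 + 1 / \<eta>)) * (\<Sum>u = 1..(p - 1) div 2. R n ^ u * \<sigma> n ^ (2 * u) * real p ^ u / (fact u)\<^sup>2)
      = moment_bound R \<sigma> \<eta> C p n" for C n and p :: nat
      by (simp add: moment_bound_def)
    show ?thesis
      unfolding Let_def R_def[symmetric] bound bound'
    proof (intro impI)
      assume h: "\<forall>n\<ge>1. 0 < a n" "\<forall>n\<ge>1. 1 \<le> B n" "0 < \<eta>" "1 < v"
        "\<forall>n\<ge>1. \<forall>k\<in>{1..n}. phi_row M N \<zeta> n k \<le> B n * exp (- a n * real k powr \<eta>)"
        "\<forall>n\<ge>n0. 1 \<le> j n \<and> j n < n \<and> phi_row M N \<zeta> n (j n) < 1 / 2 - \<epsilon>0"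
        "R \<in> o(\<lambda>n. \<sigma> n powr (1 / 3))"
      have hyps: "\<And>n. 1 \<le> n \<Longrightarrow> 0 < a n" "\<And>n. 1 \<le> n \<Longrightarrow> 1 \<le> B n"
        "\<And>n k. 1 \<le> n \<Longrightarrow> 1 \<le> k \<Longrightarrow> k \<le> n \<Longrightarrow> phi_row M N \<zeta> n k \<le> B n * exp (- a n * real k powr \<eta>)"
        "\<And>n. n0 \<le> n \<Longrightarrow> 1 \<le> j n \<and> j n < n"
        "R_row M N \<zeta> \<xi> p0 q0 v a B j \<in> o(\<lambda>n. row_sd M \<xi> n powr (1 / 3))"
        using h unfolding R_def sigma_eq by auto
      note facts = hyps(1,2) h(3,4) hyps(3,4,5)
      have est: "\<exists>C>0. \<forall>p>2. \<forall>n\<ge>n0. \<bar>(\<integral>\<omega>. S n \<omega> ^ p \<partial>M) - \<sigma> n ^ p * (\<integral>\<omega>. Z \<omega> ^ p \<partial>Q)\<bar> \<le> moment_bound R \<sigma> \<eta> C p n"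
        using arr.moment_estimate[OF facts] unfolding R_def S_eq sigma_eq .
      have big: "moment_bound R \<sigma> \<eta> C p \<in> O(\<lambda>n. R n ^ p * \<sigma> n ^ (p - 1))" if "0 < C" "2 < p" for C p
        using arr.moment_bound_bigo[OF facts that] unfolding R_def sigma_eq .
      obtain C where C: "C > 0" "\<forall>p>2. \<forall>n\<ge>n0. \<bar>(\<integral>\<omega>. S n \<omega> ^ p \<partial>M) - \<sigma> n ^ p * (\<integral>\<omega>. Z \<omega> ^ p \<partial>Q)\<bar> \<le> moment_bound R \<sigma> \<eta> C p n"
        using est by (elim exE conjE)
      have 1: "\<exists>C>0. \<forall>p>2. (\<forall>n\<ge>n0. \<bar>(\<integral>\<omega>. S n \<omega> ^ p \<partial>M) - \<sigma> n ^ p * (\<integral>\<omega>. Z \<omega> ^ p \<partial>Q)\<bar> \<le> moment_bound R \<sigma> \<eta> C p n) \<and>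
               moment_bound R \<sigma> \<eta> C p \<in> O(\<lambda>n. R n ^ p * \<sigma> n ^ (p - 1))"
      proof (intro exI[of _ C] conjI allI impI C(1))
        fix p :: nat assume p: "2 < p"
        show "\<bar>(\<integral>\<omega>. S n \<omega> ^ p \<partial>M) - \<sigma> n ^ p * (\<integral>\<omega>. Z \<omega> ^ p \<partial>Q)\<bar> \<le> moment_bound R \<sigma> \<eta> C p n" if "n0 \<le> n" for n
          using C(2)[rule_format, OF p that] .
        show "moment_bound R \<sigma> \<eta> C p \<in> O(\<lambda>n. R n ^ p * \<sigma> n ^ (p - 1))" by (rule big[OF C(1) p])
      qed
      have 2: "\<forall>p>2. (\<lambda>n. R n ^ p / \<sigma> n) \<in> o(\<lambda>_. 1) \<longrightarrow>
               (\<lambda>n. \<integral>\<omega>. (S n \<omega> / \<sigma> n) ^ p \<partial>M) \<longlonglongrightarrow> (\<integral>\<omega>. Z \<omega> ^ p \<partial>Q)"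
        unfolding R_def S_eq sigma_eq by (intro allI impI arr.moment_convergence[OF facts])
      have 3: "(\<forall>\<epsilon>>0. R \<in> o(\<lambda>n. \<sigma> n powr \<epsilon>)) \<longrightarrow>
               (\<forall>p. (\<lambda>n. \<integral>\<omega>. (S n \<omega> / \<sigma> n) ^ p \<partial>M) \<longlonglongrightarrow> (\<integral>\<omega>. Z \<omega> ^ p \<partial>Q))"
      proof (intro impI allI)
        fix p assume small: "\<forall>\<epsilon>>0. R \<in> o(\<lambda>n. \<sigma> n powr \<epsilon>)"
        show "(\<lambda>n. \<integral>\<omega>. (S n \<omega> / \<sigma> n) ^ p \<partial>M) \<longlonglongrightarrow> (\<integral>\<omega>. Z \<omega> ^ p \<partial>Q)"
          unfolding S_eq sigma_eq
          by (rule arr.all_moments_convergence[OF facts small[rule_format, unfolded R_def sigma_eq]])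
      qed
      show "(\<exists>C>0. \<forall>p>2. (\<forall>n\<ge>n0. \<bar>(\<integral>\<omega>. S n \<omega> ^ p \<partial>M) - \<sigma> n ^ p * (\<integral>\<omega>. Z \<omega> ^ p \<partial>Q)\<bar> \<le> moment_bound R \<sigma> \<eta> C p n) \<and>
               moment_bound R \<sigma> \<eta> C p \<in> O(\<lambda>n. R n ^ p * \<sigma> n ^ (p - 1))) \<and>
            (\<forall>p>2. (\<lambda>n. R n ^ p / \<sigma> n) \<in> o(\<lambda>_. 1) \<longrightarrow>
               (\<lambda>n. \<integral>\<omega>. (S n \<omega> / \<sigma> n) ^ p \<partial>M) \<longlonglongrightarrow> (\<integral>\<omega>. Z \<omega> ^ p \<partial>Q)) \<and>
            ((\<forall>\<epsilon>>0. R \<in> o(\<lambda>n. \<sigma> n powr \<epsilon>)) \<longrightarrow>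
               (\<forall>p. (\<lambda>n. \<integral>\<omega>. (S n \<omega> / \<sigma> n) ^ p \<partial>M) \<longlonglongrightarrow> (\<integral>\<omega>. Z \<omega> ^ p \<partial>Q)))"
        by (intro conjI 1 2 3)
    qed
  qed
  have part2: "(\<forall>n\<ge>1. \<forall>k\<in>{1..n}. phi_row M N \<zeta> n k \<le> max A 1 * exp (- a * real k powr \<eta>)) \<and>
          (\<exists>j0\<ge>1. \<exists>\<epsilon>0>0. \<forall>n>j0. phi_row M N \<zeta> n j0 < 1 / 2 - \<epsilon>0) \<and>
          (\<forall>j0\<ge>1. (\<exists>\<epsilon>0>0. \<forall>n>j0. phi_row M N \<zeta> n j0 < 1 / 2 - \<epsilon>0) \<longrightarrow>
             (let R = R_row M N \<zeta> \<xi> p0 q0 v (\<lambda>_. a) (\<lambda>_. max A 1) (\<lambda>_. j0) in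
                Bseq R \<and> (\<forall>\<epsilon>>0. R \<in> o(\<lambda>n. \<sigma> n powr \<epsilon>)))) \<and>
          (\<forall>p. (\<lambda>n. \<integral>\<omega>. (S n \<omega> / \<sigma> n) ^ p \<partial>M) \<longlonglongrightarrow> (\<integral>\<omega>. Z \<omega> ^ p \<partial>Q))"
    if h: "A > 0" "a > 0" "\<eta> > 0" "v > 1" "bdd_above (K_inf M \<xi> ` {1..})"
      "\<forall>k\<ge>1. phi_sup M N \<zeta> k \<le> A * exp (- a * real k powr \<eta>)" for A a \<eta> v :: real
  proof -
    have hk: "\<And>k. 1 \<le> k \<Longrightarrow> phi_sup M N \<zeta> k \<le> A * exp (- a * real k powr \<eta>)" using h(6) by blast
    note facts = h(1-5) hk
    have R: "let R = R_row M N \<zeta> \<xi> p0 q0 v (\<lambda>_. a) (\<lambda>_. max A 1) (\<lambda>_. j0) in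
                Bseq R \<and> (\<forall>\<epsilon>>0. R \<in> o(\<lambda>n. \<sigma> n powr \<epsilon>))" for j0
      unfolding Let_def sigma_eq by (intro conjI allI impI arr.uniform_R[OF facts])
    show ?thesis
    proof (intro conjI allI impI ballI)
      show "phi_row M N \<zeta> n k \<le> max A 1 * exp (- a * real k powr \<eta>)" if "1 \<le> n" "k \<in> {1..n}" for n k
        by (rule arr.uniform_phi_row_max[OF facts]) (use that in auto)
      show "\<exists>j0\<ge>1. \<exists>\<epsilon>0>0. \<forall>n>j0. phi_row M N \<zeta> n j0 < 1 / 2 - \<epsilon>0" by (rule arr.small_gap_exists[OF facts])
      show "(\<lambda>n. \<integral>\<omega>. (S n \<omega> / \<sigma> n) ^ p \<partial>M) \<longlonglongrightarrow> (\<integral>\<omega>. Z \<omega> ^ p \<partial>Q)" for p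
        unfolding S_eq sigma_eq by (rule arr.uniform_convergence[OF facts])
    qed (rule R)
  qed
  show ?thesis
    by (rule conjI, intro allI, rule part1, intro allI impI, rule part2) assumption+
qed

end
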